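(* Let $X(\mathbb{R})$ be a reflexive Banach function space such that the Hardy-Littlewood maximal operator $M$ is bounded on $X(\mathbb{R})$ and on its associate space $X'(\mathbb{R})$. Suppose that $\psi$ is an orthonormal $C^1$-wavelet with compact support. Then $\{\psi_{j,k}: j,k\in\mathbb{Z}\}$ is an unconditional basis of $X(\mathbb{R})$, and for every $f\in X(\mathbb{R})$ \[ f=\sum_{j\in\mathbb{Z}}\sum_{k\in\mathbb{Z}}\langle f,\psi_{j,k}\rangle\psi_{j,k}, \] with unconditional convergence in $X(\mathbb{R})$.
   Context: A Banach function norm is a map $\rho$ from nonnegative measurable functions on $\mathbb{R}$ to $[0,\infty]$ that is a norm-like functional ($\rho(f)=0\iff f=0$ a.e., positive homogeneous, subadditive), has the lattice property, the Fatou property ($0\le f_n\uparrow f$ a.e. implies $\rho(f_n)\uparrow\rho(f)$), satisfies $\rho(\chi_E)<\infty$ and $\int_E f\,dx\le C_E\rho(f)$ for every measurable $E$ with $|E|<\infty$. $X(\mathbb{R})$ is the set of measurable $f$ with $\|f\|_{X(\mathbb{R})}:=\rho(|f|)<\infty$; the associate space $X'(\mathbb{R})$ is given by $\rho'(g)=\sup\{\int fg: f\ge0,\ \rho(f)\le1\}$. $M$ is the Hardy-Littlewood maximal operator $(Mf)(x)=\sup_{Q\ni x}\frac1{|Q|}\int_Q|f|$ over bounded intervals $Q\ni x$. A function $\psi\in L^2(\mathbb{R})$ is an orthonormal wavelet if $\psi_{j,k}(x)=2^{j/2}\psi(2^jx-k)$, $j,k\in\mathbb{Z}$, form an orthonormal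 basis of $L^2(\mathbb{R})$. $\langle f,g\rangle=\int_\mathbb{R} f\overline g\,dx$. *)

theory Defs
  imports "HOL-Analysis.Analysis"
begin

definition banach_function_norm :: "((real \<Rightarrow> ennreal) \<Rightarrow> ennreal) \<Rightarrow> bool" where
  "banach_function_norm rho \<longleftrightarrow>
     \<comment> \<open>(P1) norm-like\<close>
     (\<forall>f \<in> borel_measurable lebesgue. rho f = 0 \<longleftrightarrow> (AE x in lebesgue. f x = 0)) \<and>
     (\<forall>f \<in> borel_measurable lebesgue. \<forall>a::real. a \<ge> 0 \<longrightarrow>
         rho (\<lambda>x. ennreal a * f x) = ennreal a * rho f) \<and>
     (\<forall>f \<in> borel_measurable lebesgue. \<forall>g \<in> borel_measurable lebesgue.
         rho (\<lambda>x. f x + g x) \<le> rho f + rho g) \<and>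
     \<comment> \<open>(P2) lattice property\<close>
     (\<forall>f \<in> borel_measurable lebesgue. \<forall>g \<in> borel_measurable lebesgue.
         (AE x in lebesgue. g x \<le> f x) \<longrightarrow> rho g \<le> rho f) \<and>
     \<comment> \<open>(P3) Fatou property\<close>
     (\<forall>F f. (\<forall>n. F n \<in> borel_measurable lebesgue) \<longrightarrow> f \<in> borel_measurable lebesgue \<longrightarrow>
         (AE x in lebesgue. incseq (\<lambda>n. F n x) \<and> (\<lambda>n. F n x) \<longlonglongrightarrow> f x) \<longrightarrow>
         incseq (\<lambda>n. rho (F n)) \<and> (\<lambda>n. rho (F n)) \<longlonglongrightarrow> rho f) \<and>
     \<comment> \<open>(P4) characteristic functions of sets of finite measure\<close>
     (\<forall>E \<in> sets lebesgue. emeasure lebesgue E < \<infinity> \<longrightarrow> rho (indicator E) < \<infinity>) \<and>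
     \<comment> \<open>(P5) local integrability\<close>
     (\<forall>E \<in> sets lebesgue. emeasure lebesgue E < \<infinity> \<longrightarrow>
         (\<exists>C::real. \<forall>f \<in> borel_measurable lebesgue.
             (\<integral>\<^sup>+ x \<in> E. f x \<partial>lebesgue) \<le> ennreal C * rho f))"

definition BFS :: "((real \<Rightarrow> ennreal) \<Rightarrow> ennreal) \<Rightarrow> (real \<Rightarrow> complex) set" where
  "BFS rho = {f. f \<in> borel_measurable lebesgue \<and> rho (\<lambda>x. ennreal (cmod (f x))) < \<infinity>}"

text \<open>The norm of X(R) (used for elements of X(R), where it is finite).\<close>
definition BFS_norm :: "((real \<Rightarrow> ennreal) \<Rightarrow> ennreal) \<Rightarrow> (real \<Rightarrow> complex) \<Rightarrow> real" where
  "BFS_norm rho f = enn2real (rho (\<lambda>x. ennreal (cmod (f x))))"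

definition assoc_norm :: "((real \<Rightarrow> ennreal) \<Rightarrow> ennreal) \<Rightarrow> (real \<Rightarrow> ennreal) \<Rightarrow> ennreal" where
  "assoc_norm rho g =
     (SUP f \<in> {f \<in> borel_measurable lebesgue. rho f \<le> 1}. \<integral>\<^sup>+ x. f x * g x \<partial>lebesgue)"

definition bounded_linear_functional_on ::
    "'a set \<Rightarrow> ('a \<Rightarrow> real) \<Rightarrow> ('a \<Rightarrow> 'a \<Rightarrow> 'a) \<Rightarrow> (complex \<Rightarrow> 'a \<Rightarrow> 'a) \<Rightarrow> ('a \<Rightarrow> complex) \<Rightarrow> bool" where
  "bounded_linear_functional_on V nrm add smul \<phi> \<longleftrightarrow>
     (\<forall>u \<in> V. \<forall>v \<in> V. \<phi> (add u v) = \<phi> u + \<phi> v) \<and>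
     (\<forall>c. \<forall>u \<in> V. \<phi> (smul c u) = c * \<phi> u) \<and>
     (\<exists>C. \<forall>u \<in> V. cmod (\<phi> u) \<le> C * nrm u)"

definition BFS_dual :: "((real \<Rightarrow> ennreal) \<Rightarrow> ennreal) \<Rightarrow> ((real \<Rightarrow> complex) \<Rightarrow> complex) set" where
  "BFS_dual rho = {\<phi>. bounded_linear_functional_on (BFS rho) (BFS_norm rho)
                        (\<lambda>f g x. f x + g x) (\<lambda>c f x. c * f x) \<phi>}"

definition BFS_dual_norm ::
    "((real \<Rightarrow> ennreal) \<Rightarrow> ennreal) \<Rightarrow> ((real \<Rightarrow> complex) \<Rightarrow> complex) \<Rightarrow> real" where
  "BFS_dual_norm rho \<phi> = Sup {cmod (\<phi> f) | f. f \<in> BFS rho \<and> BFS_norm rho f \<le> 1}"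

definition reflexive_BFS :: "((real \<Rightarrow> ennreal) \<Rightarrow> ennreal) \<Rightarrow> bool" where
  "reflexive_BFS rho \<longleftrightarrow>
     (\<forall>\<Phi>. bounded_linear_functional_on (BFS_dual rho) (BFS_dual_norm rho)
              (\<lambda>\<phi> \<psi> f. \<phi> f + \<psi> f) (\<lambda>c \<phi> f. c * \<phi> f) \<Phi> \<longrightarrow>
          (\<exists>f \<in> BFS rho. \<forall>\<phi> \<in> BFS_dual rho. \<Phi> \<phi> = \<phi> f))"

definition maximal_op :: "(real \<Rightarrow> complex) \<Rightarrow> real \<Rightarrow> ennreal" where
  "maximal_op f x =
     (SUP Q \<in> {(a, b). a < b \<and> a \<le> x \<and> x \<le> b}.
        (\<integral>\<^sup>+ y \<in> {fst Q..snd Q}. ennreal (cmod (f y)) \<partial>lebesgue) / ennreal (snd Q - fst Q))"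

definition maximal_bounded :: "((real \<Rightarrow> ennreal) \<Rightarrow> ennreal) \<Rightarrow> bool" where
  "maximal_bounded rho \<longleftrightarrow>
     (\<exists>C::real. C \<ge> 0 \<and> (\<forall>f \<in> BFS rho. maximal_op f \<in> borel_measurable lebesgue \<and>
        rho (maximal_op f) \<le> ennreal C * rho (\<lambda>x. ennreal (cmod (f x)))))"

definition L2_space :: "(real \<Rightarrow> complex) set" where
  "L2_space = {f. f \<in> borel_measurable lebesgue \<and> integrable lebesgue (\<lambda>x. (cmod (f x))\<^sup>2)}"

definition L2_inner :: "(real \<Rightarrow> complex) \<Rightarrow> (real \<Rightarrow> complex) \<Rightarrow> complex" where
  "L2_inner f g = (LINT x|lebesgue. f x * cnj (g x))"

definition L2_norm :: "(real \<Rightarrow> complex) \<Rightarrow> real" where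
  "L2_norm f = sqrt (LINT x|lebesgue. (cmod (f x))\<^sup>2)"

definition wavelet_fam :: "(real \<Rightarrow> complex) \<Rightarrow> int \<times> int \<Rightarrow> real \<Rightarrow> complex" where
  "wavelet_fam \<psi> jk x =
     complex_of_real (2 powr (real_of_int (fst jk) / 2)) *
       \<psi> (2 powr real_of_int (fst jk) * x - real_of_int (snd jk))"

definition orthonormal_wavelet :: "(real \<Rightarrow> complex) \<Rightarrow> bool" where
  "orthonormal_wavelet \<psi> \<longleftrightarrow>
     \<psi> \<in> L2_space \<and>
     (\<forall>i i'. L2_inner (wavelet_fam \<psi> i) (wavelet_fam \<psi> i') = (if i = i' then 1 else 0)) \<and>
     (\<forall>f \<in> L2_space. \<forall>\<epsilon>>0. \<exists>F c. finite F \<and>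
        L2_norm (\<lambda>x. f x - (\<Sum>i\<in>F. c i * wavelet_fam \<psi> i x)) < \<epsilon>)"

definition uncond_conv ::
    "((real \<Rightarrow> ennreal) \<Rightarrow> ennreal) \<Rightarrow> (int \<times> int \<Rightarrow> real \<Rightarrow> complex) \<Rightarrow> (int \<times> int \<Rightarrow> complex)
       \<Rightarrow> (real \<Rightarrow> complex) \<Rightarrow> bool" where
  "uncond_conv rho e c f \<longleftrightarrow>
     (\<forall>\<sigma> :: nat \<Rightarrow> int \<times> int. bij \<sigma> \<longrightarrow>
        (\<lambda>n. rho (\<lambda>x. ennreal (cmod (f x - (\<Sum>m<n. c (\<sigma> m) * e (\<sigma> m) x))))) \<longlonglongrightarrow> 0)"

definition unconditional_basis ::
    "((real \<Rightarrow> ennreal) \<Rightarrow> ennreal) \<Rightarrow> (int \<times> int \<Rightarrow> real \<Rightarrow> complex) \<Rightarrow> bool" where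
  "unconditional_basis rho e \<longleftrightarrow>
     (\<forall>i. e i \<in> BFS rho) \<and> (\<forall>f \<in> BFS rho. \<exists>!c. uncond_conv rho e c f)"

end

theory Submission
  imports Defs
begin

text \<open>Finite partial sums \<open>S\<^sub>F f = (\<Sum>i\<in>F. \<langle>f, \<psi>\<^sub>i\<rangle> \<psi>\<^sub>i)\<close> of the wavelet expansion are bounded on X uniformly in F. By the
  Lorentz-Luxemburg theorem it suffices to bound \<open>\<Sum>i\<in>F. \<bar>\<langle>f, \<psi>\<^sub>i\<rangle> \<langle>g, \<psi>\<^sub>i\<rangle>\<bar>\<close> by a multiple of \<open>\<integral> Mf Mg\<close>, because
  Hoelder's inequality and the boundedness of M on X and X' do the rest. That bound is local: the indices are sorted
  by the sizes of Mf and Mg on their dyadic intervals, and among indices for which all averages of f over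
  larger intervals are at most \<open>\<lambda>\<close> one has \<open>\<Sum> \<bar>\<langle>f, \<psi>\<^sub>i\<rangle>\<bar>\<^sup>2 \<le> C \<lambda>\<^sup>2 \<bar>\<Union> I\<^sub>i\<bar>\<close>, by orthonormality of the wavelets and their Lipschitz
  bounds on a Whitney-type partition. Convergence follows from uniform boundedness: if \<open>\<parallel>f - S\<^sub>n f\<parallel>\<close> did not tend
  to 0, the Hahn-Banach theorem applied to the seminorm \<open>limsup \<parallel>u - S\<^sub>n u\<parallel>\<close> would give a bounded functional that
  vanishes on all wavelets but not at f, whereas by reflexivity bounded sequences that are null when tested against bounded
  functions of bounded support are weakly null, and \<open>S\<^sub>n f\<close> tends to f in \<open>L\<^sup>2\<close> for such f.\<close>

section \<open>The Hahn-Banach theorem for seminorms on function spaces\<close>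

text \<open>The obstacle is that Mf controls only L1 averages of f, while orthonormality is an L2
  statement and f need not be locally square integrable. So f is paired with the combination u of
  wavelets whose coefficients are those of f. On an interval shorter than every wavelet support that
  it meets, u is nearly constant, so its supremum there may be traded for its infimum, which the L2
  norm of u controls. Cancellation of the wavelets enters only through their orthonormality. The
  size of a maximal function on an interval is taken to be its infimum there: this still dominates
  the averages over all larger intervals, and the interval lies inside the corresponding superlevel
  set. In the final argument a functional that is blind to the wavelets is followed from the
  wavelets to test functions, and from test functions to f, by weak convergence alone. Spaces are
  plain sets of functions with null functions not factored out, so Hahn-Banach is stated for
  seminorms; complex functions on an arbitrary type cover both X and its dual, whose elements are
  again complex functions.\<close>

definition fun_subspace :: "('a \<Rightarrow> complex) set \<Rightarrow> bool" where
  "fun_subspace V \<longleftrightarrow> V \<noteq> {} \<and> (\<forall>u\<in>V. \<forall>v\<in>V. (\<lambda>x. u x + v x) \<in> V) \<and>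
     (\<forall>c. \<forall>u\<in>V. (\<lambda>x. c * u x) \<in> V)"

text \<open>Homogeneity is demanded for real t \<ge> 0 only: the separation takes place over the
  reals, and complex linearity is restored afterwards.\<close>

definition sublinear_on :: "('a \<Rightarrow> complex) set \<Rightarrow> (('a \<Rightarrow> complex) \<Rightarrow> real) \<Rightarrow> bool" where
  "sublinear_on V p \<longleftrightarrow> (\<forall>u\<in>V. \<forall>v\<in>V. p (\<lambda>x. u x + v x) \<le> p u + p v) \<and>
     (\<forall>t\<ge>0. \<forall>u\<in>V. p (\<lambda>x. of_real t * u x) = t * p u)"

lemma mult_cnj_sgn: "z * cnj (sgn z) = complex_of_real (cmod z)"
proof (cases "z = 0")
  case False
  have "z * cnj (sgn z) = (z * cnj z) / of_real (cmod z)"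
    by (simp add: sgn_div_norm scaleR_conv_of_real divide_inverse)
  also have "\<dots> = of_real ((cmod z)\<^sup>2) / of_real (cmod z)" unfolding complex_norm_square ..
  finally show ?thesis using False by (simp add: power2_eq_square)
qed simp

lemma fun_subspaceD:
  assumes "fun_subspace V"
  shows "u \<in> V \<Longrightarrow> v \<in> V \<Longrightarrow> (\<lambda>x. u x + v x) \<in> V" "u \<in> V \<Longrightarrow> (\<lambda>x. c * u x) \<in> V"
  using assms by (auto simp: fun_subspace_def)

lemma fun_subspace_uminus: "fun_subspace V \<Longrightarrow> u \<in> V \<Longrightarrow> (\<lambda>x. - u x) \<in> V"
  using fun_subspaceD(2)[of V u "-1"] by simp

lemma fun_subspace_diff:
  "fun_subspace V \<Longrightarrow> u \<in> V \<Longrightarrow> v \<in> V \<Longrightarrow> (\<lambda>x. u x - v x) \<in> V"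
  using fun_subspaceD(1)[of V u "\<lambda>x. - v x"] fun_subspace_uminus[of V v] by simp

lemma fun_subspace_zero: "fun_subspace V \<Longrightarrow> (\<lambda>x. 0) \<in> V"
  using fun_subspaceD(2)[of V _ 0] by (auto simp: fun_subspace_def)

lemma fun_subspace_sum:
  assumes "fun_subspace V" "finite F" "\<And>i. i \<in> F \<Longrightarrow> e i \<in> V"
  shows "(\<lambda>x. \<Sum>i\<in>F. c i * e i x) \<in> V"
  using assms(2,3)
proof (induction F)
  case empty
  then show ?case using fun_subspace_zero[OF assms(1)] by simp
next
  case (insert i F)
  then show ?case
    using fun_subspaceD(1)[OF assms(1), of "\<lambda>x. c i * e i x" "\<lambda>x. \<Sum>i\<in>F. c i * e i x"]
      fun_subspaceD(2)[OF assms(1), of "e i" "c i"] by simp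
qed

lemma sublinear_onD:
  assumes "sublinear_on V p"
  shows "u \<in> V \<Longrightarrow> v \<in> V \<Longrightarrow> p (\<lambda>x. u x + v x) \<le> p u + p v"
    "t \<ge> 0 \<Longrightarrow> u \<in> V \<Longrightarrow> p (\<lambda>x. of_real t * u x) = t * p u"
  using assms by (auto simp: sublinear_on_def)

lemma sublinear_on_lower:
  assumes "fun_subspace V" "sublinear_on V p" "u \<in> V"
  shows "- p (\<lambda>x. - u x) \<le> p u"
proof -
  have "p (\<lambda>x. u x + - u x) \<le> p u + p (\<lambda>x. - u x)"
    using assms sublinear_onD(1) fun_subspace_uminus by fastforce
  moreover have "p (\<lambda>x. 0) = 0"
    using sublinear_onD(2)[OF assms(2) order_refl assms(3)] by simp
  ultimately show ?thesis by simp
qed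

lemma sublinear_on_zero: "fun_subspace V \<Longrightarrow> sublinear_on V p \<Longrightarrow> p (\<lambda>x. 0) = 0"
  using sublinear_onD(2)[of V p 0 "\<lambda>x. 0"] fun_subspace_zero[of V] by simp

text \<open>Homogeneity follows from the inequality, applied to t and to 1/t.\<close>
lemma sublinear_onI:
  assumes V: "fun_subspace V"
    and add: "\<And>u v. u \<in> V \<Longrightarrow> v \<in> V \<Longrightarrow> p (\<lambda>x. u x + v x) \<le> p u + p v"
    and zero: "p (\<lambda>x. 0) = 0"
    and scale: "\<And>t u. t > 0 \<Longrightarrow> u \<in> V \<Longrightarrow> p (\<lambda>x. of_real t * u x) \<le> t * p u"
  shows "sublinear_on V p"
  unfolding sublinear_on_def
proof (intro conjI ballI allI impI)
  fix t :: real and u assume t: "0 \<le> t" and u: "u \<in> V"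
  show "p (\<lambda>x. of_real t * u x) = t * p u"
  proof (cases "t = 0")
    case True
    then show ?thesis using zero by simp
  next
    case False
    then have t: "t > 0" using t by simp
    have "p (\<lambda>x. of_real (1/t) * (of_real t * u x)) \<le> (1/t) * p (\<lambda>x. of_real t * u x)"
      using t by (intro scale fun_subspaceD(2)[OF V] u) auto
    also have "(\<lambda>x. of_real (1/t) * (of_real t * u x)) = u"
      using t by (auto simp: fun_eq_iff)
    finally have "t * p u \<le> p (\<lambda>x. of_real t * u x)" using t by (simp add: field_simps)
    then show ?thesis using scale[OF t u] by simp
  qed
qed (use add in auto)

text \<open>The witness is the infimum over t \<ge> 0 of p (v + t u) - t p u; t = 0 gives q \<le> p,
  and t = 1 at -u gives the third property. It serves twice: to force the value at a chosen point,
  and to show that a functional admitting no smaller one is odd. The value 0 outside V makes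
  equality of such functionals equality of HOL functions.\<close>

lemma sublinear_on_shift:
  assumes V: "fun_subspace V" and p: "sublinear_on V p" and u: "u \<in> V"
  obtains q where "sublinear_on V q" "\<And>v. v \<in> V \<Longrightarrow> q v \<le> p v" "q (\<lambda>x. - u x) \<le> - p u"
    "\<And>v. v \<notin> V \<Longrightarrow> q v = 0"
proof -
  define S where "S = (\<lambda>v. (\<lambda>t::real. p (\<lambda>x. v x + of_real t * u x) - t * p u) ` {0..})"
  have tu: "(\<lambda>x. of_real t * u x) \<in> V" for t by (intro fun_subspaceD(2)[OF V] u)
  have vt: "(\<lambda>x. v x + of_real t * u x) \<in> V" if "v \<in> V" for v t
    by (rule fun_subspaceD(1)[OF V that tu])
  have lb: "- p (\<lambda>x. - v x) \<le> y" if "v \<in> V" "y \<in> S v" for v y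
  proof -
    obtain t where t: "t \<ge> 0" "y = p (\<lambda>x. v x + of_real t * u x) - t * p u"
      using \<open>y \<in> S v\<close> by (auto simp: S_def)
    have "p (\<lambda>x. (v x + of_real t * u x) + - v x) \<le> p (\<lambda>x. v x + of_real t * u x) + p (\<lambda>x. - v x)"
      by (intro sublinear_onD(1)[OF p] vt that fun_subspace_uminus[OF V])
    also have "(\<lambda>x. (v x + of_real t * u x) + - v x) = (\<lambda>x. of_real t * u x)" by auto
    also have "p \<dots> = t * p u" by (rule sublinear_onD(2)[OF p t(1) u])
    finally show ?thesis using t(2) by simp
  qed
  have bdd: "bdd_below (S v)" if "v \<in> V" for v by (rule bdd_belowI) (rule lb[OF that])
  have ne: "S v \<noteq> {}" for v by (auto simp: S_def)
  have mem: "p (\<lambda>x. v x + of_real t * u x) - t * p u \<in> S v" if "t \<ge> 0" for v t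
    using that by (auto simp: S_def)
  define q where "q = (\<lambda>v. if v \<in> V then Inf (S v) else 0)"
  have qle: "q v \<le> p (\<lambda>x. v x + of_real t * u x) - t * p u" if "v \<in> V" "t \<ge> 0" for v t
    using cInf_lower[OF mem[OF that(2)] bdd[OF that(1)]] that by (simp add: q_def)
  have qge: "c \<le> q v" if "v \<in> V" "\<And>t. t \<ge> 0 \<Longrightarrow> c \<le> p (\<lambda>x. v x + of_real t * u x) - t * p u" for v c
    using cInf_greatest[OF ne[of v], of c] that by (auto simp: q_def S_def)
  show ?thesis
  proof (rule that)
    show "sublinear_on V q"
    proof (rule sublinear_onI[OF V])
      fix v w assume vw: "v \<in> V" "w \<in> V"
      have vw': "(\<lambda>x. v x + w x) \<in> V" using vw by (rule fun_subspaceD(1)[OF V])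
      have *: "q (\<lambda>x. v x + w x) \<le> (p (\<lambda>x. v x + of_real s * u x) - s * p u) + (p (\<lambda>x. w x + of_real t * u x) - t * p u)"
        if st: "s \<ge> 0" "t \<ge> 0" for s t
      proof -
        have "q (\<lambda>x. v x + w x) \<le> p (\<lambda>x. v x + w x + of_real (s + t) * u x) - (s + t) * p u"
          using qle[OF vw', of "s + t"] st by simp
        also have "(\<lambda>x. v x + w x + of_real (s + t) * u x) = (\<lambda>x. (v x + of_real s * u x) + (w x + of_real t * u x))"
          by (auto simp: algebra_simps)
        also have "p \<dots> \<le> p (\<lambda>x. v x + of_real s * u x) + p (\<lambda>x. w x + of_real t * u x)"
          by (intro sublinear_onD(1)[OF p] vt vw)
        finally show ?thesis by (simp add: algebra_simps)
      qed
      have "q (\<lambda>x. v x + w x) - (p (\<lambda>x. v x + of_real s * u x) - s * p u) \<le> q w" if "s \<ge> 0" for s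
        using *[OF that] by (intro qge vw) (simp add: algebra_simps)
      then have "q (\<lambda>x. v x + w x) - q w \<le> p (\<lambda>x. v x + of_real s * u x) - s * p u" if "s \<ge> 0" for s
        using that by (simp add: algebra_simps)
      then have "q (\<lambda>x. v x + w x) - q w \<le> q v" by (intro qge vw)
      then show "q (\<lambda>x. v x + w x) \<le> q v + q w" by simp
    next
      have z: "(\<lambda>x. 0) \<in> V" by (rule fun_subspace_zero[OF V])
      have "q (\<lambda>x. 0) \<le> 0" using qle[OF z, of 0] sublinear_on_zero[OF V p] by simp
      moreover have "0 \<le> q (\<lambda>x. 0)"
        using sublinear_onD(2)[OF p _ u] by (intro qge z) simp
      ultimately show "q (\<lambda>x. 0) = 0" by simp
    next
      fix t :: real and v assume t: "t > 0" and v: "v \<in> V"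
      have tv: "(\<lambda>x. of_real t * v x) \<in> V" by (intro fun_subspaceD(2)[OF V] v)
      have "q (\<lambda>x. of_real t * v x) / t \<le> p (\<lambda>x. v x + of_real s * u x) - s * p u" if s: "s \<ge> 0" for s
      proof -
        have "q (\<lambda>x. of_real t * v x) \<le> p (\<lambda>x. of_real t * v x + of_real (t * s) * u x) - (t * s) * p u"
          using t s by (intro qle tv) simp
        also have "(\<lambda>x. of_real t * v x + of_real (t * s) * u x) = (\<lambda>x. of_real t * (v x + of_real s * u x))"
          by (auto simp: algebra_simps)
        also have "p \<dots> = t * p (\<lambda>x. v x + of_real s * u x)"
          using t by (intro sublinear_onD(2)[OF p] vt v) simp
        finally show ?thesis using t by (simp add: field_simps)
      qed
      then have "q (\<lambda>x. of_real t * v x) / t \<le> q v" by (intro qge v)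
      then show "q (\<lambda>x. of_real t * v x) \<le> t * q v" using t by (simp add: field_simps)
    qed
    show "q v \<le> p v" if "v \<in> V" for v using qle[OF that, of 0] by simp
    show "q (\<lambda>x. - u x) \<le> - p u"
      using qle[OF fun_subspace_uminus[OF V u], of 1] sublinear_on_zero[OF V p] by simp
    show "q v = 0" if "v \<notin> V" for v using that by (simp add: q_def)
  qed
qed

text \<open>Zorn's lemma in the reversed order. A chain has its pointwise infimum as a lower bound,
  which is finite because every member stays above \<open>- p0 (\<lambda>x. - u x)\<close>.\<close>

lemma minimal_sublinear_exists:
  assumes V: "fun_subspace V" and p0: "sublinear_on V p0" "\<And>v. v \<notin> V \<Longrightarrow> p0 v = 0"
  obtains p where "sublinear_on V p" "\<And>v. v \<in> V \<Longrightarrow> p v \<le> p0 v" "\<And>v. v \<notin> V \<Longrightarrow> p v = 0"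
    "\<And>q. sublinear_on V q \<Longrightarrow> (\<And>v. v \<in> V \<Longrightarrow> q v \<le> p v) \<Longrightarrow> (\<And>v. v \<notin> V \<Longrightarrow> q v = 0) \<Longrightarrow> q = p"
proof -
  define A where "A = {p. sublinear_on V p \<and> p \<le> p0 \<and> (\<forall>v. v \<notin> V \<longrightarrow> p v = 0)}"
  define P where "P = (\<lambda>p q :: ('a \<Rightarrow> complex) \<Rightarrow> real. q \<le> p)"
  have "\<exists>m\<in>A. \<forall>a\<in>A. P m a \<longrightarrow> a = m"
  proof (rule predicate_Zorn)
    show "partial_order_on A (relation_of P A)"
      by (auto simp: partial_order_on_def preorder_on_def relation_of_def P_def refl_on_def trans_def antisym_def)
  next
    fix C assume C: "C \<in> Chains (relation_of P A)"
    then have CA: "C \<subseteq> A" by (rule Chains_relation_of)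
    have tot: "p \<le> q \<or> q \<le> p" if "p \<in> C" "q \<in> C" for p q
      using C that by (auto simp: Chains_def relation_of_def P_def)
    show "\<exists>u\<in>A. \<forall>a\<in>C. P a u"
    proof (cases "C = {}")
      case True
      then show ?thesis using p0 by (intro bexI[of _ p0]) (auto simp: A_def)
    next
      case False
      have CD: "sublinear_on V p" "p u \<le> p0 u" "v \<notin> V \<Longrightarrow> p v = 0" if "p \<in> C" for p u v
        using that CA by (auto simp: A_def le_fun_def)
      define q where "q = (\<lambda>u. INF p\<in>C. p u)"
      have bdd: "bdd_below ((\<lambda>p. p u) ` C)" for u
      proof (cases "u \<in> V")
        case True
        have "- p0 (\<lambda>x. - u x) \<le> p u" if "p \<in> C" for p
          using sublinear_on_lower[OF V CD(1)[OF that] True] CD(2)[OF that, of "\<lambda>x. - u x"] by simp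
        then show ?thesis by (auto intro!: bdd_belowI)
      next
        case False
        then show ?thesis by (auto intro!: bdd_belowI[of _ 0] simp: CD(3))
      qed
      have qle: "q u \<le> p u" if "p \<in> C" for p u
        unfolding q_def by (rule cINF_lower[OF bdd that])
      have qlt: "\<exists>p\<in>C. p u < q u + e" if "e > 0" for u e
        using cInf_lessD[of "(\<lambda>p. p u) ` C" "q u + e"] False that by (auto simp: q_def)
      have "sublinear_on V q"
      proof (rule sublinear_onI[OF V])
        fix u v assume uv: "u \<in> V" "v \<in> V"
        show "q (\<lambda>x. u x + v x) \<le> q u + q v"
        proof (rule field_le_epsilon)
          fix e :: real assume "e > 0"
          then obtain p1 p2 where p12: "p1 \<in> C" "p2 \<in> C" "p1 u < q u + e/2" "p2 v < q v + e/2"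
            using qlt[of "e/2"] by (metis half_gt_zero)
          \<comment> \<open>Two near-optimal members of the chain may differ; the smaller of them
            serves both points at once, which makes the infimum subadditive.\<close>
          then obtain p where p: "p \<in> C" "p \<le> p1" "p \<le> p2" using tot by (metis order_refl)
          have "q (\<lambda>x. u x + v x) \<le> p u + p v"
            using qle[OF p(1), of "\<lambda>x. u x + v x"] sublinear_onD(1)[OF CD(1)[OF p(1)] uv] by linarith
          then show "q (\<lambda>x. u x + v x) \<le> q u + q v + e"
            using p12(3,4) le_funD[OF p(2), of u] le_funD[OF p(3), of v] by linarith
        qed
      next
        have "p (\<lambda>x. 0) = 0" if "p \<in> C" for p by (rule sublinear_on_zero[OF V CD(1)[OF that]])
        then have "(\<lambda>p. p (\<lambda>x. 0)) ` C = {0}" using False by (force simp: image_iff)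
        then show "q (\<lambda>x. 0) = 0" by (simp add: q_def)
      next
        fix t :: real and u assume t: "t > 0" and u: "u \<in> V"
        have "q (\<lambda>x. of_real t * u x) / t \<le> q u"
          unfolding q_def[of ] using False
        proof (intro cINF_greatest)
          fix p assume p: "p \<in> C"
          have "q (\<lambda>x. of_real t * u x) \<le> t * p u"
            using qle[OF p, of "\<lambda>x. of_real t * u x"] sublinear_onD(2)[OF CD(1)[OF p] less_imp_le[OF t] u] by simp
          then show "(INF p\<in>C. p (\<lambda>x. of_real t * u x)) / t \<le> p u"
            using t by (simp add: q_def field_simps)
        qed
        then show "q (\<lambda>x. of_real t * u x) \<le> t * q u" using t by (simp add: field_simps)
      qed
      moreover have "q \<le> p0"
      proof -
        obtain p where "p \<in> C" using False by blast
        then show ?thesis using qle CD(2) by (intro le_funI) (meson order_trans)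
      qed
      moreover have "q v = 0" if "v \<notin> V" for v
      proof -
        have "(\<lambda>p. p v) ` C = {0}" using False CD(3)[OF _ that] by (force simp: image_iff)
        then show ?thesis by (simp add: q_def)
      qed
      ultimately show ?thesis using qle by (intro bexI[of _ q]) (auto simp: A_def P_def le_fun_def)
    qed
  qed
  then obtain p where p: "p \<in> A" "\<And>q. q \<in> A \<Longrightarrow> q \<le> p \<Longrightarrow> q = p" by (auto simp: P_def)
  show ?thesis
  proof (rule that[of p])
    fix q assume q: "sublinear_on V q" "\<And>v. v \<in> V \<Longrightarrow> q v \<le> p v" "\<And>v. v \<notin> V \<Longrightarrow> q v = 0"
    have le: "q \<le> p"
    proof (rule le_funI)
      fix v show "q v \<le> p v" using q p(1) by (cases "v \<in> V") (auto simp: A_def)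
    qed
    moreover have "q \<in> A" using q le p(1) by (auto simp: A_def)
    ultimately show "q = p" by (intro p(2))
  qed (use p(1) in \<open>auto simp: A_def le_fun_def\<close>)
qed

text \<open>A minimal sublinear functional is linear.\<close>
lemma Hahn_Banach_real:
  assumes V: "fun_subspace V" and p0: "sublinear_on V p0" and u0: "u0 \<in> V"
  obtains r where "\<And>u v. u \<in> V \<Longrightarrow> v \<in> V \<Longrightarrow> r (\<lambda>x. u x + v x) = r u + r v"
    "\<And>t u. u \<in> V \<Longrightarrow> r (\<lambda>x. of_real t * u x) = t * r u"
    "\<And>u. u \<in> V \<Longrightarrow> r u \<le> p0 u" "r u0 = p0 u0"
proof -
  \<comment> \<open>Lowering \<open>p0\<close> at \<open>- u0\<close> to \<open>- p0 u0\<close>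
    before minimising forces every linear functional below \<open>p1\<close> to take the value
    \<open>p0 u0\<close> at \<open>u0\<close>.\<close>
  obtain p1 where p1: "sublinear_on V p1" "\<And>v. v \<in> V \<Longrightarrow> p1 v \<le> p0 v"
     "p1 (\<lambda>x. - u0 x) \<le> - p0 u0" "\<And>v. v \<notin> V \<Longrightarrow> p1 v = 0"
    using sublinear_on_shift[OF V p0 u0] by blast
  obtain r where r: "sublinear_on V r" "\<And>v. v \<in> V \<Longrightarrow> r v \<le> p1 v" "\<And>v. v \<notin> V \<Longrightarrow> r v = 0"
    "\<And>q. sublinear_on V q \<Longrightarrow> (\<And>v. v \<in> V \<Longrightarrow> q v \<le> r v) \<Longrightarrow> (\<And>v. v \<notin> V \<Longrightarrow> q v = 0) \<Longrightarrow> q = r"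
    using minimal_sublinear_exists[OF V p1(1,4)] by blast
  \<comment> \<open>Shifting \<open>r\<close> at \<open>u\<close> yields a sublinear functional
    below \<open>r\<close>, hence \<open>r\<close> itself by minimality; so the value at
    \<open>- u\<close> is at most \<open>- r u\<close>.\<close>
  have neg: "r (\<lambda>x. - u x) = - r u" if u: "u \<in> V" for u
  proof -
    obtain q where "sublinear_on V q" "\<And>v. v \<in> V \<Longrightarrow> q v \<le> r v" "q (\<lambda>x. - u x) \<le> - r u"
      "\<And>v. v \<notin> V \<Longrightarrow> q v = 0" using sublinear_on_shift[OF V r(1) u] by blast
    then have "r (\<lambda>x. - u x) \<le> - r u" using r(4)[of q] by simp
    then show ?thesis using sublinear_on_lower[OF V r(1) u] by simp
  qed
  show ?thesis
  proof (rule that[of r])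
    fix u v assume uv: "u \<in> V" "v \<in> V"
    have "r (\<lambda>x. (u x + v x) + - v x) \<le> r (\<lambda>x. u x + v x) + r (\<lambda>x. - v x)"
      using uv by (intro sublinear_onD(1)[OF r(1)] fun_subspaceD(1)[OF V] fun_subspace_uminus[OF V])
    then have "r u \<le> r (\<lambda>x. u x + v x) - r v" using neg[OF uv(2)] by simp
    then show "r (\<lambda>x. u x + v x) = r u + r v" using sublinear_onD(1)[OF r(1) uv] by simp
  next
    fix t :: real and u assume u: "u \<in> V"
    show "r (\<lambda>x. of_real t * u x) = t * r u"
    proof (cases "t \<ge> 0")
      case True
      then show ?thesis using sublinear_onD(2)[OF r(1) _ u] by simp
    next
      case False
      then have "r (\<lambda>x. of_real (-t) * u x) = (-t) * r u" using sublinear_onD(2)[OF r(1) _ u, of "-t"] by simp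
      moreover have "r (\<lambda>x. - (of_real (- t) * u x)) = - r (\<lambda>x. of_real (-t) * u x)"
        by (rule neg[OF fun_subspaceD(2)[OF V u]])
      ultimately show ?thesis by simp
    qed
  next
    fix u assume u: "u \<in> V"
    show "r u \<le> p0 u" using r(2)[OF u] p1(2)[OF u] by simp
  next
    have "r (\<lambda>x. - u0 x) \<le> - p0 u0" using r(2)[OF fun_subspace_uminus[OF V u0]] p1(3) by simp
    then show "r u0 = p0 u0" using neg[OF u0] r(2)[OF u0] p1(2)[OF u0] by simp
  qed
qed

text \<open>A real linear r below p determines the complex functional r u - i r (i u), whose real
  part is r. Rotation invariance of p carries the bound from the real part to the modulus.\<close>

lemma Hahn_Banach_seminorm:
  assumes V: "fun_subspace V" and u0: "u0 \<in> V"
    and add: "\<And>u v. u \<in> V \<Longrightarrow> v \<in> V \<Longrightarrow> p (\<lambda>x. u x + v x) \<le> p u + p v"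
    and scale: "\<And>c u. u \<in> V \<Longrightarrow> p (\<lambda>x. c * u x) = cmod c * p u"
  obtains \<phi> where "\<And>u v. u \<in> V \<Longrightarrow> v \<in> V \<Longrightarrow> \<phi> (\<lambda>x. u x + v x) = \<phi> u + \<phi> v"
    "\<And>c u. u \<in> V \<Longrightarrow> \<phi> (\<lambda>x. c * u x) = c * \<phi> u"
    "\<And>u. u \<in> V \<Longrightarrow> cmod (\<phi> u) \<le> p u" "\<phi> u0 = of_real (p u0)"
proof -
  have "sublinear_on V p" by (auto simp: sublinear_on_def add scale)
  then obtain r where r: "\<And>u v. u \<in> V \<Longrightarrow> v \<in> V \<Longrightarrow> r (\<lambda>x. u x + v x) = r u + r v"
    "\<And>t u. u \<in> V \<Longrightarrow> r (\<lambda>x. of_real t * u x) = t * r u"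
    "\<And>u. u \<in> V \<Longrightarrow> r u \<le> p u" "r u0 = p u0"
    using Hahn_Banach_real[OF V _ u0] by blast
  define \<phi> where "\<phi> = (\<lambda>u. Complex (r u) (- r (\<lambda>x. \<i> * u x)))"
  have cV: "(\<lambda>x. c * u x) \<in> V" if "u \<in> V" for c u by (rule fun_subspaceD(2)[OF V that])
  have add': "\<phi> (\<lambda>x. u x + v x) = \<phi> u + \<phi> v" if "u \<in> V" "v \<in> V" for u v
    using r(1)[OF that] r(1)[OF cV[OF that(1), of \<i>] cV[OF that(2), of \<i>]]
    by (simp add: \<phi>_def complex_eq_iff algebra_simps)
  have sc: "\<phi> (\<lambda>x. c * u x) = c * \<phi> u" if u: "u \<in> V" for c u
  proof -
    have e1: "(\<lambda>x. c * u x) = (\<lambda>x. of_real (Re c) * u x + of_real (Im c) * (\<i> * u x))"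
      by (subst complex_eq[of c]) (auto simp: algebra_simps)
    have e2: "(\<lambda>x. \<i> * (c * u x)) = (\<lambda>x. of_real (Re c) * (\<i> * u x) + of_real (- Im c) * u x)"
      by (subst complex_eq[of c]) (auto simp: algebra_simps)
    have "r (\<lambda>x. c * u x) = Re c * r u + Im c * r (\<lambda>x. \<i> * u x)"
      unfolding e1 using r(1)[OF cV[OF u] cV[OF cV[OF u]]] r(2)[OF u] r(2)[OF cV[OF u]] by simp
    moreover have "r (\<lambda>x. \<i> * (c * u x)) = Re c * r (\<lambda>x. \<i> * u x) - Im c * r u"
      unfolding e2 r(1)[OF cV[OF cV[OF u]] cV[OF u]] r(2)[OF u] r(2)[OF cV[OF u]] by simp
    ultimately show ?thesis by (simp add: \<phi>_def complex_eq_iff)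
  qed
  have bd: "cmod (\<phi> u) \<le> p u" if u: "u \<in> V" for u
  proof (cases "\<phi> u = 0")
    case True
    have "p (\<lambda>x. u x + (-1) * u x) \<le> p u + p (\<lambda>x. (-1) * u x)" by (intro add u cV)
    then have "0 \<le> p u" using scale[OF u, of "-1"] scale[OF u, of 0] by simp
    then show ?thesis using True by simp
  next
    case False
    \<comment> \<open>A unimodular factor that makes the value real and nonnegative, so that r sees
      all of it.\<close>
    define c where "c = cnj (sgn (\<phi> u))"
    have c1: "cmod c = 1" using False by (simp add: c_def norm_sgn)
    have "c * \<phi> u = of_real (cmod (\<phi> u))" by (simp add: c_def mult.commute mult_cnj_sgn)
    then have "\<phi> (\<lambda>x. c * u x) = of_real (cmod (\<phi> u))" using sc[OF u] by simp
    then have "r (\<lambda>x. c * u x) = cmod (\<phi> u)" by (simp add: \<phi>_def complex_eq_iff)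
    then show ?thesis using r(3)[OF cV[OF u, of c]] scale[OF u, of c] c1 by simp
  qed
  have "\<phi> u0 = of_real (p u0)"
  proof -
    \<comment> \<open>The real part already exhausts the bound \<open>p u0\<close> on the modulus,
      so the imaginary part vanishes.\<close>
    have "Re (\<phi> u0) = p u0" using r(4) by (simp add: \<phi>_def)
    moreover have "(cmod (\<phi> u0))\<^sup>2 \<le> (p u0)\<^sup>2" using bd[OF u0] by (simp add: power_mono)
    ultimately have "Im (\<phi> u0) = 0" by (simp add: cmod_power2)
    then show ?thesis using \<open>Re (\<phi> u0) = p u0\<close> by (simp add: complex_eq_iff)
  qed
  then show ?thesis using that[of \<phi>] add' sc bd by blast
qed

text \<open>Hahn-Banach for the limsup of the seminorms \<open>p n\<close>. It turns failure of
  convergence at one point into a functional that annihilates every point of convergence. It is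
  applied once on the dual of X, producing an element of the bidual, and once on X itself.\<close>

lemma Hahn_Banach_limsup:
  fixes p :: "nat \<Rightarrow> ('a \<Rightarrow> complex) \<Rightarrow> real"
  assumes V: "fun_subspace V" and u0: "u0 \<in> V"
    and nonneg: "\<And>n u. u \<in> V \<Longrightarrow> 0 \<le> p n u"
    and add: "\<And>n u v. u \<in> V \<Longrightarrow> v \<in> V \<Longrightarrow> p n (\<lambda>x. u x + v x) \<le> p n u + p n v"
    and scale: "\<And>n c u. u \<in> V \<Longrightarrow> p n (\<lambda>x. c * u x) = cmod c * p n u"
    and not0: "\<not> (\<lambda>n. p n u0) \<longlonglongrightarrow> 0"
    and bdd: "\<And>n u. u \<in> V \<Longrightarrow> p n u \<le> B u"
  obtains \<phi> where "\<And>u v. u \<in> V \<Longrightarrow> v \<in> V \<Longrightarrow> \<phi> (\<lambda>x. u x + v x) = \<phi> u + \<phi> v"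
    "\<And>c u. u \<in> V \<Longrightarrow> \<phi> (\<lambda>x. c * u x) = c * \<phi> u"
    "\<And>u. u \<in> V \<Longrightarrow> cmod (\<phi> u) \<le> B u" "\<phi> u0 \<noteq> 0"
    "\<And>u. u \<in> V \<Longrightarrow> (\<lambda>n. p n u) \<longlonglongrightarrow> 0 \<Longrightarrow> \<phi> u = 0"
proof -
  \<comment> \<open>\<open>q\<close> is the limsup, written as the infimum of the eventual upper
    bounds; r \<ge> 0 keeps these bounded below, and \<open>B u\<close> keeps the set
    nonempty.\<close>
  define S where "S = (\<lambda>u. {r. r \<ge> 0 \<and> (\<forall>\<^sub>F n in sequentially. p n u \<le> r)})"
  define q where "q = (\<lambda>u. Inf (S u))"
  have BS: "B u \<in> S u" if "u \<in> V" for u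
    using bdd[OF that] nonneg[OF that] unfolding S_def by (auto intro: order_trans)
  have bb: "bdd_below (S u)" for u by (auto simp: S_def intro: bdd_belowI[of _ 0])
  have qle: "q u \<le> r" if "r \<ge> 0" "\<forall>\<^sub>F n in sequentially. p n u \<le> r" for u r
    unfolding q_def using that by (intro cInf_lower bb) (simp add: S_def)
  have qge: "r \<le> q u" if "u \<in> V" "\<And>s. s \<ge> 0 \<Longrightarrow> \<forall>\<^sub>F n in sequentially. p n u \<le> s \<Longrightarrow> r \<le> s" for u r
    unfolding q_def using that BS[OF that(1)] by (intro cInf_greatest) (auto simp: S_def)
  have q0: "0 \<le> q u" if "u \<in> V" for u by (rule qge[OF that])
  have qadd: "q (\<lambda>x. u x + v x) \<le> q u + q v" if uv: "u \<in> V" "v \<in> V" for u v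
  proof -
    have *: "q (\<lambda>x. u x + v x) \<le> s + t" if "s \<ge> 0" "\<forall>\<^sub>F n in sequentially. p n u \<le> s"
       "t \<ge> 0" "\<forall>\<^sub>F n in sequentially. p n v \<le> t" for s t
    proof (rule qle)
      show "\<forall>\<^sub>F n in sequentially. p n (\<lambda>x. u x + v x) \<le> s + t"
        using that(2,4) by eventually_elim (use add[OF uv] in \<open>smt (verit)\<close>)
    qed (use that in auto)
    have "q (\<lambda>x. u x + v x) - t \<le> q u" if "t \<ge> 0" "\<forall>\<^sub>F n in sequentially. p n v \<le> t" for t
      using *[OF _ _ that] by (intro qge uv) (simp add: algebra_simps)
    then have "q (\<lambda>x. u x + v x) - q u \<le> t" if "t \<ge> 0" "\<forall>\<^sub>F n in sequentially. p n v \<le> t" for t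
      using that by (simp add: algebra_simps)
    then have "q (\<lambda>x. u x + v x) - q u \<le> q v" by (intro qge uv)
    then show ?thesis by simp
  qed
  have qsc1: "q (\<lambda>x. c * u x) \<le> cmod c * q u" if u: "u \<in> V" and c: "c \<noteq> 0" for c u
  proof -
    have "q (\<lambda>x. c * u x) / cmod c \<le> q u"
    proof (rule qge[OF u])
      fix s assume s: "s \<ge> 0" "\<forall>\<^sub>F n in sequentially. p n u \<le> s"
      have "q (\<lambda>x. c * u x) \<le> cmod c * s"
        using s by (intro qle) (auto simp: scale[OF u] intro: mult_left_mono elim!: eventually_mono)
      then show "q (\<lambda>x. c * u x) / cmod c \<le> s" using c by (simp add: field_simps)
    qed
    then show ?thesis using c by (simp add: field_simps)
  qed
  have qsc: "q (\<lambda>x. c * u x) = cmod c * q u" if u: "u \<in> V" for c u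
  proof (cases "c = 0")
    case True
    have "q (\<lambda>x. 0 * u x) \<le> 0" by (rule qle) (use scale[OF u, of _ 0] in auto)
    then show ?thesis using True q0[OF fun_subspace_zero[OF V]] by simp
  next
    case False
    have "q (\<lambda>x. inverse c * (c * u x)) \<le> cmod (inverse c) * q (\<lambda>x. c * u x)"
      using False by (intro qsc1 fun_subspaceD(2)[OF V u]) auto
    also have "(\<lambda>x. inverse c * (c * u x)) = u" using False by auto
    finally have "cmod c * q u \<le> q (\<lambda>x. c * u x)" using False by (simp add: norm_inverse norm_divide divide_simps mult.commute)
    then show ?thesis using qsc1[OF u False] by simp
  qed
  obtain \<phi> where \<phi>: "\<And>u v. u \<in> V \<Longrightarrow> v \<in> V \<Longrightarrow> \<phi> (\<lambda>x. u x + v x) = \<phi> u + \<phi> v"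
    "\<And>c u. u \<in> V \<Longrightarrow> \<phi> (\<lambda>x. c * u x) = c * \<phi> u"
    "\<And>u. u \<in> V \<Longrightarrow> cmod (\<phi> u) \<le> q u" "\<phi> u0 = of_real (q u0)"
    using Hahn_Banach_seminorm[where p = q, OF V u0 qadd qsc] by blast
  have lim: "(\<lambda>n. p n u) \<longlonglongrightarrow> 0 \<longleftrightarrow> q u = 0" if u: "u \<in> V" for u
  proof
    assume l: "(\<lambda>n. p n u) \<longlonglongrightarrow> 0"
    have "q u \<le> 0 + e" if "e > 0" for e
      using order_tendstoD(2)[OF l that] that by (intro qle) (auto elim: eventually_mono)
    then have "q u \<le> 0" by (rule field_le_epsilon)
    then show "q u = 0" using q0[OF u] by simp
  next
    assume q: "q u = 0"
    show "(\<lambda>n. p n u) \<longlonglongrightarrow> 0"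
    proof (rule order_tendstoI)
      fix a :: real assume "0 < a"
      then have "\<exists>r\<in>S u. r < a" using cInf_lessD[of "S u" a] q BS[OF u] by (auto simp: q_def)
      then show "\<forall>\<^sub>F n in sequentially. p n u < a" by (auto simp: S_def elim: eventually_mono)
    next
      fix a :: real assume "a < 0"
      then show "\<forall>\<^sub>F n in sequentially. a < p n u" using nonneg[OF u] by (auto intro: always_eventually less_le_trans)
    qed
  qed
  show ?thesis
  proof (rule that[OF \<phi>(1,2)])
    show "cmod (\<phi> u) \<le> B u" if "u \<in> V" for u
      using \<phi>(3)[OF that] cInf_lower[OF BS[OF that] bb] by (simp add: q_def)
    show "\<phi> u0 \<noteq> 0" using \<phi>(4) not0 lim[OF u0] by auto
    show "\<phi> u = 0" if "u \<in> V" "(\<lambda>n. p n u) \<longlonglongrightarrow> 0" for u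
      using \<phi>(3)[OF that(1)] lim[OF that(1)] that(2) by simp
  qed
qed

section \<open>Banach function spaces and reflexivity\<close>

text \<open>A common part of X, its associate space and L2: (P4) places these functions in X, and
  (P5) makes them pair with all of X.\<close>

definition test_functions :: "(real \<Rightarrow> complex) set" where
  "test_functions = {G \<in> borel_measurable lebesgue.
     (\<exists>K. \<forall>x. cmod (G x) \<le> K) \<and> (\<exists>R. \<forall>x. \<bar>x\<bar> > R \<longrightarrow> G x = 0)}"

lemma test_functionsI:
  assumes "G \<in> borel_measurable lebesgue" "\<And>x. cmod (G x) \<le> K" "\<And>x. \<bar>x\<bar> > R \<Longrightarrow> G x = 0"
  shows "G \<in> test_functions"
  using assms unfolding test_functions_def by blast

lemma test_functionsE:
  assumes "G \<in> test_functions"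
  obtains K R where "G \<in> borel_measurable lebesgue" "K \<ge> 0" "R \<ge> 0" "\<And>x. cmod (G x) \<le> K"
    "\<And>x. \<bar>x\<bar> > R \<Longrightarrow> G x = 0" "\<And>x. cmod (G x) \<le> K * indicator {-R..R} x"
proof -
  obtain K R where G: "G \<in> borel_measurable lebesgue" "\<And>x. cmod (G x) \<le> K" "\<And>x. \<bar>x\<bar> > R \<Longrightarrow> G x = 0"
    using assms unfolding test_functions_def by blast
  have "K \<ge> 0" using G(2)[of 0] norm_ge_zero order_trans by blast
  moreover have "cmod (G x) \<le> K * indicator {-max R 0..max R 0} x" for x
    using G(2)[of x] G(3)[of x] by (cases "\<bar>x\<bar> > max R 0") (auto simp: indicator_def abs_le_iff)
  ultimately show ?thesis using G by (intro that[of K "max R 0"]) auto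
qed

lemma test_functions_measurable: "G \<in> test_functions \<Longrightarrow> G \<in> borel_measurable lebesgue"
  by (simp add: test_functions_def)

lemma test_functions_subspace: "fun_subspace test_functions"
  unfolding fun_subspace_def
proof (intro conjI ballI allI)
  show "test_functions \<noteq> {}"
    using test_functionsI[of "\<lambda>x. 0" 0 0] by auto
next
  fix f g assume "f \<in> test_functions" "g \<in> test_functions"
  then obtain K R L S where "f \<in> borel_measurable lebesgue" "\<And>x. cmod (f x) \<le> K" "\<And>x. \<bar>x\<bar> > R \<Longrightarrow> f x = 0"
    "g \<in> borel_measurable lebesgue" "\<And>x. cmod (g x) \<le> L" "\<And>x. \<bar>x\<bar> > S \<Longrightarrow> g x = 0"
    by (metis test_functionsE)
  then show "(\<lambda>x. f x + g x) \<in> test_functions"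
    by (intro test_functionsI[of _ "K + L" "max R S"]) (auto intro: norm_triangle_mono)
next
  fix c f assume "f \<in> test_functions"
  then obtain K R where "f \<in> borel_measurable lebesgue" "\<And>x. cmod (f x) \<le> K" "\<And>x. \<bar>x\<bar> > R \<Longrightarrow> f x = 0"
    by (metis test_functionsE)
  then show "(\<lambda>x. c * f x) \<in> test_functions"
    by (intro test_functionsI[of _ "cmod c * K" R]) (auto simp: norm_mult intro: mult_left_mono)
qed

lemma test_functions_mult:
  assumes "f \<in> test_functions" "g \<in> borel_measurable lebesgue" "\<And>x. cmod (g x) \<le> L"
  shows "(\<lambda>x. f x * g x) \<in> test_functions"
proof -
  obtain K R where "f \<in> borel_measurable lebesgue" "\<And>x. cmod (f x) \<le> K" "\<And>x. \<bar>x\<bar> > R \<Longrightarrow> f x = 0"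
    "K \<ge> 0" using assms(1) by (metis test_functionsE)
  then show ?thesis using assms(2,3)
    by (intro test_functionsI[of _ "K * L" R]) (auto simp: norm_mult intro: mult_mono)
qed

lemma sets_lebesgue_Icc [measurable]: "{a..b::real} \<in> sets lebesgue" by simp

lemma borel_measurable_cnj' [measurable]:
  "f \<in> borel_measurable M \<Longrightarrow> (\<lambda>x. cnj (f x)) \<in> borel_measurable M"
  by (rule measurable_compose[of f M borel cnj]) (auto intro!: borel_measurable_continuous_onI continuous_intros)

lemma test_functions_cnj: "f \<in> test_functions \<Longrightarrow> (\<lambda>x. cnj (f x)) \<in> test_functions"
  unfolding test_functions_def by auto

section \<open>Banach function norms: elementary rules and pairings with test functions\<close>

locale banach_fun_norm =
  fixes rho :: "(real \<Rightarrow> ennreal) \<Rightarrow> ennreal"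
  assumes bfn: "banach_function_norm rho"
begin

lemma rho_eq_0: "f \<in> borel_measurable lebesgue \<Longrightarrow> rho f = 0 \<longleftrightarrow> (AE x in lebesgue. f x = 0)"
  and rho_scale: "f \<in> borel_measurable lebesgue \<Longrightarrow> a \<ge> 0 \<Longrightarrow> rho (\<lambda>x. ennreal a * f x) = ennreal a * rho f"
  and rho_add: "f \<in> borel_measurable lebesgue \<Longrightarrow> g \<in> borel_measurable lebesgue \<Longrightarrow>
     rho (\<lambda>x. f x + g x) \<le> rho f + rho g"
  and rho_mono_AE: "f \<in> borel_measurable lebesgue \<Longrightarrow> g \<in> borel_measurable lebesgue \<Longrightarrow>
     (AE x in lebesgue. g x \<le> f x) \<Longrightarrow> rho g \<le> rho f"
  and rho_indicator: "E \<in> sets lebesgue \<Longrightarrow> emeasure lebesgue E < \<infinity> \<Longrightarrow> rho (indicator E) < \<infinity>"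
  and rho_local: "E \<in> sets lebesgue \<Longrightarrow> emeasure lebesgue E < \<infinity> \<Longrightarrow> \<exists>C::real. \<forall>f \<in> borel_measurable lebesgue.
             (\<integral>\<^sup>+ x \<in> E. f x \<partial>lebesgue) \<le> ennreal C * rho f"
  using bfn unfolding banach_function_norm_def by meson+

lemma rho_Fatou:
  assumes "\<And>n. F n \<in> borel_measurable lebesgue" "f \<in> borel_measurable lebesgue"
    "AE x in lebesgue. incseq (\<lambda>n. F n x) \<and> (\<lambda>n. F n x) \<longlonglongrightarrow> f x"
  shows "(\<lambda>n. rho (F n)) \<longlonglongrightarrow> rho f"
proof -
  have "\<forall>F f. (\<forall>n. F n \<in> borel_measurable lebesgue) \<longrightarrow> f \<in> borel_measurable lebesgue \<longrightarrow>
         (AE x in lebesgue. incseq (\<lambda>n. F n x) \<and> (\<lambda>n. F n x) \<longlonglongrightarrow> f x) \<longrightarrow>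
         incseq (\<lambda>n. rho (F n)) \<and> (\<lambda>n. rho (F n)) \<longlonglongrightarrow> rho f"
    using bfn unfolding banach_function_norm_def by (elim conjE)
  then show ?thesis using assms by blast
qed

lemma rho_mono: "f \<in> borel_measurable lebesgue \<Longrightarrow> g \<in> borel_measurable lebesgue \<Longrightarrow>
     (\<And>x. g x \<le> f x) \<Longrightarrow> rho g \<le> rho f"
  by (rule rho_mono_AE) auto

lemma rho_local_interval:
  obtains C :: real where "C \<ge> 0" "\<And>f. f \<in> borel_measurable lebesgue \<Longrightarrow>
     (\<integral>\<^sup>+ x \<in> {-R..R}. f x \<partial>lebesgue) \<le> ennreal C * rho f"
proof -
  have "emeasure lebesgue {-R..R} < \<infinity>" by (simp add: emeasure_lborel_Icc_eq)
  then obtain C :: real where C: "\<forall>f \<in> borel_measurable lebesgue.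
     (\<integral>\<^sup>+ x \<in> {-R..R}. f x \<partial>lebesgue) \<le> ennreal C * rho f"
    using rho_local[of "{-R..R}"] by fastforce
  show ?thesis
  proof (rule that[of "max C 0"])
    fix f :: "real \<Rightarrow> ennreal" assume f: "f \<in> borel_measurable lebesgue"
    have "ennreal C * rho f \<le> ennreal (max C 0) * rho f" by (intro mult_right_mono ennreal_leI) auto
    then show "(\<integral>\<^sup>+ x \<in> {-R..R}. f x \<partial>lebesgue) \<le> ennreal (max C 0) * rho f" using C f order_trans by blast
  qed simp
qed

lemma BFS_measurable: "f \<in> BFS rho \<Longrightarrow> f \<in> borel_measurable lebesgue"
  by (simp add: BFS_def)

lemma ennreal_BFS_norm: "f \<in> BFS rho \<Longrightarrow> ennreal (BFS_norm rho f) = rho (\<lambda>x. ennreal (cmod (f x)))"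
  by (simp add: BFS_def BFS_norm_def ennreal_enn2real)

lemma BFS_norm_nonneg: "0 \<le> BFS_norm rho f" by (simp add: BFS_norm_def)

lemma rho_cmod_scale:
  assumes f: "f \<in> borel_measurable lebesgue"
  shows "rho (\<lambda>x. ennreal (cmod (c * f x))) = ennreal (cmod c) * rho (\<lambda>x. ennreal (cmod (f x)))"
  using rho_scale[of "\<lambda>x. ennreal (cmod (f x))" "cmod c"] f by (simp add: norm_mult ennreal_mult)

lemma rho_cmod_add:
  assumes [measurable]: "f \<in> borel_measurable lebesgue" "g \<in> borel_measurable lebesgue"
  shows "rho (\<lambda>x. ennreal (cmod (f x + g x))) \<le> rho (\<lambda>x. ennreal (cmod (f x))) + rho (\<lambda>x. ennreal (cmod (g x)))"
proof -
  have "rho (\<lambda>x. ennreal (cmod (f x + g x))) \<le> rho (\<lambda>x. ennreal (cmod (f x)) + ennreal (cmod (g x)))"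
    by (intro rho_mono) (auto simp flip: ennreal_plus intro: ennreal_leI norm_triangle_ineq)
  also have "\<dots> \<le> rho (\<lambda>x. ennreal (cmod (f x))) + rho (\<lambda>x. ennreal (cmod (g x)))"
    by (intro rho_add) auto
  finally show ?thesis .
qed

lemma BFS_dominated:
  assumes "f \<in> BFS rho" and [measurable]: "g \<in> borel_measurable lebesgue" and "\<And>x. cmod (g x) \<le> cmod (f x)"
  shows "g \<in> BFS rho" "BFS_norm rho g \<le> BFS_norm rho f"
proof -
  note [measurable] = BFS_measurable[OF assms(1)]
  have le: "rho (\<lambda>x. ennreal (cmod (g x))) \<le> rho (\<lambda>x. ennreal (cmod (f x)))"
    using assms(3) by (intro rho_mono) (auto intro: ennreal_leI)
  moreover have "rho (\<lambda>x. ennreal (cmod (f x))) < \<infinity>" using assms(1) by (simp add: BFS_def)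
  ultimately show "g \<in> BFS rho" by (auto simp: BFS_def)
  show "BFS_norm rho g \<le> BFS_norm rho f"
    unfolding BFS_norm_def using le assms(1) by (intro enn2real_mono) (auto simp: BFS_def)
qed

lemma test_functions_BFS:
  assumes "f \<in> test_functions" shows "f \<in> BFS rho"
proof -
  obtain K R where f: "f \<in> borel_measurable lebesgue" "K \<ge> 0" "R \<ge> 0" "\<And>x. cmod (f x) \<le> K * indicator {-R..R} x"
    using assms by (metis test_functionsE)
  note [measurable] = f(1)
  have "rho (\<lambda>x. ennreal (cmod (f x))) \<le> rho (\<lambda>x. ennreal K * indicator {-R..R} x)"
    using f(2,4) by (intro rho_mono) (auto simp: ennreal_leI ennreal_mult[symmetric] simp flip: ennreal_indicator)
  also have "\<dots> = ennreal K * rho (indicator {-R..R})"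
    using f(2) rho_scale[of "indicator {-R..R}" K] by simp
  also have "\<dots> < \<infinity>" using rho_indicator[of "{-R..R}"]
    by (simp add: ennreal_mult_less_top emeasure_lborel_Icc_eq)
  finally show ?thesis using f(1) by (simp add: BFS_def)
qed

lemma BFS_norm_scale: "f \<in> BFS rho \<Longrightarrow> BFS_norm rho (\<lambda>x. c * f x) = cmod c * BFS_norm rho f"
  using rho_cmod_scale[of f c] BFS_measurable[of f] by (simp add: BFS_norm_def enn2real_mult)

lemma BFS_subspace: "fun_subspace (BFS rho)"
  unfolding fun_subspace_def
proof (intro conjI ballI allI)
  show "BFS rho \<noteq> {}" using test_functions_BFS fun_subspace_zero[OF test_functions_subspace] by blast
next
  fix f g assume "f \<in> BFS rho" "g \<in> BFS rho"
  then show "(\<lambda>x. f x + g x) \<in> BFS rho"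
    using rho_cmod_add[of f g] by (auto simp: BFS_def less_top[symmetric] top_unique)
next
  fix c f assume "f \<in> BFS rho"
  then show "(\<lambda>x. c * f x) \<in> BFS rho"
    using rho_cmod_scale[of f c] by (auto simp: BFS_def ennreal_mult_less_top)
qed

lemma BFS_norm_add:
  assumes "f \<in> BFS rho" "g \<in> BFS rho"
  shows "BFS_norm rho (\<lambda>x. f x + g x) \<le> BFS_norm rho f + BFS_norm rho g"
proof -
  have "ennreal (BFS_norm rho (\<lambda>x. f x + g x)) \<le> ennreal (BFS_norm rho f + BFS_norm rho g)"
    using assms rho_cmod_add[of f g] fun_subspaceD(1)[OF BFS_subspace assms]
    by (simp add: ennreal_BFS_norm BFS_measurable BFS_norm_nonneg)
  then show ?thesis by (simp add: BFS_norm_nonneg del: ennreal_plus)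
qed

lemma BFS_norm_eq_0:
  assumes "f \<in> BFS rho" shows "BFS_norm rho f = 0 \<longleftrightarrow> (AE x in lebesgue. f x = 0)"
proof -
  have "BFS_norm rho f = 0 \<longleftrightarrow> rho (\<lambda>x. ennreal (cmod (f x))) = 0"
    using ennreal_BFS_norm[OF assms] BFS_norm_nonneg[of f] by (metis ennreal_eq_0_iff order_antisym order_refl)
  also have "\<dots> \<longleftrightarrow> (AE x in lebesgue. f x = 0)"
    using BFS_measurable[OF assms] by (subst rho_eq_0) auto
  finally show ?thesis .
qed

text \<open>(P5) on an interval containing the support of G, multiplied by a bound for G. These
  pairings are the concrete bounded functionals behind coefficients and weak convergence.\<close>

lemma BFS_pairing:
  assumes G: "G \<in> test_functions"
  obtains C where "C \<ge> 0" "\<And>f. f \<in> BFS rho \<Longrightarrow> integrable lebesgue (\<lambda>x. f x * G x)"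
    "\<And>f. f \<in> BFS rho \<Longrightarrow> cmod (LINT x|lebesgue. f x * G x) \<le> C * BFS_norm rho f"
proof -
  obtain K R where f: "G \<in> borel_measurable lebesgue" "K \<ge> 0" "R \<ge> 0" "\<And>x. cmod (G x) \<le> K * indicator {-R..R} x"
    using G by (metis test_functionsE)
  note [measurable] = f(1)
  obtain C where C: "C \<ge> 0" "\<And>f. f \<in> borel_measurable lebesgue \<Longrightarrow>
     (\<integral>\<^sup>+ x \<in> {-R..R}. f x \<partial>lebesgue) \<le> ennreal C * rho f" using rho_local_interval[of R] by blast
  have *: "(\<integral>\<^sup>+ x. ennreal (cmod (f x * G x)) \<partial>lebesgue) \<le> ennreal (K * C * BFS_norm rho f)" if fB: "f \<in> BFS rho" for f
  proof -
    note [measurable] = BFS_measurable[OF fB]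
    have "(\<integral>\<^sup>+ x. ennreal (cmod (f x * G x)) \<partial>lebesgue)
       \<le> (\<integral>\<^sup>+ x. ennreal K * (ennreal (cmod (f x)) * indicator {-R..R} x) \<partial>lebesgue)"
    proof (rule nn_integral_mono)
      fix x
      have "cmod (f x * G x) \<le> K * (cmod (f x) * indicator {-R..R} x)"
        using mult_left_mono[OF f(4)[of x] norm_ge_zero[of "f x"]] by (simp add: norm_mult algebra_simps)
      then have "ennreal (cmod (f x * G x)) \<le> ennreal (K * (cmod (f x) * indicator {-R..R} x))" by (rule ennreal_leI)
      also have "\<dots> = ennreal K * (ennreal (cmod (f x)) * indicator {-R..R} x)"
        using f(2) by (simp add: ennreal_mult indicator_def)
      finally show "ennreal (cmod (f x * G x)) \<le> \<dots>" .
    qed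
    also have "\<dots> = ennreal K * (\<integral>\<^sup>+ x \<in> {-R..R}. ennreal (cmod (f x)) \<partial>lebesgue)"
      by (intro nn_integral_cmult) auto
    also have "\<dots> \<le> ennreal K * (ennreal C * ennreal (BFS_norm rho f))"
      unfolding ennreal_BFS_norm[OF fB] by (intro mult_left_mono C(2)) auto
    also have "\<dots> = ennreal (K * C * BFS_norm rho f)"
      using f(2) C(1) by (simp add: ennreal_mult BFS_norm_nonneg mult.assoc)
    finally show ?thesis .
  qed
  have int: "integrable lebesgue (\<lambda>x. f x * G x)" if fB: "f \<in> BFS rho" for f
    unfolding integrable_iff_bounded using *[OF fB] BFS_measurable[OF fB] by (auto simp: less_top[symmetric] top_unique)
  show ?thesis
  proof (rule that[of "K * C"])
    fix f assume fB: "f \<in> BFS rho"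
    have "ennreal (cmod (LINT x|lebesgue. f x * G x)) \<le> (\<integral>\<^sup>+ x. ennreal (cmod (f x * G x)) \<partial>lebesgue)"
      by (rule integral_norm_bound_ennreal[OF int[OF fB]])
    also note *[OF fB]
    finally show "cmod (LINT x|lebesgue. f x * G x) \<le> K * C * BFS_norm rho f"
      using f(2) C(1) by (simp add: BFS_norm_nonneg)
  qed (use f(2) C(1) int in auto)
qed

lemma pairing_BFS_dual:
  assumes "G \<in> test_functions"
  shows "(\<lambda>f. LINT x|lebesgue. f x * G x) \<in> BFS_dual rho"
proof -
  obtain C where C: "C \<ge> 0" "\<And>f. f \<in> BFS rho \<Longrightarrow> integrable lebesgue (\<lambda>x. f x * G x)"
    "\<And>f. f \<in> BFS rho \<Longrightarrow> cmod (LINT x|lebesgue. f x * G x) \<le> C * BFS_norm rho f"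
    using BFS_pairing[OF assms] by blast
  show ?thesis
    unfolding BFS_dual_def bounded_linear_functional_on_def mem_Collect_eq
  proof (intro conjI ballI allI)
    fix u v assume "u \<in> BFS rho" "v \<in> BFS rho"
    then show "(LINT x|lebesgue. (u x + v x) * G x) = (LINT x|lebesgue. u x * G x) + (LINT x|lebesgue. v x * G x)"
      using C(2) by (simp add: distrib_right)
  next
    fix c u assume "u \<in> BFS rho"
    then show "(LINT x|lebesgue. (c * u x) * G x) = c * (LINT x|lebesgue. u x * G x)"
      by (simp add: mult.assoc)
  qed (use C(3) in blast)
qed

section \<open>The dual space and weakly null sequences\<close>

lemma BFS_dualD:
  assumes "\<phi> \<in> BFS_dual rho"
  shows "u \<in> BFS rho \<Longrightarrow> v \<in> BFS rho \<Longrightarrow> \<phi> (\<lambda>x. u x + v x) = \<phi> u + \<phi> v"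
    "u \<in> BFS rho \<Longrightarrow> \<phi> (\<lambda>x. c * u x) = c * \<phi> u"
    "\<exists>C\<ge>0. \<forall>u\<in>BFS rho. cmod (\<phi> u) \<le> C * BFS_norm rho u"
proof -
  obtain C where C: "\<forall>u\<in>BFS rho. cmod (\<phi> u) \<le> C * BFS_norm rho u"
    using assms unfolding BFS_dual_def bounded_linear_functional_on_def by blast
  have "\<forall>u\<in>BFS rho. cmod (\<phi> u) \<le> max C 0 * BFS_norm rho u"
    using C mult_right_mono[OF max.cobounded1[of C 0] BFS_norm_nonneg] order_trans by blast
  then show "\<exists>C\<ge>0. \<forall>u\<in>BFS rho. cmod (\<phi> u) \<le> C * BFS_norm rho u" by (intro exI[of _ "max C 0"]) auto
qed (use assms in \<open>auto simp: BFS_dual_def bounded_linear_functional_on_def\<close>)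

lemma BFS_dualI:
  assumes "\<And>u v. u \<in> BFS rho \<Longrightarrow> v \<in> BFS rho \<Longrightarrow> \<phi> (\<lambda>x. u x + v x) = \<phi> u + \<phi> v"
    "\<And>c u. u \<in> BFS rho \<Longrightarrow> \<phi> (\<lambda>x. c * u x) = c * \<phi> u"
    "\<And>u. u \<in> BFS rho \<Longrightarrow> cmod (\<phi> u) \<le> C * BFS_norm rho u"
  shows "\<phi> \<in> BFS_dual rho"
  using assms unfolding BFS_dual_def bounded_linear_functional_on_def by blast

lemma BFS_dual_diff:
  assumes "\<phi> \<in> BFS_dual rho" "u \<in> BFS rho" "v \<in> BFS rho"
  shows "\<phi> (\<lambda>x. u x - v x) = \<phi> u - \<phi> v"
  using BFS_dualD(1)[OF assms(1,2) fun_subspaceD(2)[OF BFS_subspace assms(3), of "-1"]]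
    BFS_dualD(2)[OF assms(1,3), of "-1"] by simp

lemma BFS_dual_sum:
  assumes \<phi>: "\<phi> \<in> BFS_dual rho" and "finite F" "\<And>i. i \<in> F \<Longrightarrow> e i \<in> BFS rho"
  shows "\<phi> (\<lambda>x. \<Sum>i\<in>F. c i * e i x) = (\<Sum>i\<in>F. c i * \<phi> (e i))"
  using assms(2,3)
proof (induction F)
  case empty
  show ?case using BFS_dualD(2)[OF \<phi> fun_subspace_zero[OF BFS_subspace], of 0] by simp
next
  case (insert i F)
  then show ?case
    using BFS_dualD(1)[OF \<phi> fun_subspaceD(2)[OF BFS_subspace] fun_subspace_sum[OF BFS_subspace], of "e i" F e "c i" c]
      BFS_dualD(2)[OF \<phi>, of "e i" "c i"] by simp
qed

lemma BFS_dual_subspace: "fun_subspace (BFS_dual rho)"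
  unfolding fun_subspace_def
proof (intro conjI ballI allI)
  show "BFS_dual rho \<noteq> {}" using pairing_BFS_dual fun_subspace_zero[OF test_functions_subspace] by blast
next
  fix f g assume fg: "f \<in> BFS_dual rho" "g \<in> BFS_dual rho"
  obtain C D where "\<forall>u\<in>BFS rho. cmod (f u) \<le> C * BFS_norm rho u" "\<forall>u\<in>BFS rho. cmod (g u) \<le> D * BFS_norm rho u"
    using BFS_dualD(3)[OF fg(1)] BFS_dualD(3)[OF fg(2)] by blast
  then show "(\<lambda>x. f x + g x) \<in> BFS_dual rho"
    using BFS_dualD(1,2)[OF fg(1)] BFS_dualD(1,2)[OF fg(2)]
    by (intro BFS_dualI[of _ "C + D"]) (auto simp: algebra_simps intro: norm_triangle_mono)
next
  fix c f assume f: "f \<in> BFS_dual rho"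
  obtain C where "\<forall>u\<in>BFS rho. cmod (f u) \<le> C * BFS_norm rho u"
    using BFS_dualD(3)[OF f(1)] by blast
  then have "cmod (c * f u) \<le> (cmod c * C) * BFS_norm rho u" if "u \<in> BFS rho" for u
    using that mult_left_mono[of "cmod (f u)" "C * BFS_norm rho u" "cmod c"] by (simp add: norm_mult mult.assoc)
  then show "(\<lambda>x. c * f x) \<in> BFS_dual rho"
    using BFS_dualD(1,2)[OF f]
    by (intro BFS_dualI[of _ "cmod c * C"]) (auto simp: distrib_left mult.left_commute)
qed

lemma BFS_dual_norm_upper:
  assumes \<phi>: "\<phi> \<in> BFS_dual rho" and f: "f \<in> BFS rho" "BFS_norm rho f \<le> 1"
  shows "cmod (\<phi> f) \<le> BFS_dual_norm rho \<phi>"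
  unfolding BFS_dual_norm_def
proof (rule cSup_upper)
  obtain C where C: "C \<ge> 0" "\<And>u. u \<in> BFS rho \<Longrightarrow> cmod (\<phi> u) \<le> C * BFS_norm rho u"
    using BFS_dualD(3)[OF \<phi>] by blast
  show "bdd_above {cmod (\<phi> f) |f. f \<in> BFS rho \<and> BFS_norm rho f \<le> 1}"
  proof (rule bdd_aboveI, safe)
    fix f assume "f \<in> BFS rho" "BFS_norm rho f \<le> 1"
    then show "cmod (\<phi> f) \<le> C" using C(2)[of f] mult_left_mono[OF _ C(1), of "BFS_norm rho f" 1] by simp
  qed
qed (use f in auto)

lemma BFS_dual_norm_bound:
  assumes \<phi>: "\<phi> \<in> BFS_dual rho" and u: "u \<in> BFS rho"
  shows "cmod (\<phi> u) \<le> BFS_norm rho u * BFS_dual_norm rho \<phi>"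
proof -
  obtain C where C: "C \<ge> 0" "\<And>u. u \<in> BFS rho \<Longrightarrow> cmod (\<phi> u) \<le> C * BFS_norm rho u"
    using BFS_dualD(3)[OF \<phi>] by blast
  show ?thesis
  proof (cases "BFS_norm rho u = 0")
    case True
    then show ?thesis using C(2)[OF u] by simp
  next
    case False
    then have pos: "BFS_norm rho u > 0" using BFS_norm_nonneg[of u] by simp
    let ?c = "of_real (1 / BFS_norm rho u) :: complex"
    have mem: "(\<lambda>x. ?c * u x) \<in> BFS rho" by (rule fun_subspaceD(2)[OF BFS_subspace u])
    have nrm: "BFS_norm rho (\<lambda>x. ?c * u x) = 1"
      unfolding BFS_norm_scale[OF u] using pos by (simp add: norm_divide)
    have "cmod (\<phi> (\<lambda>x. ?c * u x)) \<le> BFS_dual_norm rho \<phi>"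
      using nrm by (intro BFS_dual_norm_upper \<phi> mem) auto
    also have "cmod (\<phi> (\<lambda>x. ?c * u x)) = cmod (\<phi> u) / BFS_norm rho u"
      unfolding BFS_dualD(2)[OF \<phi> u] using pos by (simp add: norm_mult norm_divide)
    finally show ?thesis using pos by (simp add: field_simps)
  qed
qed

text \<open>Testing against the conjugate phase of h on [-n, n] turns the pairing into the integral
  of the modulus of h over that interval.\<close>

lemma AE_0_if_pairings_0:
  assumes h: "h \<in> BFS rho" and 0: "\<And>G. G \<in> test_functions \<Longrightarrow> (LINT x|lebesgue. h x * G x) = 0"
  shows "AE x in lebesgue. h x = 0"
proof -
  note [measurable] = BFS_measurable[OF h]
  have "AE x in lebesgue. \<bar>x\<bar> \<le> real n \<longrightarrow> h x = 0" for n
  proof -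
    define G where "G = (\<lambda>x. cnj (sgn (h x)) * indicator {-real n..real n} x)"
    have G: "G \<in> test_functions"
    proof (rule test_functionsI[of _ 1 "real n"])
      show "G \<in> borel_measurable lebesgue" unfolding G_def sgn_div_norm by measurable
    qed (auto simp: G_def norm_mult norm_sgn split: split_indicator)
    have eq: "h x * G x = complex_of_real (cmod (h x) * indicator {-real n..real n} x)" for x
      using mult_cnj_sgn[of "h x"] by (simp add: G_def mult.assoc[symmetric] split: split_indicator)
    obtain C where "integrable lebesgue (\<lambda>x. h x * G x)" using BFS_pairing[OF G] h by metis
    then have int: "integrable lebesgue (\<lambda>x. cmod (h x) * indicator {-real n..real n} x)"
      unfolding eq by (simp only: complex_of_real_integrable_eq)
    have "(LINT x|lebesgue. cmod (h x) * indicator {-real n..real n} x) = 0"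
      using 0[OF G] unfolding eq by (simp only: integral_complex_of_real of_real_eq_0_iff)
    then have "AE x in lebesgue. cmod (h x) * indicator {-real n..real n} x = 0"
      using integral_nonneg_eq_0_iff_AE[OF int] by auto
    then show ?thesis by eventually_elim (auto simp: indicator_def abs_le_iff split: if_splits)
  qed
  then have "AE x in lebesgue. \<forall>n. \<bar>x\<bar> \<le> real n \<longrightarrow> h x = 0" by (subst AE_all_countable) blast
  then show ?thesis by eventually_elim (use real_arch_simple in blast)
qed

text \<open>If the pairing did not tend to zero, then a Hahn-Banach limit of evaluations would be an element of
  the bidual that is nonzero but annihilates all test functions.\<close>
lemma reflexive_weakly_null:
  assumes refl: "reflexive_BFS rho"
    and u: "\<And>n. u n \<in> BFS rho" "\<And>n. BFS_norm rho (u n) \<le> B"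
    and lim: "\<And>G. G \<in> test_functions \<Longrightarrow> (\<lambda>n. LINT x|lebesgue. u n x * G x) \<longlonglongrightarrow> 0"
    and \<phi>: "\<phi> \<in> BFS_dual rho"
  shows "(\<lambda>n. \<phi> (u n)) \<longlonglongrightarrow> 0"
proof (rule ccontr)
  assume "\<not> (\<lambda>n. \<phi> (u n)) \<longlonglongrightarrow> 0"
  then have not0: "\<not> (\<lambda>n. cmod (\<phi> (u n))) \<longlonglongrightarrow> 0" by (simp add: tendsto_norm_zero_iff)
  have bd: "cmod (\<phi>' (u n)) \<le> B * BFS_dual_norm rho \<phi>'" if "\<phi>' \<in> BFS_dual rho" for \<phi>' n
  proof -
    \<comment> \<open>The value at the zero function is one of the numbers in the supremum, so the
      dual norm is nonnegative and the norm of \<open>u n\<close> may be replaced by its bound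
      B.\<close>
    have z: "(\<lambda>x. 0) \<in> BFS rho" by (rule fun_subspace_zero[OF BFS_subspace])
    have "BFS_norm rho (\<lambda>x. 0) = 0" using BFS_norm_scale[OF z, of 0] by simp
    then have "cmod (\<phi>' (\<lambda>x. 0)) \<le> BFS_dual_norm rho \<phi>'"
      using z by (intro BFS_dual_norm_upper that) auto
    then have "0 \<le> BFS_dual_norm rho \<phi>'" using norm_ge_zero order_trans by blast
    then show ?thesis
      using BFS_dual_norm_bound[OF that u(1), of n] mult_right_mono[OF u(2)[of n]] order_trans by blast
  qed
  obtain \<Phi> where \<Phi>: "\<And>u v. u \<in> BFS_dual rho \<Longrightarrow> v \<in> BFS_dual rho \<Longrightarrow> \<Phi> (\<lambda>x. u x + v x) = \<Phi> u + \<Phi> v"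
    "\<And>c u. u \<in> BFS_dual rho \<Longrightarrow> \<Phi> (\<lambda>x. c * u x) = c * \<Phi> u"
    "\<And>u. u \<in> BFS_dual rho \<Longrightarrow> cmod (\<Phi> u) \<le> B * BFS_dual_norm rho u" "\<Phi> \<phi> \<noteq> 0"
    "\<And>\<phi>'. \<phi>' \<in> BFS_dual rho \<Longrightarrow> (\<lambda>n. cmod (\<phi>' (u n))) \<longlonglongrightarrow> 0 \<Longrightarrow> \<Phi> \<phi>' = 0"
    using Hahn_Banach_limsup[where p = "\<lambda>n \<phi>. cmod (\<phi> (u n))" and B = "\<lambda>\<phi>. B * BFS_dual_norm rho \<phi>",
      OF BFS_dual_subspace \<phi>, OF norm_ge_zero norm_triangle_ineq norm_mult not0 bd] by blast
  have "bounded_linear_functional_on (BFS_dual rho) (BFS_dual_norm rho)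
              (\<lambda>\<phi> \<psi> f. \<phi> f + \<psi> f) (\<lambda>c \<phi> f. c * \<phi> f) \<Phi>"
    unfolding bounded_linear_functional_on_def using \<Phi>(1-3) by blast
  then obtain h where h: "h \<in> BFS rho" "\<And>\<phi>. \<phi> \<in> BFS_dual rho \<Longrightarrow> \<Phi> \<phi> = \<phi> h"
    using refl unfolding reflexive_BFS_def by blast
  \<comment> \<open>Pairings with test functions tend to 0 along u, so the limit functional kills
    them; its representing function h therefore vanishes a.e.\<close>
  have "(LINT x|lebesgue. h x * G x) = 0" if G: "G \<in> test_functions" for G
    using \<Phi>(5)[OF pairing_BFS_dual[OF G]] tendsto_norm_zero[OF lim[OF G]] h(2)[OF pairing_BFS_dual[OF G]] by simp
  then have "BFS_norm rho h = 0"
    using AE_0_if_pairings_0[OF h(1)] BFS_norm_eq_0[OF h(1)] by blast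
  then have "\<phi> h = 0" using BFS_dual_norm_bound[OF \<phi> h(1)] by simp
  then show False using \<Phi>(4) h(2)[OF \<phi>] by simp
qed

end

section \<open>The Lorentz-Luxemburg theorem\<close>

lemma ennreal_enn2real_min: "ennreal (enn2real (min y (of_nat n))) = min y (of_nat n)"
  by (rule ennreal_enn2real) (simp add: min_less_iff_disj of_nat_less_top)

text \<open>Young's inequality with weight 4^n, chosen so that for squared L2 increments of order
  16^{-n} on a bounded interval both terms integrate to order 4^{-n}.\<close>

lemma abs_le_weighted_square: "\<bar>t\<bar> \<le> 4 ^ n / 2 * t\<^sup>2 + (1/4) ^ n / (2::real)"
proof -
  have *: "(a * \<bar>t\<bar> - b)\<^sup>2 = (a * a) * t\<^sup>2 - 2 * (a * b) * \<bar>t\<bar> + b * b" for a b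
    by (simp add: power2_eq_square algebra_simps)
  have "2 ^ n * 2 ^ n = (4::real) ^ n" "(1/2) ^ n * (1/2) ^ n = (1/4 :: real) ^ n" "2 ^ n * (1/2) ^ n = (1::real)"
    by (simp_all flip: power_mult_distrib)
  then have "(2 ^ n * \<bar>t\<bar> - (1/2) ^ n)\<^sup>2 = 4 ^ n * t\<^sup>2 - 2 * \<bar>t\<bar> + (1/4) ^ n" unfolding * by simp
  then show ?thesis using zero_le_power2[of "2 ^ n * \<bar>t\<bar> - (1/2) ^ n"] by simp
qed

text \<open>The pointwise half of the Riesz-Fischer theorem. The common bounded support turns fast
  L2 decay of the increments into summable L1 norms, so the telescoping series converges absolutely
  a.e.\<close>

lemma AE_convergent_fast_L2:
  fixes h :: "nat \<Rightarrow> real \<Rightarrow> real"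
  assumes [measurable]: "\<And>n. h n \<in> borel_measurable lebesgue"
    and zero: "\<And>n x. x \<notin> {-R..R} \<Longrightarrow> h n x = 0" and R: "R \<ge> 0"
    and int: "\<And>n. integrable lebesgue (\<lambda>x. (h n x - h (Suc n) x)\<^sup>2)"
    and le: "\<And>n. (LINT x|lebesgue. (h n x - h (Suc n) x)\<^sup>2) \<le> 4 * (1/16) ^ n"
  shows "AE x in lebesgue. convergent (\<lambda>n. h n x)"
proof -
  have bound: "(\<integral>\<^sup>+ x. ennreal \<bar>h (Suc n) x - h n x\<bar> \<partial>lebesgue) \<le> ennreal ((2 + R) * (1/4) ^ n)" for n
  proof -
    have "(\<integral>\<^sup>+ x. ennreal \<bar>h (Suc n) x - h n x\<bar> \<partial>lebesgue)
      \<le> (\<integral>\<^sup>+ x. ennreal (4 ^ n / 2) * ennreal ((h n x - h (Suc n) x)\<^sup>2) + ennreal ((1/4) ^ n / 2) * indicator {-R..R} x \<partial>lebesgue)"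
    proof (rule nn_integral_mono)
      fix x
      let ?t = "h n x - h (Suc n) x"
      show "ennreal \<bar>h (Suc n) x - h n x\<bar> \<le> ennreal (4 ^ n / 2) * ennreal (?t\<^sup>2) + ennreal ((1/4) ^ n / 2) * indicator {-R..R} x"
      proof (cases "x \<in> {-R..R}")
        case True
        have "\<bar>?t\<bar> \<le> 4 ^ n / 2 * ?t\<^sup>2 + (1/4) ^ n / 2" by (rule abs_le_weighted_square)
        then have "ennreal \<bar>?t\<bar> \<le> ennreal (4 ^ n / 2 * ?t\<^sup>2 + (1/4) ^ n / 2)" by (rule ennreal_leI)
        also have "\<dots> = ennreal (4 ^ n / 2) * ennreal (?t\<^sup>2) + ennreal ((1/4) ^ n / 2) * indicator {-R..R} x"
          using True by (simp add: ennreal_mult flip: ennreal_mult)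
        finally show ?thesis by (simp add: abs_minus_commute)
      next
        case False
        then show ?thesis by (simp add: zero)
      qed
    qed
    also have "\<dots> = ennreal (4 ^ n / 2) * (\<integral>\<^sup>+ x. ennreal ((h n x - h (Suc n) x)\<^sup>2) \<partial>lebesgue)
        + ennreal ((1/4) ^ n / 2) * emeasure lebesgue {-R..R}"
      by (subst nn_integral_add) (auto simp: nn_integral_cmult)
    also have "(\<integral>\<^sup>+ x. ennreal ((h n x - h (Suc n) x)\<^sup>2) \<partial>lebesgue) = ennreal (LINT x|lebesgue. (h n x - h (Suc n) x)\<^sup>2)"
      by (rule nn_integral_eq_integral[OF int]) auto
    also have "\<dots> \<le> ennreal (4 * (1/16) ^ n)" by (intro ennreal_leI le)
    also have "emeasure lebesgue {-R..R} = ennreal (2 * R)" using R by (simp add: emeasure_lborel_Icc_eq)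
    also have "ennreal (4 ^ n / 2) * ennreal (4 * (1/16) ^ n) + ennreal ((1/4) ^ n / 2) * ennreal (2 * R)
       = ennreal (4 ^ n / 2 * (4 * (1/16) ^ n) + (1/4) ^ n / 2 * (2 * R))"
      using R by (simp flip: ennreal_mult)
    also have "4 ^ n / 2 * (4 * (1/16) ^ n) + (1/4) ^ n / 2 * (2 * R) = (2 + R) * (1/4) ^ n"
    proof -
      have "(4::real) ^ n * (1/16) ^ n = (1/4) ^ n" by (simp flip: power_mult_distrib)
      then show ?thesis by (simp add: algebra_simps)
    qed
    finally show ?thesis by (simp add: add_right_mono mult_left_mono)
  qed
  have "(\<integral>\<^sup>+ x. (\<Sum>n. ennreal \<bar>h (Suc n) x - h n x\<bar>) \<partial>lebesgue) = (\<Sum>n. \<integral>\<^sup>+ x. ennreal \<bar>h (Suc n) x - h n x\<bar> \<partial>lebesgue)"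
    by (intro nn_integral_suminf) auto
  also have "\<dots> \<le> (\<Sum>n. ennreal ((2 + R) * (1/4) ^ n))" by (intro suminf_le bound) auto
  also have "\<dots> = ennreal (\<Sum>n. (2 + R) * (1/4) ^ n)"
    using R by (intro suminf_ennreal2 summable_mult summable_geometric) auto
  also have "\<dots> < \<infinity>" by simp
  finally have "AE x in lebesgue. (\<Sum>n. ennreal \<bar>h (Suc n) x - h n x\<bar>) \<noteq> \<infinity>"
    by (intro nn_integral_PInf_AE) auto
  then show ?thesis
  proof eventually_elim
    case (elim x)
    then have "summable (\<lambda>n. \<bar>h (Suc n) x - h n x\<bar>)" by (intro summable_suminf_not_top) auto
    then have "summable (\<lambda>n. h (Suc n) x - h n x)" by (rule summable_rabs_cancel)
    then have "convergent (\<lambda>n. (h n x - h 0 x) + h 0 x)"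
      by (intro convergent_add convergent_const) (simp add: summable_iff_convergent sum_lessThan_telescope[of "\<lambda>i. h i x"])
    then show ?case by simp
  qed
qed

context banach_fun_norm
begin

text \<open>Fatou's lemma for rho: the tail infima increase to the liminf, and (P3) applies to
  them.\<close>

lemma rho_liminf_le:
  assumes [measurable]: "\<And>n. F n \<in> borel_measurable lebesgue" and le: "\<And>n. rho (F n) \<le> c"
  shows "rho (\<lambda>x. liminf (\<lambda>n. F n x)) \<le> c"
proof -
  have "(\<lambda>n. rho (\<lambda>x. INF k\<in>{n..}. F k x)) \<longlonglongrightarrow> rho (\<lambda>x. liminf (\<lambda>n. F n x))"
  proof (rule rho_Fatou)
    show "AE x in lebesgue. incseq (\<lambda>n. INF k\<in>{n..}. F k x) \<and> (\<lambda>n. INF k\<in>{n..}. F k x) \<longlonglongrightarrow> liminf (\<lambda>n. F n x)"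
    proof (rule AE_I2)
      fix x
      have "incseq (\<lambda>n. INF k\<in>{n..}. F k x)" by (auto simp: incseq_def intro!: INF_superset_mono)
      moreover from LIMSEQ_SUP[OF this] have "(\<lambda>n. INF k\<in>{n..}. F k x) \<longlonglongrightarrow> liminf (\<lambda>n. F n x)"
        by (simp add: liminf_SUP_INF)
      ultimately show "incseq (\<lambda>n. INF k\<in>{n..}. F k x) \<and> (\<lambda>n. INF k\<in>{n..}. F k x) \<longlonglongrightarrow> liminf (\<lambda>n. F n x)" ..
    qed
  qed measurable
  moreover have "rho (\<lambda>x. INF k\<in>{n..}. F k x) \<le> c" for n
    by (rule order_trans[OF rho_mono le[of n]]) (auto intro!: INF_lower)
  ultimately show ?thesis by (meson LIMSEQ_le_const2)
qed

text \<open>A ball of X cut down to nonnegative square integrable functions on a fixed interval, so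
  that nearest points can be found by Hilbert space geometry. Sign and support are required at every
  point, not just a.e.\<close>

definition rho_ball :: "real \<Rightarrow> real \<Rightarrow> (real \<Rightarrow> real) set" where
  "rho_ball R c = {h \<in> borel_measurable lebesgue. (\<forall>x. 0 \<le> h x) \<and> (\<forall>x. x \<notin> {-R..R} \<longrightarrow> h x = 0) \<and>
     integrable lebesgue (\<lambda>x. (h x)\<^sup>2) \<and> rho (\<lambda>x. ennreal (h x)) \<le> ennreal c}"

lemma integrable_mult_L2:
  fixes f g :: "real \<Rightarrow> real"
  assumes [measurable]: "f \<in> borel_measurable lebesgue" "g \<in> borel_measurable lebesgue"
    and "integrable lebesgue (\<lambda>x. (f x)\<^sup>2)" "integrable lebesgue (\<lambda>x. (g x)\<^sup>2)"
  shows "integrable lebesgue (\<lambda>x. f x * g x)"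
proof (rule Bochner_Integration.integrable_bound)
  show "integrable lebesgue (\<lambda>x. (f x)\<^sup>2 + (g x)\<^sup>2)" using assms by simp
  show "AE x in lebesgue. norm (f x * g x) \<le> norm ((f x)\<^sup>2 + (g x)\<^sup>2)"
  proof (rule AE_I2)
    fix x
    have "2 * \<bar>f x * g x\<bar> \<le> (f x)\<^sup>2 + (g x)\<^sup>2"
      using sum_squares_bound[of "\<bar>f x\<bar>" "\<bar>g x\<bar>"] by (simp add: abs_mult mult.assoc)
    then show "norm (f x * g x) \<le> norm ((f x)\<^sup>2 + (g x)\<^sup>2)" by simp
  qed
qed auto

lemma integrable_diff_L2:
  fixes f g :: "real \<Rightarrow> real"
  assumes "f \<in> borel_measurable lebesgue" "g \<in> borel_measurable lebesgue"
    and "integrable lebesgue (\<lambda>x. (f x)\<^sup>2)" "integrable lebesgue (\<lambda>x. (g x)\<^sup>2)"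
  shows "integrable lebesgue (\<lambda>x. (f x - g x)\<^sup>2)"
  using integrable_mult_L2[OF assms] assms(3,4) by (simp add: power2_diff mult.assoc)

lemma rho_ball_convex:
  assumes h: "h \<in> rho_ball R c" and k: "k \<in> rho_ball R c" and t: "0 \<le> t" "t \<le> 1" and c: "0 \<le> c"
  shows "(\<lambda>x. (1 - t) * h x + t * k x) \<in> rho_ball R c"
proof -
  have [measurable]: "h \<in> borel_measurable lebesgue" "k \<in> borel_measurable lebesgue"
    using h k by (auto simp: rho_ball_def)
  have nn: "0 \<le> h x" "0 \<le> k x" for x using h k by (auto simp: rho_ball_def)
  have "rho (\<lambda>x. ennreal ((1 - t) * h x + t * k x)) = rho (\<lambda>x. ennreal (1 - t) * ennreal (h x) + ennreal t * ennreal (k x))"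
    using nn t by (simp add: ennreal_mult)
  also have "\<dots> \<le> rho (\<lambda>x. ennreal (1 - t) * ennreal (h x)) + rho (\<lambda>x. ennreal t * ennreal (k x))"
    by (intro rho_add) auto
  also have "\<dots> = ennreal (1 - t) * rho (\<lambda>x. ennreal (h x)) + ennreal t * rho (\<lambda>x. ennreal (k x))"
    using t by (simp add: rho_scale)
  also have "\<dots> \<le> ennreal (1 - t) * ennreal c + ennreal t * ennreal c"
    using h k by (intro add_mono mult_left_mono) (auto simp: rho_ball_def)
  also have "\<dots> = ennreal c" using t c by (simp flip: ennreal_mult ennreal_plus) (simp add: algebra_simps)
  finally have "rho (\<lambda>x. ennreal ((1 - t) * h x + t * k x)) \<le> ennreal c" .
  moreover have "integrable lebesgue (\<lambda>x. ((1 - t) * h x + t * k x)\<^sup>2)"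
  proof -
    have "integrable lebesgue (\<lambda>x. (1 - t)\<^sup>2 * (h x)\<^sup>2 + t\<^sup>2 * (k x)\<^sup>2 + (2 * (1 - t) * t) * (h x * k x))"
      using h k integrable_mult_L2[of h k] by (intro Bochner_Integration.integrable_add integrable_mult_right) (auto simp: rho_ball_def)
    moreover have "((1 - t) * h x + t * k x)\<^sup>2 = (1 - t)\<^sup>2 * (h x)\<^sup>2 + t\<^sup>2 * (k x)\<^sup>2 + (2 * (1 - t) * t) * (h x * k x)" for x
      by (simp add: power2_eq_square algebra_simps)
    ultimately show ?thesis by simp
  qed
  ultimately show ?thesis using h k nn t by (auto simp: rho_ball_def)
qed

text \<open>Projection to a convex set: a minimising sequence is Cauchy by the parallelogram law,
  and its a.e. limit stays in the ball by the Fatou property of rho.\<close>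

lemma rho_ball_closest:
  fixes f :: "real \<Rightarrow> real"
  assumes [measurable]: "f \<in> borel_measurable lebesgue" and f2: "integrable lebesgue (\<lambda>x. (f x)\<^sup>2)"
    and R: "0 \<le> R" and c: "0 \<le> c"
  obtains h where "h \<in> rho_ball R c"
    "\<And>k. k \<in> rho_ball R c \<Longrightarrow> (LINT x|lebesgue. (f x - h x)\<^sup>2) \<le> (LINT x|lebesgue. (f x - k x)\<^sup>2)"
proof -
  let ?U = "rho_ball R c"
  define D where "D = (\<lambda>h. LINT x|lebesgue. (f x - h x)\<^sup>2)"
  have Um: "h \<in> borel_measurable lebesgue" "integrable lebesgue (\<lambda>x. (h x)\<^sup>2)" if "h \<in> ?U" for h
    using that by (auto simp: rho_ball_def)
  have Ud: "integrable lebesgue (\<lambda>x. (f x - h x)\<^sup>2)" if "h \<in> ?U" for h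
    using Um[OF that] by (intro integrable_diff_L2 f2) auto
  have z: "(\<lambda>x. 0) \<in> ?U" using rho_eq_0[of "\<lambda>x. 0"] by (simp add: rho_ball_def)
  define d where "d = (INF h\<in>?U. D h)"
  have bdd: "bdd_below (D ` ?U)" unfolding D_def by (auto intro!: bdd_belowI[of _ 0])
  have d_le: "d \<le> D h" if "h \<in> ?U" for h unfolding d_def by (rule cINF_lower[OF bdd that])
  \<comment> \<open>Near-minimality of this order makes the squared distance of consecutive members
    at most 8 E n = 4 (1/16)^n, the rate asked for by \<open>AE_convergent_fast_L2\<close>.\<close>
  define E :: "nat \<Rightarrow> real" where "E = (\<lambda>n. (1/16) ^ n / 2)"
  have E: "0 < E n" "E (Suc n) \<le> E n" for n by (auto simp: E_def)
  have "\<exists>h\<in>?U. D h < d + E n" for n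
    using cInf_lessD[of "D ` ?U" "d + E n"] z E(1)[of n] unfolding d_def by auto
  then obtain h where h: "\<And>n. h n \<in> ?U" "\<And>n. D (h n) < d + E n" by metis
  have [measurable]: "h n \<in> borel_measurable lebesgue" for n using Um(1)[OF h(1)] .
  have "(LINT x|lebesgue. (h n x - h (Suc n) x)\<^sup>2) \<le> 4 * (1/16) ^ n" for n
  proof -
    \<comment> \<open>The midpoint stays in the ball, so its squared distance to f is at least d;
      the parallelogram identity then bounds the distance of consecutive members.\<close>
    define m where "m = (\<lambda>x. (1 - 1/2) * h n x + 1/2 * h (Suc n) x)"
    have m: "m \<in> ?U" unfolding m_def by (intro rho_ball_convex h c) auto
    have "(LINT x|lebesgue. (h n x - h (Suc n) x)\<^sup>2) =
      (LINT x|lebesgue. 2 * (f x - h n x)\<^sup>2 + 2 * (f x - h (Suc n) x)\<^sup>2 - 4 * (f x - m x)\<^sup>2)"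
      by (intro Bochner_Integration.integral_cong refl) (simp add: m_def power2_eq_square field_simps)
    also have "\<dots> = 2 * D (h n) + 2 * D (h (Suc n)) - 4 * D m"
      unfolding D_def using Ud[OF h(1)[of n]] Ud[OF h(1)[of "Suc n"]] Ud[OF m] by simp
    also have "\<dots> \<le> 8 * E n"
      using h(2)[of n] h(2)[of "Suc n"] d_le[OF m] E[of n] by linarith
    also have "\<dots> = 4 * (1/16) ^ n" by (simp add: E_def)
    finally show ?thesis .
  qed
  then have conv: "AE x in lebesgue. convergent (\<lambda>n. h n x)"
    using h(1) integrable_diff_L2[OF Um(1)[OF h(1)] Um(1)[OF h(1)] Um(2)[OF h(1)] Um(2)[OF h(1)]]
    by (intro AE_convergent_fast_L2[of h R] R) (auto simp: rho_ball_def)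
  \<comment> \<open>The liminf exists at every point, so \<open>p\<close> inherits sign and support
    everywhere, as membership in \<open>rho_ball\<close> demands.\<close>
  define H where "H = (\<lambda>x. liminf (\<lambda>n. ennreal (h n x)))"
  define p where "p = (\<lambda>x. enn2real (H x))"
  have [measurable]: "H \<in> borel_measurable lebesgue" "p \<in> borel_measurable lebesgue"
    unfolding H_def p_def by measurable
  have rho_p: "rho (\<lambda>x. ennreal (p x)) \<le> ennreal c"
  proof -
    have "rho (\<lambda>x. ennreal (p x)) \<le> rho H"
      by (intro rho_mono) (auto simp: p_def ennreal_enn2real_if)
    also have "\<dots> \<le> ennreal c" unfolding H_def
      using h(1) by (intro rho_liminf_le) (auto simp: rho_ball_def)
    finally show ?thesis .
  qed
  have lim: "AE x in lebesgue. (\<lambda>n. h n x) \<longlonglongrightarrow> p x"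
    using conv
  proof eventually_elim
    case (elim x)
    then obtain l where l: "(\<lambda>n. h n x) \<longlonglongrightarrow> l" by (auto simp: convergent_def)
    have "l \<ge> 0" using h(1) by (intro LIMSEQ_le_const[OF l]) (auto simp: rho_ball_def)
    moreover have "H x = ennreal l"
      unfolding H_def using l by (intro lim_imp_Liminf) (auto intro: tendsto_ennrealI)
    ultimately show ?case using l by (simp add: p_def)
  qed
  have "(\<integral>\<^sup>+ x. ennreal ((f x - p x)\<^sup>2) \<partial>lebesgue) = (\<integral>\<^sup>+ x. liminf (\<lambda>n. ennreal ((f x - h n x)\<^sup>2)) \<partial>lebesgue)"
  proof (intro nn_integral_cong_AE, use lim in eventually_elim)
    case (elim x)
    then have "(\<lambda>n. ennreal ((f x - h n x)\<^sup>2)) \<longlonglongrightarrow> ennreal ((f x - p x)\<^sup>2)"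
      by (intro tendsto_ennrealI tendsto_intros)
    then show ?case by (intro lim_imp_Liminf[symmetric]) auto
  qed
  also have "\<dots> \<le> liminf (\<lambda>n. \<integral>\<^sup>+ x. ennreal ((f x - h n x)\<^sup>2) \<partial>lebesgue)"
    by (intro nn_integral_liminf) auto
  also have "(\<lambda>n. \<integral>\<^sup>+ x. ennreal ((f x - h n x)\<^sup>2) \<partial>lebesgue) = (\<lambda>n. ennreal (D (h n)))"
    unfolding D_def using Ud[OF h(1)] by (intro ext nn_integral_eq_integral) auto
  also have "liminf \<dots> = ennreal d"
  proof (intro lim_imp_Liminf tendsto_ennrealI)
    show "(\<lambda>n. D (h n)) \<longlonglongrightarrow> d"
    proof (rule tendsto_sandwich[of "\<lambda>_. d" _ _ "\<lambda>n. d + E n"])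
      have "(\<lambda>n. d + E n) \<longlonglongrightarrow> d + 0 / 2"
        unfolding E_def by (intro tendsto_intros LIMSEQ_realpow_zero) auto
      then show "(\<lambda>n. d + E n) \<longlonglongrightarrow> d" by simp
    qed (use d_le h in \<open>auto intro!: always_eventually less_imp_le\<close>)
  qed simp
  finally have le: "(\<integral>\<^sup>+ x. ennreal ((f x - p x)\<^sup>2) \<partial>lebesgue) \<le> ennreal d" .
  have int: "integrable lebesgue (\<lambda>x. (f x - p x)\<^sup>2)"
    using le by (intro integrableI_bounded) (auto simp: le_less_trans)
  have d0: "0 \<le> d" unfolding d_def D_def using z by (intro cINF_greatest) auto
  have "ennreal (D p) \<le> ennreal d"
    unfolding D_def using le int by (subst nn_integral_eq_integral[symmetric]) auto
  then have Dp: "D p \<le> d" using d0 by simp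
  have "integrable lebesgue (\<lambda>x. (f x - (f x - p x))\<^sup>2)"
    by (rule integrable_diff_L2) (auto simp: f2 int)
  moreover have "p x = 0" if "x \<notin> {-R..R}" for x
  proof -
    have "h n x = 0" for n using h(1) that unfolding rho_ball_def by blast
    then show ?thesis by (simp add: p_def H_def Liminf_const)
  qed
  ultimately have "p \<in> ?U" using rho_p by (auto simp: rho_ball_def p_def)
  then show ?thesis using that[of p] Dp d_le unfolding D_def by (meson order_trans)
qed

text \<open>The Lorentz-Luxemburg theorem for bounded functions: the separating functional in the Hahn-Banach argument
  is the difference between f and its \<open>L\<^sup>2\<close> projection to the ball.\<close>
lemma rho_le_if_pairings_le:
  fixes f :: "real \<Rightarrow> real"
  assumes [measurable]: "f \<in> borel_measurable lebesgue" and f0: "\<And>x. 0 \<le> f x" and fK: "\<And>x. f x \<le> K"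
    and fR: "\<And>x. x \<notin> {-R..R} \<Longrightarrow> f x = 0" and R: "0 \<le> R" and c: "0 < c"
    and hyp: "\<And>g :: real \<Rightarrow> real. g \<in> borel_measurable lebesgue \<Longrightarrow> (\<And>x. 0 \<le> g x) \<Longrightarrow> (\<And>x. g x \<le> f x) \<Longrightarrow>
      (\<integral>\<^sup>+ x. ennreal (f x) * ennreal (g x) \<partial>lebesgue) \<le> ennreal c * assoc_norm rho (\<lambda>x. ennreal (g x))"
  shows "rho (\<lambda>x. ennreal (f x)) \<le> ennreal c"
proof (rule ccontr)
  assume not: "\<not> ?thesis"
  let ?U = "rho_ball R c"
  have bdint: "integrable lebesgue k" if [measurable]: "k \<in> borel_measurable lebesgue" and "\<And>x. \<bar>k x\<bar> \<le> M"
      "\<And>x. x \<notin> {-R..R} \<Longrightarrow> k x = 0" for k :: "real \<Rightarrow> real" and M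
  proof (rule Bochner_Integration.integrable_bound)
    have "integrable lebesgue (indicator {-R..R} :: real \<Rightarrow> real)"
      by (rule integrable_real_indicator) (auto simp: emeasure_lborel_Icc_eq)
    then show "integrable lebesgue (\<lambda>x. M * indicator {-R..R} x :: real)" by (rule integrable_mult_right)
    show "AE x in lebesgue. norm (k x) \<le> norm (M * indicator {-R..R} x)"
    proof (rule AE_I2)
      fix x show "norm (k x) \<le> norm (M * indicator {-R..R} x)"
        using that(2)[of x] that(3)[of x] by (cases "x \<in> {-R..R}") (auto)
    qed
  qed auto
  have bdint2: "integrable lebesgue (\<lambda>x. (k x)\<^sup>2)" if "k \<in> borel_measurable lebesgue" "\<And>x. \<bar>k x\<bar> \<le> M"
      "\<And>x. x \<notin> {-R..R} \<Longrightarrow> k x = 0" for k :: "real \<Rightarrow> real" and M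
    using that(1,3) power_mono[OF that(2) abs_ge_zero, where n = 2]
    by (intro bdint[of _ "M\<^sup>2"]) auto
  have f2: "integrable lebesgue (\<lambda>x. (f x)\<^sup>2)" using f0 fK fR by (intro bdint2[of f K]) auto
  obtain p where p: "p \<in> ?U"
    and min: "\<And>k. k \<in> ?U \<Longrightarrow> (LINT x|lebesgue. (f x - p x)\<^sup>2) \<le> (LINT x|lebesgue. (f x - k x)\<^sup>2)"
    using rho_ball_closest[OF _ f2 R less_imp_le[OF c]] by auto
  have [measurable]: "p \<in> borel_measurable lebesgue" and p2: "integrable lebesgue (\<lambda>x. (p x)\<^sup>2)"
    and p0: "\<And>x. 0 \<le> p x" and rho_p: "rho (\<lambda>x. ennreal (p x)) \<le> ennreal c"
    using p by (auto simp: rho_ball_def)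
  define g where "g = (\<lambda>x. f x - p x)"
  have [measurable]: "g \<in> borel_measurable lebesgue" unfolding g_def by measurable
  have g2: "integrable lebesgue (\<lambda>x. (g x)\<^sup>2)" unfolding g_def by (intro integrable_diff_L2 f2 p2) auto
  \<comment> \<open>First variation of the distance along the segment from p to k: compare with (1 -
    t) p + t k, divide by t and let t tend to 0.\<close>
  have var: "(LINT x|lebesgue. g x * k x) \<le> (LINT x|lebesgue. g x * p x)" if k: "k \<in> ?U" for k
  proof -
    have [measurable]: "k \<in> borel_measurable lebesgue" and k2: "integrable lebesgue (\<lambda>x. (k x)\<^sup>2)"
      using k by (auto simp: rho_ball_def)
    define w where "w = (\<lambda>x. k x - p x)"
    have [measurable]: "w \<in> borel_measurable lebesgue" unfolding w_def by measurable
    have w2: "integrable lebesgue (\<lambda>x. (w x)\<^sup>2)" unfolding w_def by (intro integrable_diff_L2 k2 p2) auto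
    have gw: "integrable lebesgue (\<lambda>x. g x * w x)" by (intro integrable_mult_L2 g2 w2) auto
    have *: "2 * (LINT x|lebesgue. g x * w x) \<le> t * (LINT x|lebesgue. (w x)\<^sup>2)" if t: "0 < t" "t \<le> 1" for t
    proof -
      have "(LINT x|lebesgue. (g x)\<^sup>2) \<le> (LINT x|lebesgue. (f x - ((1 - t) * p x + t * k x))\<^sup>2)"
        unfolding g_def using t c by (intro min rho_ball_convex p k) auto
      also have "\<dots> = (LINT x|lebesgue. (g x)\<^sup>2 - (2 * t) * (g x * w x) + t\<^sup>2 * (w x)\<^sup>2)"
        by (intro Bochner_Integration.integral_cong refl) (simp add: g_def w_def power2_eq_square algebra_simps)
      also have "\<dots> = (LINT x|lebesgue. (g x)\<^sup>2) - 2 * t * (LINT x|lebesgue. g x * w x) + t\<^sup>2 * (LINT x|lebesgue. (w x)\<^sup>2)"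
        using g2 w2 gw by simp
      finally have "t * (2 * (LINT x|lebesgue. g x * w x)) \<le> t * (t * (LINT x|lebesgue. (w x)\<^sup>2))"
        by (simp add: power2_eq_square algebra_simps)
      then show ?thesis using t(1) by simp
    qed
    have "((\<lambda>t. t * (LINT x|lebesgue. (w x)\<^sup>2)) \<longlongrightarrow> 0 * (LINT x|lebesgue. (w x)\<^sup>2)) (at_right 0)"
      by (intro tendsto_intros)
    moreover have "\<forall>\<^sub>F t in at_right 0. 2 * (LINT x|lebesgue. g x * w x) \<le> t * (LINT x|lebesgue. (w x)\<^sup>2)"
      using eventually_at_right_less[of 0] eventually_at_right_real[of 0 1]
      by (auto elim!: eventually_mono intro!: * simp: less_imp_le)
    ultimately have "2 * (LINT x|lebesgue. g x * w x) \<le> 0"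
      using tendsto_lowerbound[of "\<lambda>t. t * (LINT x|lebesgue. (w x)\<^sup>2)" 0 "at_right (0::real)" "2 * (LINT x|lebesgue. g x * w x)"] by simp
    moreover have "(LINT x|lebesgue. g x * w x) = (LINT x|lebesgue. g x * k x) - (LINT x|lebesgue. g x * p x)"
      unfolding w_def right_diff_distrib using integrable_mult_L2[OF _ _ g2 k2] integrable_mult_L2[OF _ _ g2 p2] by simp
    ultimately show ?thesis by simp
  qed
  define B where "B = (LINT x|lebesgue. g x * p x)"
  have pos: "0 < (LINT x|lebesgue. (g x)\<^sup>2)"
  proof (rule ccontr)
    assume "\<not> ?thesis"
    moreover have "0 \<le> (LINT x|lebesgue. (g x)\<^sup>2)" by simp
    ultimately have "(LINT x|lebesgue. (g x)\<^sup>2) = 0" by linarith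
    then have "AE x in lebesgue. (g x)\<^sup>2 = 0" using integral_nonneg_eq_0_iff_AE[OF g2] by simp
    then have "rho (\<lambda>x. ennreal (f x)) \<le> rho (\<lambda>x. ennreal (p x))"
      by (intro rho_mono_AE) (auto simp: g_def elim: eventually_mono)
    then show False using not rho_p by simp
  qed
  \<comment> \<open>The hypothesis admits only multipliers between 0 and f, so g is replaced by its
    positive part: p \<ge> 0 gives gp \<le> f, and f \<ge> 0 preserves the strict inequality when g
    grows to gp.\<close>
  define gp where "gp = (\<lambda>x. max (g x) 0)"
  have [measurable]: "gp \<in> borel_measurable lebesgue" unfolding gp_def by measurable
  have gp: "0 \<le> gp x" "gp x \<le> f x" "g x \<le> gp x" for x unfolding gp_def g_def using p0[of x] f0[of x] by auto
  have gpR: "gp x = 0" if "x \<notin> {-R..R}" for x using gp(1,2)[of x] fR[OF that] by simp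
  have "(LINT x|lebesgue. f x * g x) = (LINT x|lebesgue. (g x)\<^sup>2 + g x * p x)"
    by (intro Bochner_Integration.integral_cong refl) (simp add: g_def power2_eq_square algebra_simps)
  also have "\<dots> = (LINT x|lebesgue. (g x)\<^sup>2) + B"
    unfolding B_def using g2 integrable_mult_L2[OF _ _ g2 p2] by simp
  finally have "B < (LINT x|lebesgue. f x * g x)" using pos by simp
  also have "\<dots> \<le> (LINT x|lebesgue. f x * gp x)"
  proof (intro integral_mono integrable_mult_L2 f2 g2)
    show "integrable lebesgue (\<lambda>x. (gp x)\<^sup>2)"
      using gp(1,2) fK gpR by (intro bdint2[of gp K]) (auto intro: order_trans)
  qed (use gp(3) f0 in \<open>auto intro: mult_left_mono\<close>)
  finally have B_less: "B < (LINT x|lebesgue. f x * gp x)" .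
  have z: "(\<lambda>x. 0) \<in> ?U" using rho_eq_0[of "\<lambda>x. 0"] by (simp add: rho_ball_def)
  have B0: "0 \<le> B" unfolding B_def using var[OF z] by simp
  have "assoc_norm rho (\<lambda>x. ennreal (gp x)) \<le> ennreal (B / c)"
    unfolding assoc_norm_def
  proof (rule SUP_least, clarify)
    fix k :: "real \<Rightarrow> ennreal" assume [measurable]: "k \<in> borel_measurable lebesgue" and k1: "rho k \<le> 1"
    \<comment> \<open>Truncation in height and place puts k, up to the factor c, into the ball, so
      that \<open>var\<close> applies; cutting to g > 0 makes the integrals against g and gp
      coincide.\<close>
    define q where "q = (\<lambda>n x. enn2real (min (k x) (of_nat n)) * indicator {-R..R} x * (if g x > 0 then 1 else 0))"
    have [measurable]: "q n \<in> borel_measurable lebesgue" for n unfolding q_def by measurable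
    have q0: "0 \<le> q n x" and qn: "q n x \<le> real n" and qR: "x \<notin> {-R..R} \<Longrightarrow> q n x = 0"
      and qk: "ennreal (q n x) \<le> k x" for n x
    proof -
      define v where "v = enn2real (min (k x) (of_nat n))"
      have v: "ennreal v = min (k x) (of_nat n)" "0 \<le> v"
        unfolding v_def by (simp_all only: ennreal_enn2real_min enn2real_nonneg)
      have "ennreal v \<le> ennreal (real n)" unfolding v(1) by (simp add: ennreal_of_nat_eq_real_of_nat)
      then have "v \<le> real n" by simp
      moreover have "q n x = v \<or> q n x = 0" by (auto simp: q_def v_def split: split_indicator)
      moreover have "ennreal v \<le> k x" unfolding v(1) by simp
      ultimately show "0 \<le> q n x" "q n x \<le> real n" "ennreal (q n x) \<le> k x"
        using v(2) by (elim disjE; simp)+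
      show "q n x = 0" if "x \<notin> {-R..R}" using that by (simp add: q_def)
    qed
    have bound: "(\<integral>\<^sup>+ x. ennreal (q n x) * ennreal (gp x) \<partial>lebesgue) \<le> ennreal (B / c)" for n
    proof -
      have "rho (\<lambda>x. ennreal (c * q n x)) = ennreal c * rho (\<lambda>x. ennreal (q n x))"
        using c q0 by (simp add: ennreal_mult rho_scale)
      also have "\<dots> \<le> ennreal c * 1"
        by (intro mult_left_mono order_trans[OF rho_mono k1] qk) auto
      finally have "(\<lambda>x. c * q n x) \<in> ?U"
        using c q0 qn qR by (auto simp: rho_ball_def power_mult_distrib intro!: integrable_mult_right bdint2[of _ "real n"])
      from var[OF this] have "(LINT x|lebesgue. g x * (c * q n x)) \<le> B" by (simp only: B_def)
      moreover have "g x * (c * q n x) = c * (q n x * gp x)" for x by (simp add: gp_def q_def max_def)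
      ultimately have "(LINT x|lebesgue. c * (q n x * gp x)) \<le> B" by (simp only:)
      then have "(LINT x|lebesgue. q n x * gp x) \<le> B / c" using c by (simp add: field_simps)
      moreover have "integrable lebesgue (\<lambda>x. q n x * gp x)"
      proof (rule bdint[of _ "real n * K"])
        fix x show "\<bar>q n x * gp x\<bar> \<le> real n * K"
          unfolding abs_mult using q0[of n x] qn[of n x] gp[of x] fK[of x] by (intro mult_mono) auto
      qed (auto simp: qR)
      ultimately have "(\<integral>\<^sup>+ x. ennreal (q n x * gp x) \<partial>lebesgue) \<le> ennreal (B / c)"
        using q0 gp(1) by (subst nn_integral_eq_integral) (auto intro: ennreal_leI)
      then show ?thesis using q0 gp(1) by (simp add: ennreal_mult)
    qed
    have "(\<integral>\<^sup>+ x. k x * ennreal (gp x) \<partial>lebesgue) \<le> liminf (\<lambda>n. \<integral>\<^sup>+ x. ennreal (q n x) * ennreal (gp x) \<partial>lebesgue)"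
    proof -
      have "k x * ennreal (gp x) = liminf (\<lambda>n. ennreal (q n x) * ennreal (gp x))" for x
      proof (cases "gp x = 0")
        case True
        then show ?thesis by (simp add: Liminf_const)
      next
        case False
        then have x: "x \<in> {-R..R}" "g x > 0"
          using gp(1,2)[of x] fR[of x] unfolding gp_def by (force simp: max_def split: if_splits)+
        have "(\<lambda>n. min (k x) (of_nat n)) \<longlonglongrightarrow> min (k x) \<infinity>"
          unfolding infinity_ennreal_def by (intro tendsto_min tendsto_const of_nat_tendsto_top_ennreal)
        moreover have "ennreal (q n x) = min (k x) (of_nat n)" for n
          using x by (simp add: q_def ennreal_enn2real_min)
        ultimately have "(\<lambda>n. ennreal (gp x) * ennreal (q n x)) \<longlonglongrightarrow> ennreal (gp x) * k x"
          by (intro ennreal_tendsto_cmult) (auto simp: min_absorb1)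
        then show ?thesis by (intro lim_imp_Liminf[symmetric]) (auto simp: mult.commute)
      qed
      then show ?thesis by (simp add: nn_integral_liminf)
    qed
    also have "\<dots> \<le> ennreal (B / c)"
      using bound by (intro Liminf_le) auto
    finally show "(\<integral>\<^sup>+ x. k x * ennreal (gp x) \<partial>lebesgue) \<le> ennreal (B / c)" .
  qed
  \<comment> \<open>The bound B / c for the associate norm of gp, put into the hypothesis, caps the
    integral of f gp by c (B / c) = B, against \<open>B_less\<close>.\<close>
  then have "(\<integral>\<^sup>+ x. ennreal (f x) * ennreal (gp x) \<partial>lebesgue) \<le> ennreal c * ennreal (B / c)"
    by (intro order_trans[OF hyp] mult_left_mono gp) auto
  also have "\<dots> = ennreal B" using c B0 by (simp flip: ennreal_mult)
  also have "(\<integral>\<^sup>+ x. ennreal (f x) * ennreal (gp x) \<partial>lebesgue) = ennreal (LINT x|lebesgue. f x * gp x)"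
  proof -
    have "integrable lebesgue (\<lambda>x. f x * gp x)"
    proof (rule bdint[of _ "K * K"])
      fix x show "\<bar>f x * gp x\<bar> \<le> K * K"
        unfolding abs_mult using f0[of x] gp[of x] fK[of x] by (intro mult_mono) auto
    qed (auto simp: fR)
    then show ?thesis using f0 gp(1) by (simp add: nn_integral_eq_integral flip: ennreal_mult)
  qed
  finally show False using B_less B0 by (simp add: ennreal_le_iff2)
qed

end

section \<open>Dyadic intervals\<close>

text \<open>Larger first components are finer scales, so \<open>fst P \<le> fst Q\<close> says that
  P is at least as long as Q.\<close>

definition len :: "int \<times> int \<Rightarrow> real" where
  "len i = 2 powr (- real_of_int (fst i))"

definition dyadic :: "int \<times> int \<Rightarrow> real set" where
  "dyadic i = {of_int (snd i) * len i ..< (of_int (snd i) + 1) * len i}"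

text \<open>Centred at the left endpoint k 2^{-j}, not at the midpoint: that is where the support of
  \<psi>(2^j x - k) is centred when \<psi> lives on [-N, N].\<close>

definition dilate :: "real \<Rightarrow> int \<times> int \<Rightarrow> real set" where
  "dilate r i = {(of_int (snd i) - r) * len i .. (of_int (snd i) + r) * len i}"

lemma len_pos [simp]: "0 < len i" "0 \<le> len i" "len i \<noteq> 0" by (auto simp: len_def)

lemma mem_dyadic_iff: "x \<in> dyadic i \<longleftrightarrow> \<lfloor>x / len i\<rfloor> = snd i"
  by (auto simp: dyadic_def floor_eq_iff field_simps)

lemma mem_dilate_iff: "x \<in> dilate r i \<longleftrightarrow> \<bar>x - of_int (snd i) * len i\<bar> \<le> r * len i"
  by (auto simp: dilate_def abs_le_iff algebra_simps)

lemma dyadic_bounds: "x \<in> dyadic i \<Longrightarrow> of_int (snd i) * len i \<le> x \<and> x \<le> of_int (snd i) * len i + len i"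
  by (auto simp: dyadic_def algebra_simps)

lemma dyadic_subset_dilate: "dyadic i \<subseteq> dilate 1 i"
  using dyadic_bounds[of _ i] by (fastforce simp: mem_dilate_iff)

lemma dyadic_dist: "x \<in> dyadic i \<Longrightarrow> y \<in> dyadic i \<Longrightarrow> \<bar>x - y\<bar> \<le> len i"
  using dyadic_bounds[of x i] dyadic_bounds[of y i] by linarith

lemma corner_mem_dyadic: "of_int (snd i) * len i \<in> dyadic i"
  by (simp add: dyadic_def)

lemma dyadic_nonempty: "dyadic i \<noteq> {}" using corner_mem_dyadic by blast

lemma inverse_len: "1 / len i = 2 powr of_int (fst i)" by (simp add: len_def powr_minus_divide)

lemma len_mono: "fst i \<le> fst i' \<Longrightarrow> len i' \<le> len i" by (simp add: len_def)

text \<open>Membership is a condition on \<open>\<lfloor>x / len i\<rfloor>\<close>, and passing to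
  a scale n steps coarser is integer division by 2^n, so the position at the finer scale determines
  the one at the coarser scale.\<close>

lemma dyadic_nested:
  assumes "fst i \<le> fst i'" "dyadic i \<inter> dyadic i' \<noteq> {}"
  shows "dyadic i' \<subseteq> dyadic i"
proof -
  obtain x where x: "x \<in> dyadic i" "x \<in> dyadic i'" using assms(2) by blast
  define n where "n = nat (fst i' - fst i)"
  have "len i = 2 powr (real n + - real_of_int (fst i'))" using assms(1) by (simp add: len_def n_def)
  then have len: "len i = len i' * real_of_int (2 ^ n)" unfolding powr_add by (simp add: len_def powr_realpow)
  have "\<lfloor>y / len i\<rfloor> = \<lfloor>y / len i'\<rfloor> div 2 ^ n" for y
    unfolding len using floor_divide_real_eq_div[of "2 ^ n" "y / len i'"] by (simp add: field_simps)
  then show ?thesis using x by (auto simp: mem_dyadic_iff)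
qed

lemma dyadic_eqI:
  assumes "fst i = fst i'" "dyadic i \<inter> dyadic i' \<noteq> {}" shows "i = i'"
  using assms by (auto simp: mem_dyadic_iff len_def prod_eq_iff)

lemma dyadic_lmeasurable [simp, measurable]: "dyadic i \<in> lmeasurable" "dyadic i \<in> sets lebesgue"
  and dilate_lmeasurable [simp, measurable]: "dilate r i \<in> lmeasurable" "dilate r i \<in> sets lebesgue"
proof -
  show "dyadic i \<in> lmeasurable" unfolding dyadic_def
    by (rule bounded_set_imp_lmeasurable) (auto intro: bounded_subset[OF bounded_closed_interval])
  then show "dyadic i \<in> sets lebesgue" by auto
  show "dilate r i \<in> lmeasurable" "dilate r i \<in> sets lebesgue" unfolding dilate_def by auto
qed

lemma measure_dyadic: "measure lebesgue (dyadic i) = len i"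
  by (simp add: dyadic_def measure_def emeasure_lborel_Ico algebra_simps)

lemma measure_dilate: "r \<ge> 0 \<Longrightarrow> measure lebesgue (dilate r i) = 2 * r * len i"
  using mult_right_mono[of "of_int (snd i) - r" "of_int (snd i) + r" "len i"]
  by (simp add: dilate_def measure_def emeasure_lborel_Icc_eq algebra_simps)

text \<open>The members that are coarsest among all members they meet; these are the maximal intervals.\<close>
definition coarsest :: "(int \<times> int) set \<Rightarrow> (int \<times> int) set" where
  "coarsest S = {P \<in> S. \<forall>Q\<in>S. dyadic P \<inter> dyadic Q \<noteq> {} \<longrightarrow> fst P \<le> fst Q}"

lemma coarsest_subset: "coarsest S \<subseteq> S" by (auto simp: coarsest_def)

lemma coarsest_disjoint: "P \<in> coarsest S \<Longrightarrow> Q \<in> coarsest S \<Longrightarrow> P \<noteq> Q \<Longrightarrow> dyadic P \<inter> dyadic Q = {}"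
  by (rule ccontr) (use dyadic_eqI[of P Q] in \<open>force simp: coarsest_def Int_commute\<close>)

text \<open>Among the members that contain Q take one of least first component. A coarser member
  meeting it would contain it, hence Q, against the choice.\<close>

lemma coarsest_covers:
  assumes "finite S" "Q \<in> S" obtains P where "P \<in> coarsest S" "dyadic Q \<subseteq> dyadic P"
proof -
  define T where "T = {P \<in> S. dyadic Q \<subseteq> dyadic P}"
  have "finite T" "Q \<in> T" using assms by (auto simp: T_def)
  then have "finite T" "T \<noteq> {}" by auto
  then obtain P where P: "P \<in> T" "\<And>P'. P' \<in> T \<Longrightarrow> fst P \<le> fst P'"
    by (metis arg_min_if_finite(1) arg_min_least)
  have "fst P \<le> fst P'" if P': "P' \<in> S" "dyadic P \<inter> dyadic P' \<noteq> {}" for P'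
  proof (rule ccontr)
    assume "\<not> fst P \<le> fst P'"
    then have "dyadic P \<subseteq> dyadic P'" using dyadic_nested[of P' P] P'(2) by auto
    then have "P' \<in> T" using P(1) P'(1) by (auto simp: T_def)
    then show False using P(2) \<open>\<not> fst P \<le> fst P'\<close> by blast
  qed
  then have "P \<in> coarsest S" using P(1) by (auto simp: coarsest_def T_def)
  then show ?thesis using that P(1) by (auto simp: T_def)
qed

lemma measure_disjoint_dyadic:
  assumes "finite S" "\<And>P Q. P \<in> S \<Longrightarrow> Q \<in> S \<Longrightarrow> P \<noteq> Q \<Longrightarrow> dyadic P \<inter> dyadic Q = {}"
  shows "measure lebesgue (\<Union>P\<in>S. dyadic P) = (\<Sum>P\<in>S. len P)"
  using measure_finite_Union[of S dyadic lebesgue] assms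
  by (simp add: disjoint_family_on_def measure_dyadic image_subset_iff emeasure_eq_measure2 fmeasurableD2)

lemma sum_len_le:
  assumes "finite S" "\<And>P Q. P \<in> S \<Longrightarrow> Q \<in> S \<Longrightarrow> P \<noteq> Q \<Longrightarrow> dyadic P \<inter> dyadic Q = {}"
    "(\<Union>P\<in>S. dyadic P) \<subseteq> A" "A \<in> lmeasurable"
  shows "(\<Sum>P\<in>S. len P) \<le> measure lebesgue A"
proof -
  have "(\<Sum>P\<in>S. len P) = measure lebesgue (\<Union>P\<in>S. dyadic P)"
    using measure_disjoint_dyadic[OF assms(1,2)] by simp
  also have "\<dots> \<le> measure lebesgue A"
    using assms(1) by (intro measure_mono_fmeasurable assms(3,4)) auto
  finally show ?thesis .
qed

lemma dyadic_subset_dilate_hit: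
  assumes "fst i \<le> fst P" "dilate r i \<inter> dyadic P \<noteq> {}"
  shows "dyadic P \<subseteq> dilate (r + 1) i"
proof
  fix y assume y: "y \<in> dyadic P"
  obtain x where x: "x \<in> dilate r i" "x \<in> dyadic P" using assms(2) by blast
  have "\<bar>x - y\<bar> \<le> len i" using dyadic_dist[OF x(2) y] len_mono[OF assms(1)] by simp
  then show "y \<in> dilate (r + 1) i" using x(1) by (auto simp: mem_dilate_iff algebra_simps)
qed

lemma dilate_nested:
  assumes "dyadic i' \<subseteq> dyadic i" "fst i \<le> fst i'" "r \<ge> 0"
  shows "dilate r i' \<subseteq> dilate (r + 1) i"
proof
  fix x assume x: "x \<in> dilate r i'"
  have "of_int (snd i') * len i' \<in> dyadic i" using assms(1) corner_mem_dyadic by blast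
  then have "\<bar>of_int (snd i') * len i' - of_int (snd i) * len i\<bar> \<le> len i" using dyadic_bounds by fastforce
  moreover have "r * len i' \<le> r * len i" using len_mono[OF assms(2)] assms(3) by (rule mult_left_mono)
  ultimately show "x \<in> dilate (r + 1) i" using x by (auto simp: mem_dilate_iff algebra_simps)
qed

text \<open>Every interval sits in a maximal one, and its r-dilate in the (r + 1)-dilate of that
  one, the extra unit paying for the distance of the left endpoints. Maximal intervals are disjoint,
  so their lengths add up to at most the measure of the union.\<close>

lemma measure_Union_dilate_le:
  assumes "finite F" "r \<ge> 0"
  shows "measure lebesgue (\<Union>i\<in>F. dilate r i) \<le> 2 * (r + 1) * measure lebesgue (\<Union>i\<in>F. dyadic i)"
proof -
  have fin: "finite (coarsest F)" using coarsest_subset assms(1) finite_subset by blast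
  have "(\<Union>i\<in>F. dilate r i) \<subseteq> (\<Union>i\<in>coarsest F. dilate (r + 1) i)"
  proof
    fix x assume "x \<in> (\<Union>i\<in>F. dilate r i)"
    then obtain i where i: "i \<in> F" "x \<in> dilate r i" by blast
    obtain P where P: "P \<in> coarsest F" "dyadic i \<subseteq> dyadic P" using coarsest_covers[OF assms(1) i(1)] .
    have "fst P \<le> fst i" using P i(1) dyadic_nonempty[of i] by (auto simp: coarsest_def)
    then show "x \<in> (\<Union>i\<in>coarsest F. dilate (r + 1) i)"
      using dilate_nested[OF P(2) _ assms(2)] i(2) P(1) by blast
  qed
  then have "measure lebesgue (\<Union>i\<in>F. dilate r i) \<le> measure lebesgue (\<Union>i\<in>coarsest F. dilate (r + 1) i)"
    using assms(1) fin by (intro measure_mono_fmeasurable fmeasurable.finite_UN) auto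
  also have "\<dots> \<le> (\<Sum>i\<in>coarsest F. measure lebesgue (dilate (r + 1) i))"
    using fin by (intro measure_UNION_le) auto
  also have "\<dots> = 2 * (r + 1) * (\<Sum>i\<in>coarsest F. len i)"
    using assms(2) by (simp add: measure_dilate sum_distrib_left)
  also have "(\<Sum>i\<in>coarsest F. len i) \<le> measure lebesgue (\<Union>i\<in>F. dyadic i)"
    using coarsest_subset[of F] assms(1) fin coarsest_disjoint[of _ F]
    by (intro sum_len_le fmeasurable.finite_UN) auto
  finally show ?thesis using assms(2) by (simp add: mult_left_mono)
qed

text \<open>The right-hand side is the exact geometric sum 1/4 + ... + 4^{-n}; in this form the
  induction closes.\<close>

lemma sum_quarter_powers: "(\<Sum>j\<in>{m - int n..<m}. (1/4) powr real_of_int (m - j)) \<le> (1 - (1/4) ^ n) / 3"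
proof (induction n)
  case (Suc n)
  have "{m - int (Suc n)..<m} = insert (m - int (Suc n)) {m - int n..<m}" by auto
  then have "(\<Sum>j\<in>{m - int (Suc n)..<m}. (1/4) powr real_of_int (m - j)) =
    (1/4) powr real (Suc n) + (\<Sum>j\<in>{m - int n..<m}. (1/4) powr real_of_int (m - j))"
    by simp
  also have "(1/4::real) powr real (Suc n) = (1/4) ^ Suc n" by (rule powr_realpow) simp
  finally show ?case using Suc by (simp add: field_simps)
qed simp

text \<open>At each scale only boundedly many dilated intervals meet P, and the weights are geometric in the scale.\<close>
lemma sum_hit_le:
  fixes N :: nat
  assumes "finite H" "\<And>i. i \<in> H \<Longrightarrow> fst i < fst P" "\<And>i. i \<in> H \<Longrightarrow> dilate N i \<inter> dyadic P \<noteq> {}"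
  shows "(\<Sum>i\<in>H. (len P / len i)\<^sup>2) \<le> 2 * real N + 5"
proof -
  \<comment> \<open>The 2N + 4 possible positions at scale j: the left endpoint of P, in units of
    2^{-j}, is within N + 1 of the position, and rounding it down to m costs one more unit at the
    top.\<close>
  define K where "K = (\<lambda>j::int. let m = \<lfloor>of_int (snd P) * len P * 2 powr of_int j\<rfloor> in {m - int N - 1 .. m + int N + 2})"
  obtain n where n: "\<And>i. i \<in> H \<Longrightarrow> fst P - int n \<le> fst i"
  proof -
    have "finite (fst ` H)" using assms(1) by simp
    then obtain b where "\<And>i. i \<in> H \<Longrightarrow> b \<le> fst i" by (meson bdd_below_finite bdd_below.unfold imageI)
    then show ?thesis by (intro that[of "nat (fst P - b)"]) fastforce
  qed
  have sub: "H \<subseteq> Sigma {fst P - int n..<fst P} K"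
  proof
    fix i assume i: "i \<in> H"
    have "dyadic P \<subseteq> dilate (N + 1) i"
      using dyadic_subset_dilate_hit[OF _ assms(3)[OF i]] assms(2)[OF i] by (simp add: add.commute)
    from subsetD[OF this corner_mem_dyadic]
    have "\<bar>of_int (snd P) * len P - of_int (snd i) * len i\<bar> \<le> (real N + 1) * len i"
      by (simp add: mem_dilate_iff add.commute)
    then have "\<bar>(of_int (snd P) * len P - of_int (snd i) * len i) / len i\<bar> \<le> real N + 1"
      by (simp add: pos_divide_le_eq)
    then have "\<bar>of_int (snd P) * len P * (1 / len i) - of_int (snd i)\<bar> \<le> real N + 1"
      by (simp add: diff_divide_distrib)
    then have "\<bar>of_int (snd P) * len P * 2 powr of_int (fst i) - of_int (snd i)\<bar> \<le> real N + 1"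
      unfolding inverse_len .
    then have "snd i \<in> K (fst i)" unfolding K_def Let_def atLeastAtMost_iff by linarith
    then show "i \<in> Sigma {fst P - int n..<fst P} K" using n[OF i] assms(2)[OF i] by (cases i) auto
  qed
  have ratio: "(len P / len i)\<^sup>2 = (1/4) powr real_of_int (fst P - fst i)" for i
  proof -
    have "len P / len i = 2 powr - real_of_int (fst P - fst i)"
      by (simp add: len_def flip: powr_diff)
    then have "(len P / len i)\<^sup>2 = 2 powr (- 2 * real_of_int (fst P - fst i))"
      by (simp add: power2_eq_square flip: powr_add)
    also have "\<dots> = (2 powr - 2) powr real_of_int (fst P - fst i)" by (rule powr_powr[symmetric])
    also have "(2::real) powr - 2 = 1/4" by (simp add: powr_minus_divide)
    finally show ?thesis .
  qed
  have finK: "finite (K j)" and cardK: "card (K j) = 2 * N + 4" for j by (auto simp: K_def Let_def)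
  have "(\<Sum>i\<in>H. (len P / len i)\<^sup>2) \<le> (\<Sum>i\<in>Sigma {fst P - int n..<fst P} K. (len P / len i)\<^sup>2)"
    using finK by (intro sum_mono2 sub finite_SigmaI) auto
  also have "\<dots> = (\<Sum>j\<in>{fst P - int n..<fst P}. \<Sum>k\<in>K j. (1/4) powr real_of_int (fst P - j))"
    unfolding ratio using finK by (subst sum.Sigma) (auto simp: case_prod_beta)
  also have "\<dots> = (2 * real N + 4) * (\<Sum>j\<in>{fst P - int n..<fst P}. (1/4) powr real_of_int (fst P - j))"
    by (simp add: cardK sum_distrib_left)
  also have "\<dots> \<le> (2 * real N + 4) * ((1 - (1/4) ^ n) / 3)"
    by (intro mult_left_mono sum_quarter_powers) auto
  also have "\<dots> \<le> (2 * real N + 4) * 1"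
  proof (rule mult_left_mono)
    show "(1 - (1/4) ^ n) / 3 \<le> (1::real)" by (rule order_trans[of _ "1/3"]) auto
  qed simp
  finally show ?thesis by simp
qed

section \<open>Local square sums of coefficients\<close>

lemma finite_hits: "finite {P. dilate r i \<inter> dyadic P \<noteq> {} \<and> fst i < fst P \<and> fst P \<le> J}"
proof (rule finite_subset)
  show "{P. dilate r i \<inter> dyadic P \<noteq> {} \<and> fst i < fst P \<and> fst P \<le> J} \<subseteq>
    (SIGMA j:{fst i<..J}. {\<lfloor>(of_int (snd i) - r) * len i * 2 powr of_int j\<rfloor>..\<lfloor>(of_int (snd i) + r) * len i * 2 powr of_int j\<rfloor>})"
  proof
    fix P assume "P \<in> {P. dilate r i \<inter> dyadic P \<noteq> {} \<and> fst i < fst P \<and> fst P \<le> J}"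
    then obtain x where x: "x \<in> dilate r i" "\<lfloor>x / len P\<rfloor> = snd P" "fst i < fst P" "fst P \<le> J"
      by (auto simp: mem_dyadic_iff)
    have "x / len P = x * 2 powr of_int (fst P)" by (simp flip: inverse_len)
    then have "snd P \<in> {\<lfloor>(of_int (snd i) - r) * len i * 2 powr of_int (fst P)\<rfloor>..\<lfloor>(of_int (snd i) + r) * len i * 2 powr of_int (fst P)\<rfloor>}"
      using x(1) unfolding x(2)[symmetric] dilate_def by (auto intro!: floor_mono mult_right_mono)
    then show "P \<in> (SIGMA j:{fst i<..J}. {\<lfloor>(of_int (snd i) - r) * len i * 2 powr of_int j\<rfloor>..\<lfloor>(of_int (snd i) + r) * len i * 2 powr of_int j\<rfloor>})"
      using x(3,4) by (cases P) auto
  qed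
qed auto

lemma test_functions_integrable:
  assumes "f \<in> test_functions" shows "integrable lebesgue f"
proof -
  obtain K R where f: "f \<in> borel_measurable lebesgue" "K \<ge> 0" "\<And>x. cmod (f x) \<le> K * indicator {-R..R} x"
    using assms by (metis test_functionsE)
  have "integrable lebesgue (indicator {-R..R} :: real \<Rightarrow> real)"
    by (rule integrable_real_indicator) (auto simp: emeasure_lborel_Icc_eq)
  then have "integrable lebesgue (\<lambda>x. K * indicator {-R..R} x :: real)"
    by (rule integrable_mult_right)
  then show ?thesis
    using f by (elim Bochner_Integration.integrable_bound) (auto intro: order_trans[OF f(3)])
qed

lemma test_mult_integrable:
  assumes f: "f \<in> test_functions" and g: "g \<in> test_functions"
  shows "integrable lebesgue (\<lambda>x. f x * g x)"
proof -
  obtain K where "g \<in> borel_measurable lebesgue" "\<And>x. cmod (g x) \<le> K" using test_functionsE[OF g] by metis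
  then show ?thesis by (intro test_functions_integrable test_functions_mult[OF f]) auto
qed

lemma test_mult_cnj_integrable:
  "f \<in> test_functions \<Longrightarrow> g \<in> test_functions \<Longrightarrow> integrable lebesgue (\<lambda>x. f x * cnj (g x))"
  by (intro test_mult_integrable test_functions_cnj)

lemma test_square_integrable:
  assumes "f \<in> test_functions" shows "integrable lebesgue (\<lambda>x. (cmod (f x))\<^sup>2)"
  using test_mult_cnj_integrable[OF assms assms]
  by (simp only: complex_norm_square[symmetric] complex_of_real_integrable_eq)

text \<open>The properties of \<psi>_{j,k} behind the norm bound. The Lipschitz constant is that of
  a rescaled function: the argument is stretched by 1 / len i and the amplitude by 1 / sqrt (len i).
  The set \<open>dilate N i\<close> is called the window of i below.\<close>

locale bump_system =
  fixes e :: "int \<times> int \<Rightarrow> real \<Rightarrow> complex" and N :: nat and L :: real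
  assumes test: "e i \<in> test_functions"
    and supp: "x \<notin> dilate N i \<Longrightarrow> e i x = 0"
    and lip: "cmod (e i x - e i y) \<le> L * \<bar>x - y\<bar> / (len i * sqrt (len i))"
    and orth: "(LINT x|lebesgue. e i x * cnj (e i' x)) = (if i = i' then 1 else 0)"
begin

lemma L_nonneg: "0 \<le> L"
proof -
  have "cmod (e (0,0) 0 - e (0,0) 1) \<le> L" using lip[of "(0,0)" 0 1] by (simp add: len_def)
  then show ?thesis using norm_ge_zero order_trans by blast
qed

lemma e_measurable [measurable]: "e i \<in> borel_measurable lebesgue"
  using test test_functions_measurable by blast

lemma span_test: "finite F \<Longrightarrow> (\<lambda>x. \<Sum>i\<in>F. c i * e i x) \<in> test_functions"
  by (intro fun_subspace_sum test_functions_subspace test)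

lemma e_mult_integrable: "integrable lebesgue (\<lambda>x. e i x * cnj (e j x))"
  by (rule test_mult_cnj_integrable[OF test test])

lemma integral_span_square:
  fixes c :: "int \<times> int \<Rightarrow> complex"
  assumes "finite F"
  defines "u \<equiv> \<lambda>x. \<Sum>i\<in>F. c i * e i x"
  shows "integrable lebesgue (\<lambda>x. (cmod (u x))\<^sup>2)" "(LINT x|lebesgue. (cmod (u x))\<^sup>2) = (\<Sum>i\<in>F. (cmod (c i))\<^sup>2)"
proof -
  have eq: "complex_of_real ((cmod (u x))\<^sup>2) = (\<Sum>i\<in>F. \<Sum>j\<in>F. c i * cnj (c j) * (e i x * cnj (e j x)))" for x
    unfolding complex_norm_square u_def by (simp add: sum_product cnj_sum algebra_simps)
  have "integrable lebesgue (\<lambda>x. complex_of_real ((cmod (u x))\<^sup>2))"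
    unfolding eq by (intro Bochner_Integration.integrable_sum integrable_mult_right e_mult_integrable)
  then show "integrable lebesgue (\<lambda>x. (cmod (u x))\<^sup>2)" by (simp only: complex_of_real_integrable_eq)
  have "complex_of_real (LINT x|lebesgue. (cmod (u x))\<^sup>2) = (LINT x|lebesgue. complex_of_real ((cmod (u x))\<^sup>2))"
    by (rule integral_complex_of_real[symmetric])
  also have "\<dots> = (\<Sum>i\<in>F. \<Sum>j\<in>F. c i * cnj (c j) * (if i = j then 1 else 0))"
    unfolding eq by (subst Bochner_Integration.integral_sum, intro Bochner_Integration.integrable_sum integrable_mult_right e_mult_integrable,
       subst Bochner_Integration.integral_sum, intro integrable_mult_right e_mult_integrable, simp add: orth)
  also have "\<dots> = (\<Sum>i\<in>F. c i * cnj (c i))" using assms(1) by (simp add: sum.delta if_distrib cong: if_cong)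
  also have "\<dots> = complex_of_real (\<Sum>i\<in>F. (cmod (c i))\<^sup>2)" unfolding of_real_sum complex_norm_square ..
  finally show "(LINT x|lebesgue. (cmod (u x))\<^sup>2) = (\<Sum>i\<in>F. (cmod (c i))\<^sup>2)" by (simp only: of_real_eq_iff)
qed

section \<open>A Whitney-type partition adapted to a finite set of indices\<close>

definition hits :: "int \<times> int \<Rightarrow> int \<times> int \<Rightarrow> bool" where
  "hits i P \<longleftrightarrow> dilate N i \<inter> dyadic P \<noteq> {}"

lemma e_osc:
  assumes "x \<in> dyadic P" "y \<in> dyadic P"
  shows "cmod (e i x - e i y) \<le> (if hits i P then L * len P / (len i * sqrt (len i)) else 0)"
proof (cases "hits i P")
  case True
  have "cmod (e i x - e i y) \<le> L * \<bar>x - y\<bar> / (len i * sqrt (len i))" by (rule lip)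
  also have "\<dots> \<le> L * len P / (len i * sqrt (len i))"
    using dyadic_dist[OF assms] by (intro divide_right_mono mult_left_mono L_nonneg) auto
  finally show ?thesis using True by simp
next
  case False
  then have "x \<notin> dilate N i" "y \<notin> dilate N i" using assms by (auto simp: hits_def)
  then show ?thesis using False by (simp add: supp)
qed

text \<open>On such an interval no \<open>e i\<close> with i in F varies much, since the interval is
  shorter than each i whose window it meets. The scale cap keeps the set finite and leaves one scale
  finer than all of F, enough to cover every window.\<close>

definition admissible :: "(int \<times> int) set \<Rightarrow> (int \<times> int) set" where
  "admissible F = {P. (\<exists>i\<in>F. hits i P) \<and> (\<forall>i\<in>F. hits i P \<longrightarrow> fst i < fst P) \<and> fst P \<le> Max (fst ` F) + 1}"

definition cells :: "(int \<times> int) set \<Rightarrow> (int \<times> int) set" where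
  "cells F = coarsest (admissible F)"

lemma finite_admissible:
  assumes "finite F"
  shows "finite (admissible F)"
proof (rule finite_subset)
  show "admissible F \<subseteq> (\<Union>i\<in>F. {P. dilate N i \<inter> dyadic P \<noteq> {} \<and> fst i < fst P \<and> fst P \<le> Max (fst ` F) + 1})"
    unfolding admissible_def hits_def by blast
qed (use assms finite_hits in blast)

lemma cells_admissible: "P \<in> cells F \<Longrightarrow> P \<in> admissible F"
  using coarsest_subset unfolding cells_def by blast

lemma finite_cells: "finite F \<Longrightarrow> finite (cells F)"
  using finite_admissible cells_admissible finite_subset by (metis subsetI)

lemma cellsD:
  assumes "P \<in> cells F"
  shows "\<exists>i\<in>F. hits i P" "i \<in> F \<Longrightarrow> hits i P \<Longrightarrow> fst i < fst P" "fst P \<le> Max (fst ` F) + 1"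
  using cells_admissible[OF assms] unfolding admissible_def by blast+

lemma cells_coarsest:
  "P \<in> cells F \<Longrightarrow> Q \<in> admissible F \<Longrightarrow> dyadic P \<inter> dyadic Q \<noteq> {} \<Longrightarrow> fst P \<le> fst Q"
  unfolding cells_def coarsest_def by blast

lemma cells_disjoint: "P \<in> cells F \<Longrightarrow> Q \<in> cells F \<Longrightarrow> P \<noteq> Q \<Longrightarrow> dyadic P \<inter> dyadic Q = {}"
  unfolding cells_def by (rule coarsest_disjoint)

lemma cells_cover:
  assumes F: "finite F" and i: "i \<in> F" "x \<in> dilate N i"
  shows "\<exists>P\<in>cells F. x \<in> dyadic P"
proof -
  define J where "J = Max (fst ` F) + 1"
  \<comment> \<open>The interval of the finest permitted scale around x; it is shorter than all
    members of F, hence admissible.\<close>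
  define Q where "Q = (J, \<lfloor>x / 2 powr (- real_of_int J)\<rfloor>)"
  have x: "x \<in> dyadic Q" by (simp add: mem_dyadic_iff Q_def len_def)
  have "fst i' < J" if "i' \<in> F" for i' using Max_ge[of "fst ` F" "fst i'"] that F by (simp add: J_def)
  moreover have "hits i Q" using i(2) x unfolding hits_def by blast
  moreover have "fst Q = J" by (simp add: Q_def)
  ultimately have "Q \<in> admissible F" using i(1) unfolding admissible_def J_def by auto
  then obtain P where "P \<in> cells F" "dyadic Q \<subseteq> dyadic P"
    unfolding cells_def using coarsest_covers[OF finite_admissible[OF F]] by metis
  then show ?thesis using x by blast
qed

text \<open>The parent of a cell is not admissible, so it meets the dilate of an interval that is not longer.\<close>
lemma cells_average:
  assumes F: "finite F" and P: "P \<in> cells F"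
    and hyp: "\<And>i a b. i \<in> F \<Longrightarrow> a < b \<Longrightarrow> dyadic i \<subseteq> {a..b} \<Longrightarrow>
       (\<integral>\<^sup>+ y \<in> {a..b}. g y \<partial>lebesgue) \<le> ennreal (lam * (b - a))"
  shows "(\<integral>\<^sup>+ y \<in> dyadic P. g y \<partial>lebesgue) \<le> ennreal (lam * (4 * (real N + 1) * len P))"
proof -
  define x where "x = of_int (snd P) * len P"
  have x: "x \<in> dyadic P" unfolding x_def by (rule corner_mem_dyadic)
  define Q where "Q = (fst P - 1, \<lfloor>x / (2 * len P)\<rfloor>)"
  have lenQ: "len Q = 2 * len P"
  proof -
    have "len Q = 2 powr (1 + - real_of_int (fst P))" by (simp add: Q_def len_def)
    then show ?thesis unfolding powr_add by (simp add: len_def)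
  qed
  have xQ: "x \<in> dyadic Q" by (simp add: mem_dyadic_iff lenQ) (simp add: Q_def)
  have PQ: "dyadic P \<subseteq> dyadic Q" using x xQ by (intro dyadic_nested) (auto simp: Q_def)
  have "\<exists>i\<in>F. hits i Q \<and> fst Q \<le> fst i"
  proof (rule ccontr)
    assume "\<not> ?thesis"
    then have "\<forall>i\<in>F. hits i Q \<longrightarrow> fst i < fst Q" by force
    moreover have "\<exists>i\<in>F. hits i Q" using cellsD(1)[OF P] PQ unfolding hits_def by blast
    moreover have "fst Q \<le> Max (fst ` F) + 1" using cellsD(3)[OF P] by (simp add: Q_def)
    ultimately have "Q \<in> admissible F" unfolding admissible_def by blast
    then have "fst P \<le> fst Q" using cells_coarsest[OF P] x xQ by blast
    then show False by (simp add: Q_def)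
  qed
  then obtain i where i: "i \<in> F" "hits i Q" "fst Q \<le> fst i" by blast
  then obtain z where z: "z \<in> dilate N i" "z \<in> dyadic Q" by (auto simp: hits_def)
  \<comment> \<open>The point z lies in the window of i and in the parent Q, and len i \<le> len Q;
    so radius (N + 1) len Q around z reaches over both i and P. As len Q = 2 len P, the interval has
    length 4 (N + 1) len P.\<close>
  define r where "r = (real N + 1) * len Q"
  have r: "len Q \<le> r" "0 < r" unfolding r_def by (auto simp: algebra_simps intro: add_pos_nonneg)
  have len_i: "len i \<le> len Q" by (rule len_mono[OF i(3)])
  have "dyadic i \<subseteq> {z - r..z + r}"
  proof
    fix y assume "y \<in> dyadic i"
    then have "\<bar>y - of_int (snd i) * len i\<bar> \<le> 1 * len i" using dyadic_subset_dilate mem_dilate_iff by blast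
    then have "\<bar>y - z\<bar> \<le> (real N + 1) * len i" using z(1) by (auto simp: mem_dilate_iff algebra_simps)
    also have "\<dots> \<le> r" unfolding r_def using len_i by (intro mult_left_mono) auto
    finally show "y \<in> {z - r..z + r}" by (auto simp: abs_le_iff)
  qed
  then have le: "(\<integral>\<^sup>+ y \<in> {z - r..z + r}. g y \<partial>lebesgue) \<le> ennreal (lam * ((z + r) - (z - r)))"
    using r(2) by (intro hyp[OF i(1)]) auto
  have "dyadic P \<subseteq> {z - r..z + r}"
  proof
    fix y assume "y \<in> dyadic P"
    then have "\<bar>y - z\<bar> \<le> len Q" using dyadic_dist[of y Q z] PQ z(2) by auto
    then show "y \<in> {z - r..z + r}" using r(1) by auto
  qed
  then have "(\<integral>\<^sup>+ y \<in> dyadic P. g y \<partial>lebesgue) \<le> (\<integral>\<^sup>+ y \<in> {z - r..z + r}. g y \<partial>lebesgue)"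
    by (intro nn_integral_mono) (auto split: split_indicator)
  also note le
  also have "(z + r) - (z - r) = 4 * (real N + 1) * len P" by (simp add: r_def lenQ)
  finally show ?thesis .
qed

text \<open>Cells meeting the window of i are disjoint and shorter than i, so all of them lie in the
  (N + 1)-dilate of i.\<close>

lemma cells_sum_len_hit:
  assumes F: "finite F" and i: "i \<in> F"
  shows "(\<Sum>P\<in>{P\<in>cells F. hits i P}. len P) \<le> 2 * (real N + 1) * len i"
proof -
  have "(\<Sum>P\<in>{P\<in>cells F. hits i P}. len P) \<le> measure lebesgue (dilate (N + 1) i)"
  proof (rule sum_len_le)
    show "(\<Union>P\<in>{P \<in> cells F. hits i P}. dyadic P) \<subseteq> dilate (N + 1) i"
    proof (rule UN_least)
      fix P assume "P \<in> {P \<in> cells F. hits i P}"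
      then show "dyadic P \<subseteq> dilate (N + 1) i"
        using cellsD(2)[OF _ i] dyadic_subset_dilate_hit[of i P N] by (auto simp: hits_def add.commute less_imp_le)
    qed
    show "dyadic P \<inter> dyadic Q = {}" if "P \<in> {P \<in> cells F. hits i P}" "Q \<in> {P \<in> cells F. hits i P}" "P \<noteq> Q" for P Q
      using that cells_disjoint by blast
  qed (use finite_cells[OF F] in auto)
  then show ?thesis by (simp add: measure_dilate add.commute)
qed

lemma cells_sum_len:
  assumes F: "finite F"
  shows "(\<Sum>P\<in>cells F. len P) \<le> 2 * (real N + 2) * measure lebesgue (\<Union>i\<in>F. dyadic i)"
proof -
  have "(\<Sum>P\<in>cells F. len P) \<le> measure lebesgue (\<Union>i\<in>F. dilate (N + 1) i)"
  proof (rule sum_len_le)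
    show "(\<Union>P\<in>cells F. dyadic P) \<subseteq> (\<Union>i\<in>F. dilate (N + 1) i)"
    proof (rule UN_least)
      fix P assume P: "P \<in> cells F"
      then obtain i where i: "i \<in> F" "hits i P" using cellsD(1) by blast
      then have "dyadic P \<subseteq> dilate (N + 1) i"
        using cellsD(2)[OF P i] dyadic_subset_dilate_hit[of i P N] by (auto simp: hits_def add.commute less_imp_le)
      then show "dyadic P \<subseteq> (\<Union>i\<in>F. dilate (N + 1) i)" using i(1) by blast
    qed
  qed (use finite_cells[OF F] cells_disjoint F in \<open>simp_all add: fmeasurable.finite_UN\<close>)
  also have "\<dots> \<le> 2 * (real (N + 1) + 1) * measure lebesgue (\<Union>i\<in>F. dyadic i)"
    by (rule measure_Union_dilate_le[OF F]) simp
  finally show ?thesis by (simp add: add.commute)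
qed

text \<open>Cauchy-Schwarz over the pairs (P, i) that meet. The weight len P^2 / len i^{3/2} is
  split so that the first factor is summed over P for fixed i by \<open>cells_sum_len_hit\<close>,
  and the second over i for fixed P by \<open>sum_hit_le\<close>.\<close>

lemma cells_weighted_sum:
  assumes F: "finite F"
  shows "(\<Sum>P\<in>cells F. len P * (\<Sum>i\<in>F. cmod (a i) * (if hits i P then L * len P / (len i * sqrt (len i)) else 0)))
    \<le> L * (sqrt (2 * (real N + 1) * (\<Sum>i\<in>F. (cmod (a i))\<^sup>2)) * sqrt ((2 * real N + 5) * (\<Sum>P\<in>cells F. len P)))"
proof -
  let ?C = "cells F"
  note finC = finite_cells[OF F]
  define \<alpha> where "\<alpha> = (\<lambda>(P, i). if hits i P then cmod (a i) * sqrt (len P) / sqrt (len i) else 0)"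
  define \<beta> where "\<beta> = (\<lambda>(P, i). if hits i P then len P * sqrt (len P) / len i else 0)"
  have \<alpha>2: "(\<alpha> (P, i))\<^sup>2 = (if hits i P then (cmod (a i))\<^sup>2 / len i * len P else 0)" for P i
    by (simp add: \<alpha>_def power_mult_distrib power_divide real_sqrt_pow2)
  have \<beta>2: "(\<beta> (P, i))\<^sup>2 = (if hits i P then len P * (len P / len i)\<^sup>2 else 0)" for P i
    by (simp add: \<beta>_def power_mult_distrib power_divide real_sqrt_pow2)
  have summand: "len P * (cmod (a i) * (if hits i P then L * len P / (len i * sqrt (len i)) else 0))
      = L * (\<bar>\<alpha> (P, i)\<bar> * \<bar>\<beta> (P, i)\<bar>)" for P i
    by (simp add: \<alpha>_def \<beta>_def abs_mult mult_ac)
  have "(\<Sum>P\<in>?C. len P * (\<Sum>i\<in>F. cmod (a i) * (if hits i P then L * len P / (len i * sqrt (len i)) else 0)))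
      = L * (\<Sum>p\<in>?C \<times> F. \<bar>\<alpha> p\<bar> * \<bar>\<beta> p\<bar>)"
    unfolding sum_distrib_left summand by (simp add: sum.cartesian_product)
  also have "\<dots> \<le> L * (L2_set \<alpha> (?C \<times> F) * L2_set \<beta> (?C \<times> F))"
    by (intro mult_left_mono L2_set_mult_ineq L_nonneg)
  also have "\<dots> \<le> L * (sqrt (2 * (real N + 1) * (\<Sum>i\<in>F. (cmod (a i))\<^sup>2)) * sqrt ((2 * real N + 5) * (\<Sum>P\<in>?C. len P)))"
  proof (intro mult_left_mono mult_mono L_nonneg)
    have "(\<Sum>p\<in>?C \<times> F. (\<alpha> p)\<^sup>2) = (\<Sum>i\<in>F. \<Sum>P\<in>?C. (\<alpha> (P, i))\<^sup>2)"
      by (subst sum.swap) (simp add: sum.cartesian_product)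
    also have "\<dots> \<le> (\<Sum>i\<in>F. 2 * (real N + 1) * (cmod (a i))\<^sup>2)"
    proof (rule sum_mono)
      fix i assume i: "i \<in> F"
      have "(\<Sum>P\<in>?C. (\<alpha> (P, i))\<^sup>2) = (cmod (a i))\<^sup>2 / len i * (\<Sum>P\<in>{P\<in>?C. hits i P}. len P)"
        unfolding \<alpha>2 sum_distrib_left sum.inter_filter[OF finC] by (intro sum.cong) auto
      also have "\<dots> \<le> (cmod (a i))\<^sup>2 / len i * (2 * (real N + 1) * len i)"
        by (intro mult_left_mono cells_sum_len_hit[OF F i]) simp
      finally show "(\<Sum>P\<in>?C. (\<alpha> (P, i))\<^sup>2) \<le> 2 * (real N + 1) * (cmod (a i))\<^sup>2" by (simp add: mult_ac)
    qed
    finally show "L2_set \<alpha> (?C \<times> F) \<le> sqrt (2 * (real N + 1) * (\<Sum>i\<in>F. (cmod (a i))\<^sup>2))"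
      unfolding L2_set_def by (simp add: sum_distrib_left)
    have "(\<Sum>p\<in>?C \<times> F. (\<beta> p)\<^sup>2) = (\<Sum>P\<in>?C. \<Sum>i\<in>F. (\<beta> (P, i))\<^sup>2)"
      by (simp add: sum.cartesian_product)
    also have "\<dots> \<le> (\<Sum>P\<in>?C. (2 * real N + 5) * len P)"
    proof (rule sum_mono)
      fix P assume P: "P \<in> ?C"
      have "(\<Sum>i\<in>F. (\<beta> (P, i))\<^sup>2) = len P * (\<Sum>i\<in>{i\<in>F. hits i P}. (len P / len i)\<^sup>2)"
        unfolding \<beta>2 sum_distrib_left sum.inter_filter[OF F] by (intro sum.cong) auto
      also have "\<dots> \<le> len P * (2 * real N + 5)"
        using F cellsD(2)[OF P] by (intro mult_left_mono sum_hit_le) (auto simp: hits_def)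
      finally show "(\<Sum>i\<in>F. (\<beta> (P, i))\<^sup>2) \<le> (2 * real N + 5) * len P" by (simp add: mult.commute)
    qed
    finally show "L2_set \<beta> (?C \<times> F) \<le> sqrt ((2 * real N + 5) * (\<Sum>P\<in>?C. len P))"
      unfolding L2_set_def by (simp add: sum_distrib_left)
  qed (auto intro!: L2_set_nonneg sum_nonneg mult_nonneg_nonneg)
  finally show ?thesis .
qed

text \<open>Cells are disjoint, so the step function taking on each cell the infimum of |u| stays
  below |u|.\<close>

lemma cells_min_square_sum:
  assumes F: "finite F" and u: "integrable lebesgue (\<lambda>x. (cmod (u x))\<^sup>2)"
  shows "(\<Sum>P\<in>cells F. len P * (INF y\<in>dyadic P. cmod (u y))\<^sup>2) \<le> (LINT x|lebesgue. (cmod (u x))\<^sup>2)"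
proof -
  define m where "m = (\<lambda>P. INF y\<in>dyadic P. cmod (u y))"
  have m0: "0 \<le> m P" for P unfolding m_def using dyadic_nonempty by (intro cINF_greatest) auto
  have mle: "m P \<le> cmod (u x)" if "x \<in> dyadic P" for P x
    unfolding m_def using that by (intro cINF_lower) (auto intro: bdd_belowI[of _ 0])
  note finC = finite_cells[OF F]
  have int: "integrable lebesgue (\<lambda>x. (m P)\<^sup>2 * indicator (dyadic P) x)" for P
    using dyadic_lmeasurable(1)[of P] by (intro integrable_mult_right integrable_real_indicator) (auto simp: fmeasurable_def)
  have "(\<Sum>P\<in>cells F. len P * (m P)\<^sup>2) = (LINT x|lebesgue. (\<Sum>P\<in>cells F. (m P)\<^sup>2 * indicator (dyadic P) x))"
    using int by (subst Bochner_Integration.integral_sum) (auto simp: measure_dyadic mult.commute)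
  also have "\<dots> \<le> (LINT x|lebesgue. (cmod (u x))\<^sup>2)"
  proof (intro integral_mono Bochner_Integration.integrable_sum int u)
    fix x
    show "(\<Sum>P\<in>cells F. (m P)\<^sup>2 * indicator (dyadic P) x) \<le> (cmod (u x))\<^sup>2"
    proof (cases "\<exists>P\<in>cells F. x \<in> dyadic P")
      case True
      then obtain P where P: "P \<in> cells F" "x \<in> dyadic P" by blast
      have "x \<notin> dyadic Q" if "Q \<in> cells F - {P}" for Q using cells_disjoint[of P F Q] P that by blast
      then have "(\<Sum>Q\<in>cells F. (m Q)\<^sup>2 * indicator (dyadic Q) x) = (\<Sum>Q\<in>{P}. (m Q)\<^sup>2 * indicator (dyadic Q) x)"
        using P(1) finC by (intro sum.mono_neutral_right) (auto simp: indicator_def)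
      also have "\<dots> \<le> (cmod (u x))\<^sup>2" using P(2) mle[OF P(2)] m0[of P] by (simp add: power_mono)
      finally show ?thesis .
    next
      case False
      then have "(\<Sum>P\<in>cells F. (m P)\<^sup>2 * indicator (dyadic P) x) = 0" by (intro sum.neutral) auto
      then show ?thesis by simp
    qed
  qed
  finally show ?thesis unfolding m_def .
qed

text \<open>The factor 4 (N + 1) is the loss in \<open>cells_average\<close>; in the bracket, 1
  accounts for the infima of u on the cells and the other term, from
  \<open>cells_weighted_sum\<close>, for its oscillation.\<close>

definition Bessel_const :: real where
  "Bessel_const = 4 * (real N + 1) * (1 + L * (sqrt (2 * (real N + 1)) * sqrt (2 * real N + 5)))"

lemma Bessel_const_nonneg: "0 \<le> Bessel_const"
  unfolding Bessel_const_def by (intro mult_nonneg_nonneg add_nonneg_nonneg L_nonneg) auto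

text \<open>An \<open>L\<^sup>1\<close> version of Bessel's inequality: testing f against \<open>u = \<Sum>i. a i * e i\<close>, on each cell one may replace
  the modulus of u by its minimum (controlled by the norm of u) plus its oscillation (controlled by the Lipschitz bound).\<close>
lemma sum_coeff_square_le:
  fixes f :: "real \<Rightarrow> complex"
  assumes F: "finite F" and [measurable]: "f \<in> borel_measurable lebesgue"
    and int: "\<And>i. integrable lebesgue (\<lambda>x. f x * cnj (e i x))" and lam: "0 \<le> lam"
    and hyp: "\<And>i a b. i \<in> F \<Longrightarrow> a < b \<Longrightarrow> dyadic i \<subseteq> {a..b} \<Longrightarrow>
       (\<integral>\<^sup>+ y \<in> {a..b}. ennreal (cmod (f y)) \<partial>lebesgue) \<le> ennreal (lam * (b - a))"
  shows "(\<Sum>i\<in>F. (cmod (LINT x|lebesgue. f x * cnj (e i x)))\<^sup>2)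
     \<le> Bessel_const\<^sup>2 * lam\<^sup>2 * (2 * (real N + 2) * measure lebesgue (\<Union>i\<in>F. dyadic i))"
proof -
  \<comment> \<open>The coefficients of f themselves become those of u, so that the integral of f
    against the conjugate of u is the square sum s to be bounded.\<close>
  define a where "a = (\<lambda>i. LINT x|lebesgue. f x * cnj (e i x))"
  define u where "u = (\<lambda>x. \<Sum>i\<in>F. a i * e i x)"
  define s where "s = (\<Sum>i\<in>F. (cmod (a i))\<^sup>2)"
  define W where "W = (\<Sum>P\<in>cells F. len P)"
  define osc where "osc = (\<lambda>P. \<Sum>i\<in>F. cmod (a i) * (if hits i P then L * len P / (len i * sqrt (len i)) else 0))"
  define m where "m = (\<lambda>P. INF y\<in>dyadic P. cmod (u y))"
  define A where "A = 4 * (real N + 1)"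
  note finC = finite_cells[OF F]
  have s0: "0 \<le> s" and W0: "0 \<le> W" unfolding s_def W_def by (auto intro: sum_nonneg)
  have u_meas [measurable]: "u \<in> borel_measurable lebesgue" unfolding u_def by measurable
  have osc0: "0 \<le> osc P" for P unfolding osc_def using L_nonneg by (intro sum_nonneg mult_nonneg_nonneg) auto
  have m0: "0 \<le> m P" for P unfolding m_def using dyadic_nonempty by (intro cINF_greatest) auto
  have u_le: "cmod (u x) \<le> m P + osc P" if x: "x \<in> dyadic P" for x P
  proof -
    have "cmod (u x) - osc P \<le> cmod (u y)" if y: "y \<in> dyadic P" for y
    proof -
      have "u x - u y = (\<Sum>i\<in>F. a i * (e i x - e i y))" by (simp add: u_def sum_subtractf algebra_simps)
      also have "cmod \<dots> \<le> (\<Sum>i\<in>F. cmod (a i) * cmod (e i x - e i y))"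
        by (rule order_trans[OF norm_sum]) (simp add: norm_mult)
      also have "\<dots> \<le> osc P" unfolding osc_def by (intro sum_mono mult_left_mono e_osc x y) simp
      finally show ?thesis using norm_triangle_ineq2[of "u x" "u y"] by simp
    qed
    then have "cmod (u x) - osc P \<le> m P" unfolding m_def using dyadic_nonempty by (intro cINF_greatest) auto
    then show ?thesis by simp
  qed
  have u_0: "u x = 0" if "\<And>P. P \<in> cells F \<Longrightarrow> x \<notin> dyadic P" for x
  proof -
    have "e i x = 0" if "i \<in> F" for i using cells_cover[OF F that] supp \<open>\<And>P. P \<in> cells F \<Longrightarrow> x \<notin> dyadic P\<close> by blast
    then show ?thesis by (simp add: u_def)
  qed
  have "complex_of_real s = (\<Sum>i\<in>F. cnj (a i) * a i)"
    unfolding s_def of_real_sum complex_norm_square by (simp add: mult.commute)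
  also have "\<dots> = (LINT x|lebesgue. (\<Sum>i\<in>F. cnj (a i) * (f x * cnj (e i x))))"
    unfolding a_def by (subst Bochner_Integration.integral_sum) (auto intro: int)
  also have "\<dots> = (LINT x|lebesgue. f x * cnj (u x))"
    by (simp add: u_def cnj_sum sum_distrib_left mult_ac)
  finally have s_eq: "complex_of_real s = (LINT x|lebesgue. f x * cnj (u x))" .
  have "integrable lebesgue (\<lambda>x. \<Sum>i\<in>F. cnj (a i) * (f x * cnj (e i x)))"
    by (intro Bochner_Integration.integrable_sum integrable_mult_right int)
  then have int_fu: "integrable lebesgue (\<lambda>x. f x * cnj (u x))"
    by (simp add: u_def cnj_sum sum_distrib_left mult_ac)
  have "ennreal s = ennreal (cmod (LINT x|lebesgue. f x * cnj (u x)))"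
    unfolding s_eq[symmetric] using s0 by simp
  also have "\<dots> \<le> (\<integral>\<^sup>+ x. ennreal (cmod (f x * cnj (u x))) \<partial>lebesgue)"
    by (rule integral_norm_bound_ennreal[OF int_fu])
  also have "\<dots> \<le> (\<integral>\<^sup>+ x. (\<Sum>P\<in>cells F. ennreal (m P + osc P) * (ennreal (cmod (f x)) * indicator (dyadic P) x)) \<partial>lebesgue)"
  proof (rule nn_integral_mono)
    fix x
    show "ennreal (cmod (f x * cnj (u x))) \<le> (\<Sum>P\<in>cells F. ennreal (m P + osc P) * (ennreal (cmod (f x)) * indicator (dyadic P) x))"
    proof (cases "\<exists>P\<in>cells F. x \<in> dyadic P")
      case True
      then obtain P where P: "P \<in> cells F" "x \<in> dyadic P" by blast
      have "cmod (f x * cnj (u x)) \<le> (m P + osc P) * cmod (f x)"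
        using mult_right_mono[OF u_le[OF P(2)] norm_ge_zero[of "f x"]] by (simp add: norm_mult mult.commute)
      then have "ennreal (cmod (f x * cnj (u x))) \<le> ennreal ((m P + osc P) * cmod (f x))" by (rule ennreal_leI)
      also have "\<dots> = ennreal (m P + osc P) * (ennreal (cmod (f x)) * indicator (dyadic P) x)"
        using P(2) m0[of P] osc0[of P] by (simp add: ennreal_mult del: ennreal_plus)
      also have "\<dots> \<le> (\<Sum>P\<in>cells F. ennreal (m P + osc P) * (ennreal (cmod (f x)) * indicator (dyadic P) x))"
        using finC P(1) by (intro member_le_sum) auto
      finally show ?thesis .
    next
      case False
      then show ?thesis using u_0[of x] by auto
    qed
  qed
  also have "\<dots> = (\<Sum>P\<in>cells F. ennreal (m P + osc P) * (\<integral>\<^sup>+ x\<in>dyadic P. ennreal (cmod (f x)) \<partial>lebesgue))"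
    by (subst nn_integral_sum) (auto simp: nn_integral_cmult)
  also have "\<dots> \<le> (\<Sum>P\<in>cells F. ennreal (m P + osc P) * ennreal (lam * (A * len P)))"
    unfolding A_def by (intro sum_mono mult_left_mono cells_average[OF F] hyp) auto
  also have "\<dots> = ennreal (\<Sum>P\<in>cells F. (m P + osc P) * (lam * (A * len P)))"
    using m0 osc0 lam by (simp add: A_def sum_ennreal del: ennreal_plus flip: ennreal_mult)
  also have "(\<Sum>P\<in>cells F. (m P + osc P) * (lam * (A * len P))) = lam * A * ((\<Sum>P\<in>cells F. len P * m P) + (\<Sum>P\<in>cells F. len P * osc P))"
    by (simp add: sum_distrib_left sum.distrib algebra_simps)
  finally have "ennreal s \<le> ennreal (lam * A * ((\<Sum>P\<in>cells F. len P * m P) + (\<Sum>P\<in>cells F. len P * osc P)))" .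
  then have s_le: "s \<le> lam * A * ((\<Sum>P\<in>cells F. len P * m P) + (\<Sum>P\<in>cells F. len P * osc P))"
    using m0 osc0 lam by (subst (asm) ennreal_le_iff) (auto simp: A_def intro!: mult_nonneg_nonneg add_nonneg_nonneg sum_nonneg)
  \<comment> \<open>Cauchy-Schwarz with weights len P; the weighted square sum of the infima is at
    most the squared L2 norm of u, which orthonormality identifies with s.\<close>
  have "(\<Sum>P\<in>cells F. len P * m P) = (\<Sum>P\<in>cells F. \<bar>sqrt (len P)\<bar> * \<bar>sqrt (len P) * m P\<bar>)"
    using m0 by (simp add: abs_mult flip: mult.assoc)
  also have "\<dots> \<le> L2_set (\<lambda>P. sqrt (len P)) (cells F) * L2_set (\<lambda>P. sqrt (len P) * m P) (cells F)"
    by (rule L2_set_mult_ineq)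
  also have "\<dots> \<le> sqrt W * sqrt s"
  proof (rule mult_mono)
    show "L2_set (\<lambda>P. sqrt (len P)) (cells F) \<le> sqrt W" by (simp add: L2_set_def W_def)
    show "L2_set (\<lambda>P. sqrt (len P) * m P) (cells F) \<le> sqrt s"
      using cells_min_square_sum[OF F integral_span_square(1)[OF F, of a]]
      unfolding integral_span_square(2)[OF F]
      by (simp add: L2_set_def power_mult_distrib m_def u_def s_def)
  qed (use W0 L2_set_nonneg in auto)
  finally have 1: "(\<Sum>P\<in>cells F. len P * m P) \<le> sqrt W * sqrt s" .
  have 2: "(\<Sum>P\<in>cells F. len P * osc P) \<le> L * (sqrt (2 * (real N + 1)) * sqrt (2 * real N + 5)) * (sqrt W * sqrt s)"
    using cells_weighted_sum[OF F, of a]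
    by (simp add: osc_def s_def W_def real_sqrt_mult mult_ac)
  have "s \<le> lam * A * (sqrt W * sqrt s + L * (sqrt (2 * (real N + 1)) * sqrt (2 * real N + 5)) * (sqrt W * sqrt s))"
    using lam by (intro order_trans[OF s_le] mult_left_mono add_mono 1 2) (auto simp: A_def)
  also have "\<dots> = Bessel_const * lam * sqrt W * sqrt s"
    unfolding Bessel_const_def A_def by (simp add: algebra_simps)
  finally have *: "sqrt s * sqrt s \<le> Bessel_const * lam * sqrt W * sqrt s" using s0 by simp
  \<comment> \<open>One factor sqrt s is cancelled, which is legitimate because s is a finite real
    number.\<close>
  have "sqrt s \<le> Bessel_const * lam * sqrt W"
  proof (cases "s = 0")
    case True
    then show ?thesis using lam W0 Bessel_const_nonneg by simp
  next
    case False
    then have "0 < sqrt s" using s0 by simp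
    then show ?thesis using * mult_right_le_imp_le by blast
  qed
  then have "(sqrt s)\<^sup>2 \<le> (Bessel_const * lam * sqrt W)\<^sup>2" using s0 by (intro power_mono) auto
  then have "s \<le> Bessel_const\<^sup>2 * lam\<^sup>2 * W" using s0 W0 by (simp add: power_mult_distrib)
  also have "\<dots> \<le> Bessel_const\<^sup>2 * lam\<^sup>2 * (2 * (real N + 2) * measure lebesgue (\<Union>i\<in>F. dyadic i))"
    unfolding W_def by (intro mult_left_mono cells_sum_len[OF F]) simp
  finally show ?thesis unfolding s_def a_def .
qed

end

section \<open>Domination by maximal functions\<close>

lemma sum_powr_le:
  assumes "finite A" "\<And>p. p \<in> A \<Longrightarrow> p \<le> M"
  shows "(\<Sum>p\<in>A. 2 powr real_of_int p) \<le> 2 * 2 powr real_of_int M"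
  using assms
proof (induction A arbitrary: M rule: finite_linorder_max_induct)
  case (insert b A)
  have "(\<Sum>p\<in>A. 2 powr real_of_int p) \<le> 2 * 2 powr real_of_int (b - 1)"
    using insert.hyps(2) by (intro insert.IH) force
  also have "\<dots> = 2 powr real_of_int b" by (simp add: powr_diff)
  finally have "(\<Sum>p\<in>insert b A. 2 powr real_of_int p) \<le> 2 * 2 powr real_of_int b"
    using insert.hyps by (subst sum.insert) auto
  also have "\<dots> \<le> 2 * 2 powr real_of_int M" using insert.prems by simp
  finally show ?case .
qed simp

text \<open>A finite sum of distinct powers of 2 is at most twice its largest term, and that term is
  at most y.\<close>

lemma sum_levels_le:
  fixes y :: ennreal
  assumes "finite A"
  shows "(\<Sum>p\<in>A. if ennreal (2 powr real_of_int p) \<le> y then ennreal (2 powr real_of_int p) else 0) \<le> 2 * y"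
proof -
  define A' where "A' = {p \<in> A. ennreal (2 powr real_of_int p) \<le> y}"
  have fin: "finite A'" using assms by (simp add: A'_def)
  have "(\<Sum>p\<in>A. if ennreal (2 powr real_of_int p) \<le> y then ennreal (2 powr real_of_int p) else 0)
     = (\<Sum>p\<in>A'. ennreal (2 powr real_of_int p))"
    unfolding A'_def sum.inter_filter[OF assms] ..
  also have "\<dots> \<le> 2 * y"
  proof (cases "A' = {}")
    case False
    have "(\<Sum>p\<in>A'. ennreal (2 powr real_of_int p)) = ennreal (\<Sum>p\<in>A'. 2 powr real_of_int p)" by (simp add: sum_ennreal)
    also have "\<dots> \<le> ennreal (2 * 2 powr real_of_int (Max A'))"
      using fin by (intro ennreal_leI sum_powr_le) auto
    also have "\<dots> = 2 * ennreal (2 powr real_of_int (Max A'))" by (simp add: ennreal_mult)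
    also have "\<dots> \<le> 2 * y" using Max_in[OF fin False] by (intro mult_left_mono) (auto simp: A'_def)
    finally show ?thesis .
  qed simp
  finally show ?thesis .
qed

lemma AE_finite_if_locally_integrable:
  assumes [measurable]: "u \<in> borel_measurable lebesgue"
    and "\<And>n. (\<integral>\<^sup>+ x\<in>{-real n..real n}. u x \<partial>lebesgue) < \<infinity>"
  shows "AE x in lebesgue. u x < \<infinity>"
proof -
  have "AE x in lebesgue. u x * indicator {-real n..real n} x \<noteq> \<infinity>" for n
    using assms(2)[of n] by (intro nn_integral_PInf_AE) auto
  then have "AE x in lebesgue. \<forall>n. u x * indicator {-real n..real n} x \<noteq> \<infinity>"
    by (subst AE_all_countable) blast
  then show ?thesis
  proof eventually_elim
    case (elim x)
    obtain n where "\<bar>x\<bar> \<le> real n" using real_arch_simple by blast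
    then have "x \<in> {-real n..real n}" by auto
    then show ?case using elim[rule_format, of n] by (auto simp: less_top)
  qed
qed

section \<open>Hoelder's inequality and finiteness almost everywhere\<close>

context banach_fun_norm
begin

text \<open>The supremum in the associate norm, applied to u / rho u. If rho u = 0 the right-hand
  side is 0 even when the other factor is infinite, and u vanishes a.e.\<close>

lemma Hoelder:
  assumes [measurable]: "u \<in> borel_measurable lebesgue" "v \<in> borel_measurable lebesgue" and fin: "rho u < \<infinity>"
  shows "(\<integral>\<^sup>+ x. u x * v x \<partial>lebesgue) \<le> rho u * assoc_norm rho v"
proof (cases "rho u = 0")
  case True
  then have "AE x in lebesgue. u x = 0" using rho_eq_0[of u] by simp
  then have "AE x in lebesgue. u x * v x = 0" by eventually_elim simp
  then have "(\<integral>\<^sup>+ x. u x * v x \<partial>lebesgue) = 0" by (subst nn_integral_0_iff_AE) auto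
  then show ?thesis by simp
next
  case False
  define t where "t = enn2real (rho u)"
  have t: "rho u = ennreal t" "0 < t"
    using False fin by (auto simp: t_def enn2real_positive_iff less_top zero_less_iff_neq_zero)
  have "rho (\<lambda>x. ennreal (1 / t) * u x) = ennreal (1 / t) * ennreal t"
    using t rho_scale[of u "1 / t"] by simp
  also have "\<dots> = 1" using t(2) by (simp flip: ennreal_mult)
  finally have "(\<integral>\<^sup>+ x. ennreal (1 / t) * u x * v x \<partial>lebesgue) \<le> assoc_norm rho v"
    unfolding assoc_norm_def by (intro SUP_upper) auto
  then have "rho u * (ennreal (1 / t) * (\<integral>\<^sup>+ x. u x * v x \<partial>lebesgue)) \<le> rho u * assoc_norm rho v"
    by (intro mult_left_mono) (simp_all add: mult.assoc nn_integral_cmult)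
  also have "rho u * (ennreal (1 / t) * (\<integral>\<^sup>+ x. u x * v x \<partial>lebesgue)) = (\<integral>\<^sup>+ x. u x * v x \<partial>lebesgue)"
    unfolding t(1) mult.assoc[symmetric] using t(2) by (simp flip: ennreal_mult)
  finally show ?thesis .
qed

lemma AE_finite_if_rho_finite:
  assumes [measurable]: "u \<in> borel_measurable lebesgue" and fin: "rho u < \<infinity>"
  shows "AE x in lebesgue. u x < \<infinity>"
proof (rule AE_finite_if_locally_integrable)
  fix n
  obtain C where "(\<integral>\<^sup>+ x \<in> {-real n..real n}. u x \<partial>lebesgue) \<le> ennreal C * rho u"
    using rho_local_interval[of "real n"] assms(1) by blast
  also have "\<dots> < \<infinity>" using fin by (simp add: ennreal_mult_less_top)
  finally show "(\<integral>\<^sup>+ x \<in> {-real n..real n}. u x \<partial>lebesgue) < \<infinity>" .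
qed simp

lemma AE_finite_if_assoc_norm_finite:
  assumes [measurable]: "u \<in> borel_measurable lebesgue" and fin: "assoc_norm rho u < \<infinity>"
  shows "AE x in lebesgue. u x < \<infinity>"
proof (rule AE_finite_if_locally_integrable)
  fix n
  have ind: "rho (indicator {-real n..real n}) < \<infinity>"
    by (intro rho_indicator) (auto simp: emeasure_lborel_Icc_eq)
  have "(\<integral>\<^sup>+ x \<in> {-real n..real n}. u x \<partial>lebesgue) = (\<integral>\<^sup>+ x. indicator {-real n..real n} x * u x \<partial>lebesgue)"
    by (simp add: mult.commute)
  also have "\<dots> \<le> rho (indicator {-real n..real n}) * assoc_norm rho u"
    using ind by (intro Hoelder) auto
  also have "\<dots> < \<infinity>" using fin ind by (simp add: ennreal_mult_less_top)
  finally show "(\<integral>\<^sup>+ x \<in> {-real n..real n}. u x \<partial>lebesgue) < \<infinity>" .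
qed simp

end

text \<open>The infimum serves both directions: it dominates every average over an interval
  containing \<open>dyadic i\<close>, and it is dominated by the maximal function at every point of
  \<open>dyadic i\<close>.\<close>

definition min_max_op :: "(real \<Rightarrow> complex) \<Rightarrow> int \<times> int \<Rightarrow> ennreal" where
  "min_max_op f i = (INF x\<in>dyadic i. maximal_op f x)"

lemma average_le_min_max_op:
  assumes "a < b" "dyadic i \<subseteq> {a..b}"
  shows "(\<integral>\<^sup>+ y \<in> {a..b}. ennreal (cmod (f y)) \<partial>lebesgue) \<le> min_max_op f i * ennreal (b - a)"
proof -
  let ?I = "\<integral>\<^sup>+ y \<in> {a..b}. ennreal (cmod (f y)) \<partial>lebesgue"
  have "?I / ennreal (b - a) \<le> maximal_op f x" if "x \<in> dyadic i" for x
    unfolding maximal_op_def using assms that by (intro SUP_upper2[of "(a, b)"]) auto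
  then have "?I / ennreal (b - a) \<le> min_max_op f i" unfolding min_max_op_def by (rule INF_greatest)
  then have "?I / ennreal (b - a) * ennreal (b - a) \<le> min_max_op f i * ennreal (b - a)" by (rule mult_right_mono) simp
  also have "?I / ennreal (b - a) * ennreal (b - a) = ?I"
    using assms(1) by (simp add: ennreal_divide_times ennreal_divide_self)
  finally show ?thesis .
qed

lemma min_max_op_finite:
  assumes "AE x in lebesgue. maximal_op f x < \<infinity>"
  shows "min_max_op f i < \<infinity>"
proof -
  have "\<exists>x\<in>dyadic i. maximal_op f x < \<infinity>"
  proof (rule ccontr)
    assume "\<not> ?thesis"
    then have "AE x in lebesgue. x \<notin> dyadic i" using assms by (auto elim!: eventually_mono)
    then have "dyadic i \<in> null_sets lebesgue" by (subst AE_iff_null_sets) auto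
    then have "measure lebesgue (dyadic i) = 0" by (simp add: measure_def null_setsD1)
    then show False by (simp add: measure_dyadic)
  qed
  then show ?thesis unfolding min_max_op_def by (auto intro: INF_lower2 le_less_trans)
qed

text \<open>The integer p with 2^p \<le> y < 2^{p+1}. Meaningful only for 0 < y < \<infinity>, since
  \<open>enn2real\<close> sends \<infinity> to 0.\<close>

definition level :: "ennreal \<Rightarrow> int" where
  "level y = \<lfloor>log 2 (enn2real y)\<rfloor>"

lemma level_bounds:
  assumes "y \<noteq> 0" "y < \<infinity>"
  shows "ennreal (2 powr real_of_int (level y)) \<le> y" "y \<le> ennreal (2 * 2 powr real_of_int (level y))"
proof -
  define t where "t = enn2real y"
  have t: "y = ennreal t" "0 < t"
    using assms by (auto simp: t_def enn2real_positive_iff less_top zero_less_iff_neq_zero)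
  have "real_of_int (level y) \<le> log 2 t" "log 2 t \<le> real_of_int (level y) + 1"
    unfolding level_def t_def by linarith+
  then have "2 powr real_of_int (level y) \<le> 2 powr log 2 t" "2 powr log 2 t \<le> 2 powr (real_of_int (level y) + 1)"
    by (intro powr_mono; simp)+
  then have "2 powr real_of_int (level y) \<le> t" "t \<le> 2 * 2 powr real_of_int (level y)"
    using t(2) by (simp_all add: powr_add)
  then show "ennreal (2 powr real_of_int (level y)) \<le> y" "y \<le> ennreal (2 * 2 powr real_of_int (level y))"
    unfolding t(1) by (auto intro!: ennreal_leI)
qed

section \<open>The bilinear estimate and the uniform bound for partial sums\<close>

context bump_system
begin

definition coeff :: "(real \<Rightarrow> complex) \<Rightarrow> int \<times> int \<Rightarrow> complex" where
  "coeff f i = (LINT x|lebesgue. f x * cnj (e i x))"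

definition domination_const :: real where
  "domination_const = Bessel_const\<^sup>2 * (2 * (real N + 2))"

lemma domination_const_nonneg: "0 \<le> domination_const" by (simp add: domination_const_def)

lemma L2_set_coeff_level:
  assumes F: "finite F" and f: "f \<in> borel_measurable lebesgue" and int: "\<And>i. integrable lebesgue (\<lambda>x. f x * cnj (e i x))"
    and lev: "\<And>i. i \<in> F \<Longrightarrow> min_max_op f i \<le> ennreal (2 * 2 powr real_of_int p)"
  shows "L2_set (\<lambda>i. cmod (coeff f i)) F \<le> 2 * 2 powr real_of_int p * sqrt (domination_const * measure lebesgue (\<Union>i\<in>F. dyadic i))"
proof -
  have "(\<Sum>i\<in>F. (cmod (coeff f i))\<^sup>2) \<le> Bessel_const\<^sup>2 * (2 * 2 powr real_of_int p)\<^sup>2 * (2 * (real N + 2) * measure lebesgue (\<Union>i\<in>F. dyadic i))"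
    unfolding coeff_def
  proof (rule sum_coeff_square_le[OF F f int])
    fix i a b assume i: "i \<in> F" and ab: "(a::real) < b" "dyadic i \<subseteq> {a..b}"
    have "(\<integral>\<^sup>+ y \<in> {a..b}. ennreal (cmod (f y)) \<partial>lebesgue) \<le> min_max_op f i * ennreal (b - a)"
      by (rule average_le_min_max_op[OF ab])
    also have "\<dots> \<le> ennreal (2 * 2 powr real_of_int p) * ennreal (b - a)" by (intro mult_right_mono lev i) simp
    also have "\<dots> = ennreal (2 * 2 powr real_of_int p * (b - a))" using ab(1) by (simp add: ennreal_mult)
    finally show "(\<integral>\<^sup>+ y \<in> {a..b}. ennreal (cmod (f y)) \<partial>lebesgue) \<le> ennreal (2 * 2 powr real_of_int p * (b - a))" .
  qed simp
  also have "\<dots> = (2 * 2 powr real_of_int p)\<^sup>2 * (domination_const * measure lebesgue (\<Union>i\<in>F. dyadic i))"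
    by (simp add: domination_const_def)
  finally have "sqrt (\<Sum>i\<in>F. (cmod (coeff f i))\<^sup>2) \<le> sqrt ((2 * 2 powr real_of_int p)\<^sup>2 * (domination_const * measure lebesgue (\<Union>i\<in>F. dyadic i)))"
    by simp
  then show ?thesis unfolding L2_set_def by (simp add: real_sqrt_mult)
qed

text \<open>The local square-sum bound for the single index i with lam = 0. It disposes of the
  indices whose minimum has no level.\<close>

lemma coeff_eq_0_if_min_max_op_0:
  assumes f: "f \<in> borel_measurable lebesgue" and int: "\<And>i. integrable lebesgue (\<lambda>x. f x * cnj (e i x))"
    and 0: "min_max_op f i = 0"
  shows "coeff f i = 0"
proof -
  have "(\<Sum>j\<in>{i}. (cmod (coeff f j))\<^sup>2) \<le> Bessel_const\<^sup>2 * 0\<^sup>2 * (2 * (real N + 2) * measure lebesgue (\<Union>j\<in>{i}. dyadic j))"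
    unfolding coeff_def
  proof (rule sum_coeff_square_le[OF _ f int])
    fix j a b assume "j \<in> {i}" and ab: "(a::real) < b" "dyadic j \<subseteq> {a..b}"
    then show "(\<integral>\<^sup>+ y \<in> {a..b}. ennreal (cmod (f y)) \<partial>lebesgue) \<le> ennreal (0 * (b - a))"
      using average_le_min_max_op[OF ab, of f] 0 by simp
  qed auto
  then show ?thesis by simp
qed

text \<open>Sort the indices by the levels of the two maximal functions. The union of the intervals at the levels p and q
  lies in the set where the maximal functions are at least \<open>2\<^sup>p\<close> and \<open>2\<^sup>q\<close>, and the sums over p and q are geometric.\<close>
lemma sum_coeff_prod_le:
  assumes F: "finite F" and f: "f \<in> borel_measurable lebesgue" and g: "g \<in> borel_measurable lebesgue"
    and fint: "\<And>i. integrable lebesgue (\<lambda>x. f x * cnj (e i x))" and gint: "\<And>i. integrable lebesgue (\<lambda>x. g x * cnj (e i x))"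
    and [measurable]: "maximal_op f \<in> borel_measurable lebesgue" "maximal_op g \<in> borel_measurable lebesgue"
    and fin: "AE x in lebesgue. maximal_op f x < \<infinity>" "AE x in lebesgue. maximal_op g x < \<infinity>"
  shows "ennreal (\<Sum>i\<in>F. cmod (coeff f i) * cmod (coeff g i))
    \<le> ennreal (16 * domination_const) * (\<integral>\<^sup>+ x. maximal_op f x * maximal_op g x \<partial>lebesgue)"
proof -
  \<comment> \<open>Outside H one of the two coefficients is 0; inside, both minima are nonzero, and
    finite by the a.e. finiteness of the maximal functions, so their levels are meaningful.\<close>
  define H where "H = {i \<in> F. min_max_op f i \<noteq> 0 \<and> min_max_op g i \<noteq> 0}"
  define lev where "lev = (\<lambda>i. (level (min_max_op f i), level (min_max_op g i)))"
  define cls where "cls = (\<lambda>pq. {i \<in> H. lev i = pq})"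
  define U where "U = (\<lambda>pq. \<Union>i\<in>cls pq. dyadic i)"
  define w where "w = (\<lambda>p::int. 2 powr real_of_int p)"
  have w0: "0 \<le> w p" for p by (simp add: w_def)
  have finH: "finite H" and fincls: "finite (cls pq)" for pq using F by (auto simp: H_def cls_def)
  have U_lm: "U pq \<in> lmeasurable" for pq unfolding U_def using fincls by (intro fmeasurable.finite_UN) auto
  then have [measurable]: "U pq \<in> sets lebesgue" for pq by auto
  have "(\<Sum>i\<in>F. cmod (coeff f i) * cmod (coeff g i)) = (\<Sum>i\<in>H. cmod (coeff f i) * cmod (coeff g i))"
    using F coeff_eq_0_if_min_max_op_0[OF f fint] coeff_eq_0_if_min_max_op_0[OF g gint]
    by (intro sum.mono_neutral_right) (auto simp: H_def)
  also have "\<dots> = (\<Sum>pq\<in>lev ` H. \<Sum>i\<in>cls pq. cmod (coeff f i) * cmod (coeff g i))"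
    unfolding cls_def by (rule sum.image_gen[OF finH])
  also have "\<dots> \<le> (\<Sum>pq\<in>lev ` H. 4 * domination_const * (w (fst pq) * w (snd pq) * measure lebesgue (U pq)))"
  proof (rule sum_mono)
    fix pq assume "pq \<in> lev ` H"
    have lev_le: "min_max_op f i \<le> ennreal (2 * 2 powr real_of_int (fst pq))"
        "min_max_op g i \<le> ennreal (2 * 2 powr real_of_int (snd pq))" if "i \<in> cls pq" for i
      using that level_bounds(2)[OF _ min_max_op_finite[OF fin(1)], of i] level_bounds(2)[OF _ min_max_op_finite[OF fin(2)], of i]
      by (auto simp: cls_def H_def lev_def)
    have "(\<Sum>i\<in>cls pq. cmod (coeff f i) * cmod (coeff g i)) = (\<Sum>i\<in>cls pq. \<bar>cmod (coeff f i)\<bar> * \<bar>cmod (coeff g i)\<bar>)" by simp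
    also have "\<dots> \<le> L2_set (\<lambda>i. cmod (coeff f i)) (cls pq) * L2_set (\<lambda>i. cmod (coeff g i)) (cls pq)"
      by (rule L2_set_mult_ineq)
    \<comment> \<open>Both square sums are bounded by the measure of the same union
      \<open>U pq\<close>, so the two square roots multiply to that measure.\<close>
    also have "\<dots> \<le> (2 * 2 powr real_of_int (fst pq) * sqrt (domination_const * measure lebesgue (\<Union>i\<in>cls pq. dyadic i)))
       * (2 * 2 powr real_of_int (snd pq) * sqrt (domination_const * measure lebesgue (\<Union>i\<in>cls pq. dyadic i)))"
      by (intro mult_mono L2_set_coeff_level fincls f g fint gint lev_le L2_set_nonneg)
         (auto simp: domination_const_nonneg)
    also have "\<dots> = 4 * (w (fst pq) * w (snd pq)) * (sqrt (domination_const * measure lebesgue (U pq)))\<^sup>2"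
      by (simp add: w_def U_def power2_eq_square)
    also have "\<dots> = 4 * domination_const * (w (fst pq) * w (snd pq) * measure lebesgue (U pq))"
      using domination_const_nonneg by simp
    finally show "(\<Sum>i\<in>cls pq. cmod (coeff f i) * cmod (coeff g i)) \<le> 4 * domination_const * (w (fst pq) * w (snd pq) * measure lebesgue (U pq))" .
  qed
  also have "\<dots> = 4 * domination_const * (\<Sum>pq\<in>lev ` H. w (fst pq) * w (snd pq) * measure lebesgue (U pq))"
    by (simp add: sum_distrib_left)
  finally have "ennreal (\<Sum>i\<in>F. cmod (coeff f i) * cmod (coeff g i))
     \<le> ennreal (4 * domination_const * (\<Sum>pq\<in>lev ` H. w (fst pq) * w (snd pq) * measure lebesgue (U pq)))" by (rule ennreal_leI)
  also have "\<dots> = ennreal (4 * domination_const) * ennreal (\<Sum>pq\<in>lev ` H. w (fst pq) * w (snd pq) * measure lebesgue (U pq))"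
    using domination_const_nonneg w0 by (intro ennreal_mult sum_nonneg mult_nonneg_nonneg) auto
  also have "ennreal (\<Sum>pq\<in>lev ` H. w (fst pq) * w (snd pq) * measure lebesgue (U pq))
     = (\<Sum>pq\<in>lev ` H. ennreal (w (fst pq)) * ennreal (w (snd pq)) * emeasure lebesgue (U pq))"
    using w0 U_lm by (simp add: sum_ennreal[symmetric] ennreal_mult emeasure_eq_measure2)
  also have "\<dots> = (\<integral>\<^sup>+ x. (\<Sum>pq\<in>lev ` H. ennreal (w (fst pq)) * ennreal (w (snd pq)) * indicator (U pq) x) \<partial>lebesgue)"
    by (subst nn_integral_sum) (auto simp: nn_integral_cmult)
  also have "\<dots> \<le> (\<integral>\<^sup>+ x. 4 * (maximal_op f x * maximal_op g x) \<partial>lebesgue)"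
  proof (rule nn_integral_mono)
    fix x
    define u where "u = (\<lambda>y p. if ennreal (w p) \<le> y then ennreal (w p) else 0)"
    have "(\<Sum>pq\<in>lev ` H. ennreal (w (fst pq)) * ennreal (w (snd pq)) * indicator (U pq) x)
      \<le> (\<Sum>pq\<in>lev ` H. u (maximal_op f x) (fst pq) * u (maximal_op g x) (snd pq))"
    proof (rule sum_mono)
      fix pq assume "pq \<in> lev ` H"
      show "ennreal (w (fst pq)) * ennreal (w (snd pq)) * indicator (U pq) x \<le> u (maximal_op f x) (fst pq) * u (maximal_op g x) (snd pq)"
      proof (cases "x \<in> U pq")
        case True
        then obtain i where i: "i \<in> H" "lev i = pq" "x \<in> dyadic i" by (auto simp: U_def cls_def)
        have "ennreal (w (fst pq)) \<le> min_max_op f i" "ennreal (w (snd pq)) \<le> min_max_op g i"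
          using i level_bounds(1)[OF _ min_max_op_finite[OF fin(1)], of i] level_bounds(1)[OF _ min_max_op_finite[OF fin(2)], of i]
          by (auto simp: H_def lev_def w_def)
        moreover have "min_max_op f i \<le> maximal_op f x" "min_max_op g i \<le> maximal_op g x"
          unfolding min_max_op_def using i(3) by (auto intro: INF_lower)
        ultimately show ?thesis by (auto simp: u_def True intro: order_trans)
      qed simp
    qed
    \<comment> \<open>Enlarging the pairs of levels that occur to a full product makes the double
      sum factor into two geometric ones.\<close>
    also have "\<dots> \<le> (\<Sum>pq\<in>fst ` lev ` H \<times> snd ` lev ` H. u (maximal_op f x) (fst pq) * u (maximal_op g x) (snd pq))"
      using finH by (intro sum_mono2 subset_fst_snd) auto
    also have "\<dots> = (\<Sum>p\<in>fst ` lev ` H. u (maximal_op f x) p) * (\<Sum>q\<in>snd ` lev ` H. u (maximal_op g x) q)"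
      by (simp add: sum_product sum.cartesian_product case_prod_beta)
    also have "\<dots> \<le> (2 * maximal_op f x) * (2 * maximal_op g x)"
      unfolding u_def w_def using finH by (intro mult_mono sum_levels_le) auto
    also have "\<dots> = 4 * (maximal_op f x * maximal_op g x)"
      by (simp add: mult_ac)
    finally show "(\<Sum>pq\<in>lev ` H. ennreal (w (fst pq)) * ennreal (w (snd pq)) * indicator (U pq) x) \<le> \<dots>" .
  qed
  also have "\<dots> = 4 * (\<integral>\<^sup>+ x. maximal_op f x * maximal_op g x \<partial>lebesgue)"
    by (intro nn_integral_cmult) auto
  also have "ennreal (4 * domination_const) * (4 * (\<integral>\<^sup>+ x. maximal_op f x * maximal_op g x \<partial>lebesgue))
     = ennreal (16 * domination_const) * (\<integral>\<^sup>+ x. maximal_op f x * maximal_op g x \<partial>lebesgue)"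
  proof -
    have "ennreal (4 * domination_const) * 4 = ennreal (4 * domination_const * 4)"
      using domination_const_nonneg by (subst ennreal_mult) auto
    then show ?thesis by (simp add: mult_ac flip: mult.assoc)
  qed
  finally show ?thesis by (simp add: mult_left_mono)
qed

lemma partial_sum_bound:
  assumes bfn: "banach_function_norm rho" and M1: "maximal_bounded rho" and M2: "maximal_bounded (assoc_norm rho)"
  obtains C where "C \<ge> 0" "\<And>F f. finite F \<Longrightarrow> f \<in> BFS rho \<Longrightarrow>
    BFS_norm rho (\<lambda>x. \<Sum>i\<in>F. coeff f i * e i x) \<le> C * BFS_norm rho f"
proof -
  interpret banach_fun_norm rho by standard (rule bfn)
  obtain C1 where C1: "C1 \<ge> 0" "\<And>f. f \<in> BFS rho \<Longrightarrow> maximal_op f \<in> borel_measurable lebesgue"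
     "\<And>f. f \<in> BFS rho \<Longrightarrow> rho (maximal_op f) \<le> ennreal C1 * rho (\<lambda>x. ennreal (cmod (f x)))"
    using M1 unfolding maximal_bounded_def by blast
  obtain C2 where C2: "C2 \<ge> 0" "\<And>f. f \<in> BFS (assoc_norm rho) \<Longrightarrow> maximal_op f \<in> borel_measurable lebesgue"
     "\<And>f. f \<in> BFS (assoc_norm rho) \<Longrightarrow> assoc_norm rho (maximal_op f) \<le> ennreal C2 * assoc_norm rho (\<lambda>x. ennreal (cmod (f x)))"
    using M2 unfolding maximal_bounded_def by blast
  define C where "C = 16 * domination_const * C1 * C2"
  have C0: "0 \<le> C" using C1(1) C2(1) domination_const_nonneg by (simp add: C_def)
  show ?thesis
  proof (rule that[OF C0])
    fix F :: "(int \<times> int) set" and f assume F: "finite F" and f: "f \<in> BFS rho"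
    define v where "v = (\<lambda>x. \<Sum>i\<in>F. coeff f i * e i x)"
    have v: "v \<in> test_functions" unfolding v_def by (rule span_test[OF F])
    obtain K R where [measurable]: "v \<in> borel_measurable lebesgue" and KR: "K \<ge> 0" "R \<ge> 0" "\<And>x. cmod (v x) \<le> K"
      "\<And>x. \<bar>x\<bar> > R \<Longrightarrow> v x = 0" using test_functionsE[OF v] by metis
    have fint: "integrable lebesgue (\<lambda>x. f x * cnj (e i x))" for i
      using BFS_pairing[OF test_functions_cnj[OF test]] f by metis
    \<comment> \<open>The slack \<epsilon> makes the constant strictly positive, as
      \<open>rho_le_if_pairings_le\<close> requires, even if f has norm 0; it is removed at the
      end.\<close>
    have rho_le: "rho (\<lambda>x. ennreal (cmod (v x))) \<le> ennreal (C * BFS_norm rho f + \<epsilon>)" if eps: "\<epsilon> > 0" for \<epsilon>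
    proof (rule rho_le_if_pairings_le)
      show "0 < C * BFS_norm rho f + \<epsilon>" using C0 BFS_norm_nonneg[of f] eps by (intro add_nonneg_pos) auto
      show "cmod (v x) = 0" if "x \<notin> {-R..R}" for x using that KR(4)[of x] by auto
    next
      fix g :: "real \<Rightarrow> real" assume [measurable]: "g \<in> borel_measurable lebesgue" and g0: "\<And>x. 0 \<le> g x" and gv: "\<And>x. g x \<le> cmod (v x)"
      show "(\<integral>\<^sup>+ x. ennreal (cmod (v x)) * ennreal (g x) \<partial>lebesgue)
        \<le> ennreal (C * BFS_norm rho f + \<epsilon>) * assoc_norm rho (\<lambda>x. ennreal (g x))"
      proof (cases "assoc_norm rho (\<lambda>x. ennreal (g x)) < \<infinity>")
        case False
        then have "ennreal (C * BFS_norm rho f + \<epsilon>) * assoc_norm rho (\<lambda>x. ennreal (g x)) = \<infinity>"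
          using add_nonneg_pos[OF mult_nonneg_nonneg[OF C0 BFS_norm_nonneg[of f]] eps]
          by (auto simp: ennreal_mult_eq_top_iff less_top[symmetric] simp del: ennreal_plus)
        then show ?thesis by simp
      next
        case True
        \<comment> \<open>Attaching the phase of v makes v times the conjugate of G equal to |v| g,
          so the integral of |v| g expands into coefficients of f and G. The bound g \<le> |v| gives
          G the modulus g also where v = 0, and makes G a test function.\<close>
        define G where "G = (\<lambda>x. of_real (g x) * sgn (v x))"
        have G_meas [measurable]: "G \<in> borel_measurable lebesgue" unfolding G_def sgn_div_norm by measurable
        have cmodG: "cmod (G x) = g x" for x
          using g0[of x] gv[of x] by (cases "v x = 0") (auto simp: G_def norm_mult norm_sgn)
        have G: "G \<in> test_functions"
        proof (rule test_functionsI[OF G_meas])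
          show "cmod (G x) \<le> K" for x unfolding cmodG using gv KR(3) order_trans by blast
          show "G x = 0" if "\<bar>x\<bar> > R" for x using KR(4)[OF that] by (simp add: G_def)
        qed
        have GB: "G \<in> BFS (assoc_norm rho)" using True by (simp add: BFS_def cmodG)
        have Gint: "integrable lebesgue (\<lambda>x. G x * cnj (e i x))" for i
          by (rule test_mult_cnj_integrable[OF G test])
        have vG: "v x * cnj (G x) = of_real (cmod (v x) * g x)" for x
          using mult_cnj_sgn[of "v x"] by (simp add: G_def mult.left_commute)
        have vGint: "integrable lebesgue (\<lambda>x. v x * cnj (G x))"
          by (rule test_mult_cnj_integrable[OF v G])
        then have vgint: "integrable lebesgue (\<lambda>x. cmod (v x) * g x)"
          unfolding vG by (simp only: complex_of_real_integrable_eq)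
        have cnj_int: "integrable lebesgue (\<lambda>x. e i x * cnj (G x))" for i
          using integrable_cnj[OF Gint[of i]] by (simp add: mult.commute)
        have cnj_coeff: "(LINT x|lebesgue. e i x * cnj (G x)) = cnj (coeff G i)" for i
          unfolding coeff_def by (subst Bochner_Integration.integral_cnj[symmetric]) (simp add: mult.commute)
        have "complex_of_real (LINT x|lebesgue. cmod (v x) * g x) = (LINT x|lebesgue. v x * cnj (G x))"
          unfolding vG by (rule integral_complex_of_real[symmetric])
        also have "\<dots> = (LINT x|lebesgue. (\<Sum>i\<in>F. coeff f i * (e i x * cnj (G x))))"
          by (simp add: v_def sum_distrib_right mult.assoc)
        also have "\<dots> = (\<Sum>i\<in>F. coeff f i * (LINT x|lebesgue. e i x * cnj (G x)))"
          by (subst Bochner_Integration.integral_sum) (auto intro: cnj_int)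
        also have "\<dots> = (\<Sum>i\<in>F. coeff f i * cnj (coeff G i))"
          unfolding cnj_coeff ..
        finally have "cmod (complex_of_real (LINT x|lebesgue. cmod (v x) * g x)) \<le> (\<Sum>i\<in>F. cmod (coeff f i) * cmod (coeff G i))"
          by (simp only:) (rule order_trans[OF norm_sum], simp add: norm_mult)
        then have le: "(LINT x|lebesgue. cmod (v x) * g x) \<le> (\<Sum>i\<in>F. cmod (coeff f i) * cmod (coeff G i))" by simp
        have rMf: "rho (maximal_op f) \<le> ennreal (C1 * BFS_norm rho f)"
          using C1(3)[OF f] C1(1) by (simp add: ennreal_mult BFS_norm_nonneg ennreal_BFS_norm[OF f])
        have rMG: "assoc_norm rho (maximal_op G) \<le> ennreal C2 * assoc_norm rho (\<lambda>x. ennreal (g x))"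
          using C2(3)[OF GB] by (simp add: cmodG)
        have rMf_fin: "rho (maximal_op f) < \<infinity>" using rMf by (rule le_less_trans) simp
        have rMG_fin: "assoc_norm rho (maximal_op G) < \<infinity>" using rMG by (rule le_less_trans) (use True in \<open>simp add: ennreal_mult_less_top\<close>)
        have "(\<integral>\<^sup>+ x. ennreal (cmod (v x)) * ennreal (g x) \<partial>lebesgue) = ennreal (LINT x|lebesgue. cmod (v x) * g x)"
          using vgint g0 by (simp add: nn_integral_eq_integral flip: ennreal_mult)
        also have "\<dots> \<le> ennreal (\<Sum>i\<in>F. cmod (coeff f i) * cmod (coeff G i))" by (rule ennreal_leI[OF le])
        also have "\<dots> \<le> ennreal (16 * domination_const) * (\<integral>\<^sup>+ x. maximal_op f x * maximal_op G x \<partial>lebesgue)"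
          by (intro sum_coeff_prod_le F BFS_measurable[OF f] G_meas fint Gint C1(2)[OF f] C2(2)[OF GB]
              AE_finite_if_rho_finite AE_finite_if_assoc_norm_finite rMf_fin rMG_fin)
        also have "\<dots> \<le> ennreal (16 * domination_const) * (rho (maximal_op f) * assoc_norm rho (maximal_op G))"
          by (intro mult_left_mono Hoelder C1(2)[OF f] C2(2)[OF GB] rMf_fin) simp
        also have "\<dots> \<le> ennreal (16 * domination_const) * (ennreal (C1 * BFS_norm rho f) * (ennreal C2 * assoc_norm rho (\<lambda>x. ennreal (g x))))"
          by (intro mult_left_mono mult_mono rMf rMG) auto
        also have "\<dots> = ennreal (C * BFS_norm rho f) * assoc_norm rho (\<lambda>x. ennreal (g x))"
        proof -
          have "ennreal (C * BFS_norm rho f) = ennreal (16 * domination_const) * ennreal (C1 * BFS_norm rho f) * ennreal C2"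
            using C1(1) C2(1) domination_const_nonneg BFS_norm_nonneg[of f] by (simp add: C_def mult_ac flip: ennreal_mult)
          then show ?thesis by (simp add: mult.assoc)
        qed
        also have "\<dots> \<le> ennreal (C * BFS_norm rho f + \<epsilon>) * assoc_norm rho (\<lambda>x. ennreal (g x))"
          using eps by (intro mult_right_mono ennreal_leI) auto
        finally show ?thesis .
      qed
    qed (use KR in auto)
    have "BFS_norm rho v \<le> C * BFS_norm rho f + \<epsilon>" if "\<epsilon> > 0" for \<epsilon>
    proof -
      have "0 \<le> C * BFS_norm rho f + \<epsilon>" using C0 BFS_norm_nonneg[of f] that by simp
      then show ?thesis
        using rho_le[OF that] unfolding ennreal_BFS_norm[OF test_functions_BFS[OF v], symmetric] by (simp del: ennreal_plus)
    qed
    then show "BFS_norm rho (\<lambda>x. \<Sum>i\<in>F. coeff f i * e i x) \<le> C * BFS_norm rho f"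
      unfolding v_def by (rule field_le_epsilon)
  qed
qed

end

section \<open>Convergence of wavelet expansions\<close>

text \<open>The derivative is bounded on [-N, N] by compactness. Clamping to that interval does not
  increase distances and leaves \<psi> unchanged, since \<psi> vanishes at the endpoints and
  beyond.\<close>

lemma Lipschitz_if_C1_compact_support:
  fixes \<psi> :: "real \<Rightarrow> complex"
  assumes C1: "\<psi> C1_differentiable_on UNIV" and supp: "\<And>x. \<bar>x\<bar> \<ge> real N \<Longrightarrow> \<psi> x = 0"
  obtains L where "\<And>x y. cmod (\<psi> x - \<psi> y) \<le> L * \<bar>x - y\<bar>"
proof -
  obtain D where D: "\<And>x. (\<psi> has_vector_derivative D x) (at x)" "continuous_on UNIV D"
    using C1 unfolding C1_differentiable_on_def by auto
  have "compact (D ` {-real N..real N})"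
    using D(2) by (intro compact_continuous_image) (auto intro: continuous_on_subset)
  then have "bounded (D ` {-real N..real N})" by (rule compact_imp_bounded)
  then obtain L where "\<forall>z \<in> D ` {-real N..real N}. norm z \<le> L" unfolding bounded_iff by blast
  then have L: "norm (D x) \<le> L" if "x \<in> {-real N..real N}" for x using that by blast
  define c where "c = (\<lambda>x::real. max (- real N) (min (real N) x))"
  have cN: "c x \<in> {-real N..real N}" for x by (auto simp: c_def)
  have \<psi>c: "\<psi> x = \<psi> (c x)" for x
  proof (cases "\<bar>x\<bar> \<ge> real N")
    case True
    then have "\<bar>c x\<bar> \<ge> real N" by (auto simp: c_def)
    then show ?thesis using True by (simp add: supp)
  next
    case False
    then show ?thesis by (simp add: c_def)
  qed
  have "cmod (\<psi> x - \<psi> y) \<le> L * \<bar>x - y\<bar>" for x y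
  proof -
    have "norm (\<psi> (c x) - \<psi> (c y)) \<le> L * norm (c x - c y)"
    proof (rule differentiable_bound[where S = "{-real N..real N}" and f' = "\<lambda>x h. h *\<^sub>R D x"])
      show "(\<psi> has_derivative (\<lambda>h. h *\<^sub>R D z)) (at z within {-real N..real N})" for z
        using D(1)[of z] unfolding has_vector_derivative_def by (rule has_derivative_at_withinI)
      show "onorm (\<lambda>h. h *\<^sub>R D z) \<le> L" if "z \<in> {-real N..real N}" for z
        using L[OF that] by (intro onorm_le) (auto simp: mult.commute[of L] intro: mult_left_mono)
    qed (use cN in auto)
    also have "norm (c x - c y) \<le> \<bar>x - y\<bar>" by (auto simp: c_def)
    finally show ?thesis using \<psi>c[of x] \<psi>c[of y] order_trans[OF norm_ge_zero L[of 0]] by (simp add: mult_left_mono)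
  qed
  then show ?thesis by (rule that)
qed

lemma wavelet_fam_eq: "wavelet_fam \<psi> i x = of_real (1 / sqrt (len i)) * \<psi> (x / len i - of_int (snd i))"
proof -
  have "2 powr real_of_int (fst i) = 1 / len i" by (simp add: inverse_len)
  moreover have "2 powr (real_of_int (fst i) / 2) = 1 / sqrt (len i)"
  proof -
    have "sqrt (len i) = 2 powr (- (real_of_int (fst i) / 2))"
      unfolding len_def by (subst powr_half_sqrt[symmetric]) (auto simp: powr_powr)
    then show ?thesis by (simp add: powr_minus_divide)
  qed
  ultimately show ?thesis by (simp add: wavelet_fam_def)
qed

lemma wavelet_bump_system:
  assumes orth: "orthonormal_wavelet \<psi>" and C1: "\<psi> C1_differentiable_on UNIV"
    and comp: "compact (closure {x. \<psi> x \<noteq> 0})"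
  obtains N L where "bump_system (wavelet_fam \<psi>) N L"
proof -
  have "bounded {x. \<psi> x \<noteq> 0}" using comp compact_imp_bounded bounded_subset closure_subset by metis
  then obtain R where R: "\<And>x. \<psi> x \<noteq> 0 \<Longrightarrow> \<bar>x\<bar> \<le> R" unfolding bounded_iff by auto
  \<comment> \<open>Strictly beyond R, so that \<psi> vanishes at the endpoints -N and N too, as the
    clamping argument needs.\<close>
  obtain N :: nat where "R < real N" using reals_Archimedean2 by blast
  then have N: "\<psi> x = 0" if "\<bar>x\<bar> \<ge> real N" for x using R[of x] that by linarith
  obtain L where L: "\<And>x y. cmod (\<psi> x - \<psi> y) \<le> L * \<bar>x - y\<bar>" using Lipschitz_if_C1_compact_support[OF C1 N] by blast
  have L0: "0 \<le> L" using order_trans[OF norm_ge_zero L[of 0 1]] by simp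
  have cont: "continuous_on UNIV \<psi>" using C1 by (rule C1_differentiable_imp_continuous_on)
  have supp: "wavelet_fam \<psi> i x = 0" if "x \<notin> dilate N i" for i x
  proof -
    have "x / len i - of_int (snd i) = (x - of_int (snd i) * len i) / len i" by (simp add: diff_divide_distrib)
    moreover have "real N * len i < \<bar>x - of_int (snd i) * len i\<bar>" using that by (simp add: mem_dilate_iff)
    ultimately have "real N \<le> \<bar>x / len i - of_int (snd i)\<bar>" by (simp add: pos_le_divide_eq)
    then show ?thesis by (simp add: wavelet_fam_eq N)
  qed
  have lip: "cmod (wavelet_fam \<psi> i x - wavelet_fam \<psi> i y) \<le> L * \<bar>x - y\<bar> / (len i * sqrt (len i))" for i x y
  proof -
    have "cmod (wavelet_fam \<psi> i x - wavelet_fam \<psi> i y)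
      = 1 / sqrt (len i) * cmod (\<psi> (x / len i - of_int (snd i)) - \<psi> (y / len i - of_int (snd i)))"
      unfolding wavelet_fam_eq right_diff_distrib[symmetric] norm_mult by (simp add: norm_divide)
    also have "\<dots> \<le> 1 / sqrt (len i) * (L * \<bar>(x / len i - of_int (snd i)) - (y / len i - of_int (snd i))\<bar>)"
      by (intro mult_left_mono L) simp
    also have "\<dots> = L * \<bar>x - y\<bar> / (len i * sqrt (len i))"
      by (simp add: diff_divide_distrib[symmetric] abs_divide)
    finally show ?thesis .
  qed
  have test: "wavelet_fam \<psi> i \<in> test_functions" for i
  proof -
    have c: "continuous_on UNIV (wavelet_fam \<psi> i)"
      unfolding wavelet_fam_eq by (intro continuous_intros continuous_on_compose2[OF cont]) auto
    then have meas: "wavelet_fam \<psi> i \<in> borel_measurable lebesgue"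
      by (intro borel_measurable_if_D measurable_completion) (auto intro: borel_measurable_continuous_onI)
    have "bounded (wavelet_fam \<psi> i ` dilate N i)"
      unfolding dilate_def by (intro compact_imp_bounded compact_continuous_image continuous_on_subset[OF c]) auto
    then obtain K where K: "\<And>x. x \<in> dilate N i \<Longrightarrow> cmod (wavelet_fam \<psi> i x) \<le> K" "K > 0" unfolding bounded_pos by auto
    have "bounded (dilate N i)" by (simp add: dilate_def)
    then obtain S where S: "\<And>x. x \<in> dilate N i \<Longrightarrow> \<bar>x\<bar> \<le> S" unfolding bounded_real by blast
    show ?thesis
    proof (rule test_functionsI[OF meas])
      show "cmod (wavelet_fam \<psi> i x) \<le> K" for x using K supp[of x i] by (cases "x \<in> dilate N i") auto
      show "wavelet_fam \<psi> i x = 0" if "\<bar>x\<bar> > S" for x using S[of x] supp[of x i] that by fastforce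
    qed
  qed
  have "(LINT x|lebesgue. wavelet_fam \<psi> i x * cnj (wavelet_fam \<psi> i' x)) = (if i = i' then 1 else 0)" for i i'
    using orth unfolding orthonormal_wavelet_def L2_inner_def by blast
  then have "bump_system (wavelet_fam \<psi>) N L" by (intro bump_system.intro test supp lip)
  then show ?thesis by (rule that)
qed

section \<open>Coefficients and L2 approximation by partial sums\<close>

context bump_system
begin

lemma coeff_e: "coeff (e i) j = (if i = j then 1 else 0)"
  unfolding coeff_def by (rule orth)

lemma coeff_add:
  assumes "\<And>i. integrable lebesgue (\<lambda>x. f x * cnj (e i x))" "\<And>i. integrable lebesgue (\<lambda>x. g x * cnj (e i x))"
  shows "coeff (\<lambda>x. f x + g x) i = coeff f i + coeff g i"
  unfolding coeff_def distrib_right using assms by simp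

lemma coeff_scale: "coeff (\<lambda>x. c * f x) i = c * coeff f i"
  unfolding coeff_def mult.assoc by simp

lemma coeff_span:
  assumes "finite F" shows "coeff (\<lambda>x. \<Sum>i\<in>F. c i * e i x) j = (if j \<in> F then c j else 0)"
proof -
  have "coeff (\<lambda>x. \<Sum>i\<in>F. c i * e i x) j = (\<Sum>i\<in>F. c i * (if i = j then 1 else 0))"
    unfolding coeff_def sum_distrib_right mult.assoc
    by (subst Bochner_Integration.integral_sum) (auto intro: e_mult_integrable simp: orth)
  then show ?thesis using assms by (simp add: sum.delta if_distrib cong: if_cong)
qed

lemma coeff_diff_span:
  assumes int: "\<And>i. integrable lebesgue (\<lambda>x. f x * cnj (e i x))" and F: "finite F"
  shows "coeff (\<lambda>x. f x - (\<Sum>i\<in>F. c i * e i x)) j = coeff f j - (if j \<in> F then c j else 0)"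
proof -
  have "coeff (\<lambda>x. f x - (\<Sum>i\<in>F. c i * e i x)) j = coeff f j - coeff (\<lambda>x. \<Sum>i\<in>F. c i * e i x) j"
    unfolding coeff_def left_diff_distrib
    using int test_mult_cnj_integrable[OF span_test[OF F] test] by simp
  then show ?thesis by (simp add: coeff_span[OF F])
qed

text \<open>Expansion of the square with the coefficient terms completed to squares; it shows that
  over a fixed index set the choice d = coeff f is closest to f.\<close>

lemma dist_span_square:
  fixes d :: "int \<times> int \<Rightarrow> complex"
  assumes f: "f \<in> test_functions" and F: "finite F"
  shows "(LINT x|lebesgue. (cmod (f x - (\<Sum>i\<in>F. d i * e i x)))\<^sup>2)
    = (LINT x|lebesgue. (cmod (f x))\<^sup>2) + (\<Sum>i\<in>F. (cmod (coeff f i - d i))\<^sup>2 - (cmod (coeff f i))\<^sup>2)"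
proof -
  define u where "u = (\<lambda>x. \<Sum>i\<in>F. d i * e i x)"
  have u: "u \<in> test_functions" unfolding u_def by (rule span_test[OF F])
  have fu: "(LINT x|lebesgue. f x * cnj (u x)) = (\<Sum>i\<in>F. cnj (d i) * coeff f i)"
  proof -
    have "(LINT x|lebesgue. f x * cnj (u x)) = (LINT x|lebesgue. (\<Sum>i\<in>F. cnj (d i) * (f x * cnj (e i x))))"
      by (simp add: u_def cnj_sum sum_distrib_left mult_ac)
    then show ?thesis unfolding coeff_def
      by (simp add: Bochner_Integration.integral_sum test_mult_cnj_integrable[OF f test])
  qed
  have uf: "(LINT x|lebesgue. u x * cnj (f x)) = cnj (\<Sum>i\<in>F. cnj (d i) * coeff f i)"
    unfolding fu[symmetric] by (subst Bochner_Integration.integral_cnj[symmetric]) (simp add: mult.commute)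
  have "complex_of_real (LINT x|lebesgue. (cmod (f x - u x))\<^sup>2) = (LINT x|lebesgue. (f x - u x) * cnj (f x - u x))"
    unfolding complex_norm_square[symmetric] by (rule integral_complex_of_real[symmetric])
  also have "\<dots> = (LINT x|lebesgue. (f x * cnj (f x) - f x * cnj (u x)) - (u x * cnj (f x) - u x * cnj (u x)))"
    by (simp add: algebra_simps)
  also have "\<dots> = (LINT x|lebesgue. f x * cnj (f x)) - (LINT x|lebesgue. f x * cnj (u x))
     - ((LINT x|lebesgue. u x * cnj (f x)) - (LINT x|lebesgue. u x * cnj (u x)))"
    using f u by (simp add: test_mult_cnj_integrable)
  also have "(LINT x|lebesgue. f x * cnj (f x)) = complex_of_real (LINT x|lebesgue. (cmod (f x))\<^sup>2)"
    unfolding complex_norm_square[symmetric] by (rule integral_complex_of_real)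
  also have "(LINT x|lebesgue. u x * cnj (u x)) = complex_of_real (LINT x|lebesgue. (cmod (u x))\<^sup>2)"
    unfolding complex_norm_square[symmetric] by (rule integral_complex_of_real)
  also have "(LINT x|lebesgue. (cmod (u x))\<^sup>2) = (\<Sum>i\<in>F. (cmod (d i))\<^sup>2)"
    unfolding u_def by (rule integral_span_square(2)[OF F])
  finally have "complex_of_real (LINT x|lebesgue. (cmod (f x - u x))\<^sup>2) =
     complex_of_real (LINT x|lebesgue. (cmod (f x))\<^sup>2) + (\<Sum>i\<in>F. d i * cnj (d i) - cnj (d i) * coeff f i - d i * cnj (coeff f i))"
    unfolding fu uf of_real_sum complex_norm_square by (simp add: cnj_sum sum_subtractf)
  also have "(\<Sum>i\<in>F. d i * cnj (d i) - cnj (d i) * coeff f i - d i * cnj (coeff f i))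
     = complex_of_real (\<Sum>i\<in>F. (cmod (coeff f i - d i))\<^sup>2 - (cmod (coeff f i))\<^sup>2)"
    unfolding of_real_sum of_real_diff complex_norm_square by (simp add: algebra_simps)
  finally show ?thesis unfolding u_def of_real_add[symmetric] of_real_eq_iff .
qed

text \<open>Completeness supplies some combination over a finite set F near f. Once the enumeration
  has passed all of F, the partial sum is the best approximation over a larger index set and hence
  at least as near.\<close>

lemma partial_sums_L2:
  assumes complete: "\<And>f \<epsilon>. f \<in> L2_space \<Longrightarrow> \<epsilon> > 0 \<Longrightarrow> \<exists>F c. finite F \<and> L2_norm (\<lambda>x. f x - (\<Sum>i\<in>F. c i * e i x)) < \<epsilon>"
    and f: "f \<in> test_functions" and \<sigma>: "bij \<sigma>"
  shows "(\<lambda>n. LINT x|lebesgue. (cmod (f x - (\<Sum>i\<in>\<sigma> ` {..<n::nat}. coeff f i * e i x)))\<^sup>2) \<longlonglongrightarrow> 0"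
proof (rule LIMSEQ_I)
  fix r :: real assume r: "0 < r"
  have "f \<in> L2_space" using f test_square_integrable test_functions_measurable by (simp add: L2_space_def)
  then obtain F c where F: "finite F" "L2_norm (\<lambda>x. f x - (\<Sum>i\<in>F. c i * e i x)) < sqrt r"
    using complete[of f "sqrt r"] r by auto
  then have less: "(LINT x|lebesgue. (cmod (f x - (\<Sum>i\<in>F. c i * e i x)))\<^sup>2) < r" by (simp add: L2_norm_def)
  have "finite (inv \<sigma> ` F)" using F(1) by simp
  then obtain n0 where n0: "inv \<sigma> ` F \<subseteq> {..<n0}" using finite_nat_iff_bounded by blast
  show "\<exists>no. \<forall>n\<ge>no. norm ((LINT x|lebesgue. (cmod (f x - (\<Sum>i\<in>\<sigma> ` {..<n::nat}. coeff f i * e i x)))\<^sup>2) - 0) < r"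
  proof (intro exI allI impI)
    fix n assume n: "n0 \<le> n"
    have sub: "F \<subseteq> \<sigma> ` {..<n}"
    proof
      fix i assume "i \<in> F"
      then have "inv \<sigma> i < n" using n0 n by auto
      moreover have "i = \<sigma> (inv \<sigma> i)" using \<sigma> by (simp add: bij_is_surj surj_f_inv_f)
      ultimately show "i \<in> \<sigma> ` {..<n}" by blast
    qed
    have sum_eq: "(\<Sum>i\<in>\<sigma> ` {..<n}. (if i \<in> F then c i else 0) * e i x) = (\<Sum>i\<in>F. c i * e i x)" for x
      using sub by (intro sum.mono_neutral_cong_right) auto
    have "(LINT x|lebesgue. (cmod (f x - (\<Sum>i\<in>\<sigma> ` {..<n}. coeff f i * e i x)))\<^sup>2)
       \<le> (LINT x|lebesgue. (cmod (f x - (\<Sum>i\<in>\<sigma> ` {..<n}. (if i \<in> F then c i else 0) * e i x)))\<^sup>2)"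
      unfolding dist_span_square[OF f finite_imageI[OF finite_lessThan]] by (intro add_left_mono sum_mono) auto
    also have "\<dots> = (LINT x|lebesgue. (cmod (f x - (\<Sum>i\<in>F. c i * e i x)))\<^sup>2)" unfolding sum_eq ..
    also note less
    finally show "norm ((LINT x|lebesgue. (cmod (f x - (\<Sum>i\<in>\<sigma> ` {..<n::nat}. coeff f i * e i x)))\<^sup>2) - 0) < r" by simp
  qed
qed

end

text \<open>Young's inequality with a parameter \<delta> takes the place of Cauchy-Schwarz for
  integrals.\<close>

lemma pairing_tendsto_0_if_L2:
  assumes w: "\<And>n. w n \<in> test_functions" and g: "g \<in> test_functions"
    and lim: "(\<lambda>n. LINT x|lebesgue. (cmod (w n x))\<^sup>2) \<longlonglongrightarrow> 0"
  shows "(\<lambda>n. LINT x|lebesgue. w n x * g x) \<longlonglongrightarrow> 0"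
proof (rule LIMSEQ_I)
  note sq = test_square_integrable and wg = test_mult_integrable[OF w g]
  fix r :: real assume r: "0 < r"
  define G where "G = (LINT x|lebesgue. (cmod (g x))\<^sup>2)"
  have G0: "0 \<le> G" by (simp add: G_def)
  \<comment> \<open>Chosen so that \<delta> G \<le> r: the term of g is at most r / 2, and the other
    is below r / 2 once the squared norm of \<open>w n\<close> is below r \<delta>. The + 1 covers G
    = 0.\<close>
  define \<delta> where "\<delta> = r / (G + 1)"
  have \<delta>: "0 < \<delta>" using r G0 by (simp add: \<delta>_def)
  have bound: "cmod (LINT x|lebesgue. w n x * g x) \<le> (LINT x|lebesgue. (cmod (w n x))\<^sup>2) / (2 * \<delta>) + \<delta> / 2 * G" for n
  proof -
    have "cmod (LINT x|lebesgue. w n x * g x) \<le> (LINT x|lebesgue. cmod (w n x * g x))" by (rule integral_norm_bound)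
    also have "\<dots> \<le> (LINT x|lebesgue. (cmod (w n x))\<^sup>2 / (2 * \<delta>) + \<delta> / 2 * (cmod (g x))\<^sup>2)"
    proof (intro integral_mono integrable_norm wg Bochner_Integration.integrable_add integrable_mult_right integrable_divide sq w g)
      fix x
      have "0 \<le> (cmod (w n x) - \<delta> * cmod (g x))\<^sup>2 / (2 * \<delta>)" using \<delta> by simp
      also have "\<dots> = (cmod (w n x))\<^sup>2 / (2 * \<delta>) + \<delta> / 2 * (cmod (g x))\<^sup>2 - cmod (w n x) * cmod (g x)"
        using \<delta> by (simp add: power2_eq_square field_simps)
      finally show "cmod (w n x * g x) \<le> (cmod (w n x))\<^sup>2 / (2 * \<delta>) + \<delta> / 2 * (cmod (g x))\<^sup>2" by (simp add: norm_mult)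
    qed
    also have "\<dots> = (LINT x|lebesgue. (cmod (w n x))\<^sup>2) / (2 * \<delta>) + \<delta> / 2 * G"
      unfolding G_def using sq[OF w] sq[OF g] by simp
    finally show ?thesis .
  qed
  have dG: "\<delta> * G \<le> r" using r G0 by (simp add: \<delta>_def field_simps)
  have "0 < r * \<delta>" using r \<delta> by simp
  then obtain no where no: "\<And>n. n \<ge> no \<Longrightarrow> norm ((LINT x|lebesgue. (cmod (w n x))\<^sup>2) - 0) < r * \<delta>"
    using LIMSEQ_D[OF lim] by blast
  show "\<exists>no. \<forall>n\<ge>no. norm ((LINT x|lebesgue. w n x * g x) - 0) < r"
  proof (intro exI[of _ no] allI impI)
    fix n assume "no \<le> n"
    then have "(LINT x|lebesgue. (cmod (w n x))\<^sup>2) < r * \<delta>" using no[of n] by simp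
    then have "(LINT x|lebesgue. (cmod (w n x))\<^sup>2) / (2 * \<delta>) < r / 2" using \<delta> by (simp add: field_simps)
    then show "norm ((LINT x|lebesgue. w n x * g x) - 0) < r" using bound[of n] dG by simp
  qed
qed

definition truncation :: "nat \<Rightarrow> (real \<Rightarrow> complex) \<Rightarrow> real \<Rightarrow> complex" where
  "truncation k f x = (if x \<in> {-real k..real k} \<and> cmod (f x) \<le> real k then f x else 0)"

lemma truncation_test_function:
  assumes [measurable]: "f \<in> borel_measurable lebesgue"
  shows "truncation k f \<in> test_functions"
proof (rule test_functionsI[of _ "real k" "real k"])
  show "truncation k f \<in> borel_measurable lebesgue" unfolding truncation_def[abs_def] by measurable
qed (auto simp: truncation_def)

text \<open>Dominated convergence: at each point the difference is eventually 0, and its modulus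
  never exceeds that of f.\<close>

lemma (in banach_fun_norm) truncation_pairing:
  assumes f: "f \<in> BFS rho" and G: "G \<in> test_functions"
  shows "(\<lambda>k. LINT x|lebesgue. (f x - truncation k f x) * G x) \<longlonglongrightarrow> 0"
proof -
  note [measurable] = BFS_measurable[OF f] test_functions_measurable[OF G]
    test_functions_measurable[OF truncation_test_function]
  have int: "integrable lebesgue (\<lambda>x. f x * G x)" using BFS_pairing[OF G] f by metis
  have "(\<lambda>k. LINT x|lebesgue. (f x - truncation k f x) * G x) \<longlonglongrightarrow> (LINT x::real|lebesgue. 0 :: complex)"
  proof (rule integral_dominated_convergence[where f = "\<lambda>x. 0"])
    show "integrable lebesgue (\<lambda>x. cmod (f x * G x))" using int by (rule integrable_norm)
    show "AE x in lebesgue. (\<lambda>k. (f x - truncation k f x) * G x) \<longlonglongrightarrow> 0"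
    proof (rule AE_I2)
      fix x
      obtain n where n: "max \<bar>x\<bar> (cmod (f x)) \<le> real n" using real_arch_simple by blast
      have "\<forall>\<^sub>F k in sequentially. (f x - truncation k f x) * G x = 0"
        using eventually_ge_at_top[of n] by eventually_elim (use n in \<open>auto simp: truncation_def\<close>)
      then show "(\<lambda>k. (f x - truncation k f x) * G x) \<longlonglongrightarrow> 0" by (rule tendsto_eventually)
    qed
    show "AE x in lebesgue. cmod ((f x - truncation k f x) * G x) \<le> cmod (f x * G x)" for k
      by (auto simp: truncation_def norm_mult)
  qed auto
  then show ?thesis by simp
qed

section \<open>Convergence in X and uniqueness of the coefficients\<close>

context bump_system
begin

text \<open>The uniform bound keeps the remainder seminorms \<open>p n\<close> below a multiple of
  the norm. Reflexivity is used twice, each time through a bounded sequence that is null against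
  test functions: the remainders of a test function, and f minus its truncations.\<close>

lemma partial_sums_tendsto:
  assumes bfn: "banach_function_norm rho" and refl: "reflexive_BFS rho"
    and M: "maximal_bounded rho" "maximal_bounded (assoc_norm rho)"
    and complete: "\<And>f \<epsilon>. f \<in> L2_space \<Longrightarrow> \<epsilon> > 0 \<Longrightarrow> \<exists>F c. finite F \<and> L2_norm (\<lambda>x. f x - (\<Sum>i\<in>F. c i * e i x)) < \<epsilon>"
    and f: "f \<in> BFS rho" and \<sigma>: "bij \<sigma>"
  shows "(\<lambda>n. BFS_norm rho (\<lambda>x. f x - (\<Sum>i\<in>\<sigma> ` {..<n::nat}. coeff f i * e i x))) \<longlonglongrightarrow> 0"
proof (rule ccontr)
  interpret banach_fun_norm rho by standard (rule bfn)
  obtain C where C: "C \<ge> 0" "\<And>F f. finite F \<Longrightarrow> f \<in> BFS rho \<Longrightarrow>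
    BFS_norm rho (\<lambda>x. \<Sum>i\<in>F. coeff f i * e i x) \<le> C * BFS_norm rho f"
    using partial_sum_bound[OF bfn M] by metis
  define S where "S = (\<lambda>n u x. \<Sum>i\<in>\<sigma> ` {..<n}. coeff u i * e i x)"
  define p where "p = (\<lambda>n u. BFS_norm rho (\<lambda>x. u x - S n u x))"
  have int: "integrable lebesgue (\<lambda>x. u x * cnj (e i x))" if "u \<in> BFS rho" for u i
    using BFS_pairing[OF test_functions_cnj[OF test]] that by metis
  have e_BFS: "e i \<in> BFS rho" for i by (rule test_functions_BFS[OF test])
  have S_test: "S n u \<in> test_functions" for n u unfolding S_def by (intro span_test) simp
  have diff_BFS: "(\<lambda>x. u x - S n u x) \<in> BFS rho" if "u \<in> BFS rho" for u n
    by (rule fun_subspace_diff[OF BFS_subspace that test_functions_BFS[OF S_test]])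
  have S_add: "S n (\<lambda>x. u x + v x) x = S n u x + S n v x" if "u \<in> BFS rho" "v \<in> BFS rho" for n u v x
    unfolding S_def using coeff_add[OF int[OF that(1)] int[OF that(2)]] by (simp add: distrib_right sum.distrib)
  have S_scale: "S n (\<lambda>x. c * u x) x = c * S n u x" for n c u x
    unfolding S_def by (simp add: coeff_scale sum_distrib_left mult.assoc)
  have p_add: "p n (\<lambda>x. u x + v x) \<le> p n u + p n v" if "u \<in> BFS rho" "v \<in> BFS rho" for n u v
  proof -
    have "(\<lambda>x. u x + v x - S n (\<lambda>x. u x + v x) x) = (\<lambda>x. (u x - S n u x) + (v x - S n v x))"
      by (simp add: S_add[OF that] algebra_simps)
    then show ?thesis unfolding p_def using BFS_norm_add[OF diff_BFS[OF that(1)] diff_BFS[OF that(2)]] by simp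
  qed
  have p_scale: "p n (\<lambda>x. c * u x) = cmod c * p n u" if "u \<in> BFS rho" for n c u
  proof -
    have "(\<lambda>x. c * u x - S n (\<lambda>x. c * u x) x) = (\<lambda>x. c * (u x - S n u x))"
      by (simp add: S_scale right_diff_distrib)
    then show ?thesis unfolding p_def using BFS_norm_scale[OF diff_BFS[OF that]] by simp
  qed
  have p_le: "p n u \<le> (1 + C) * BFS_norm rho u" if u: "u \<in> BFS rho" for n u
  proof -
    have neg: "(\<lambda>x. (-1) * S n u x) \<in> BFS rho"
      by (rule fun_subspaceD(2)[OF BFS_subspace test_functions_BFS[OF S_test]])
    have "p n u \<le> BFS_norm rho u + BFS_norm rho (\<lambda>x. (-1) * S n u x)"
      using BFS_norm_add[OF u neg] by (simp add: p_def)
    also have "BFS_norm rho (\<lambda>x. (-1) * S n u x) = BFS_norm rho (S n u)"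
      by (subst BFS_norm_scale[OF test_functions_BFS[OF S_test]]) simp
    also have "\<dots> \<le> C * BFS_norm rho u" unfolding S_def by (intro C(2) u) simp
    finally show ?thesis by (simp add: distrib_right)
  qed
  have p_nonneg: "0 \<le> p n u" for n u unfolding p_def by (rule BFS_norm_nonneg)
  assume "\<not> ?thesis"
  then have not0: "\<not> (\<lambda>n. p n f) \<longlonglongrightarrow> 0" by (simp add: p_def S_def)
  obtain \<phi> where \<phi>: "\<And>u v. u \<in> BFS rho \<Longrightarrow> v \<in> BFS rho \<Longrightarrow> \<phi> (\<lambda>x. u x + v x) = \<phi> u + \<phi> v"
    "\<And>c u. u \<in> BFS rho \<Longrightarrow> \<phi> (\<lambda>x. c * u x) = c * \<phi> u"
    "\<And>u. u \<in> BFS rho \<Longrightarrow> cmod (\<phi> u) \<le> (1 + C) * BFS_norm rho u" "\<phi> f \<noteq> 0"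
    "\<And>u. u \<in> BFS rho \<Longrightarrow> (\<lambda>n. p n u) \<longlonglongrightarrow> 0 \<Longrightarrow> \<phi> u = 0"
    using Hahn_Banach_limsup[where p = p and B = "\<lambda>u. (1 + C) * BFS_norm rho u", OF BFS_subspace f p_nonneg p_add p_scale not0 p_le]
    by blast
  have \<phi>_dual: "\<phi> \<in> BFS_dual rho" by (rule BFS_dualI[OF \<phi>(1-3)])
  have \<phi>_e: "\<phi> (e j) = 0" for j
  proof (rule \<phi>(5)[OF e_BFS])
    obtain m where m: "\<sigma> m = j" using \<sigma> by (metis bij_pointE)
    \<comment> \<open>Once j has been enumerated, the partial sum of \<open>e j\<close> is
      \<open>e j\<close> itself.\<close>
    have "p n (e j) = 0" if "n > m" for n
    proof -
      have "j \<in> \<sigma> ` {..<n}" using m that by blast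
      then have "S n (e j) x = e j x" for x
        unfolding S_def coeff_e by (simp add: if_distrib[of "\<lambda>c. c * _"] sum.delta' cong: if_cong)
      then show ?thesis unfolding p_def using BFS_norm_eq_0[OF fun_subspace_zero[OF BFS_subspace]] by simp
    qed
    then show "(\<lambda>n. p n (e j)) \<longlonglongrightarrow> 0"
      by (intro tendsto_eventually eventually_mono[OF eventually_gt_at_top[of m]]) blast
  qed
  have \<phi>_test: "\<phi> g = 0" if g: "g \<in> test_functions" for g
  proof -
    note gB = test_functions_BFS[OF g]
    have "(\<lambda>n. \<phi> (\<lambda>x. g x - S n g x)) \<longlonglongrightarrow> 0"
    proof (rule reflexive_weakly_null[OF refl diff_BFS[OF gB] _ _ \<phi>_dual])
      show "BFS_norm rho (\<lambda>x. g x - S n g x) \<le> (1 + C) * BFS_norm rho g" for n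
        using p_le[OF gB] by (simp add: p_def)
      show "(\<lambda>n. LINT x|lebesgue. (g x - S n g x) * G x) \<longlonglongrightarrow> 0" if "G \<in> test_functions" for G
        using partial_sums_L2[OF complete g \<sigma>] that
        by (intro pairing_tendsto_0_if_L2 fun_subspace_diff[OF test_functions_subspace g S_test]) (simp_all add: S_def)
    qed
    \<comment> \<open>Partial sums lie in the span of the wavelets, where \<phi> vanishes, so along
      the weakly null remainders \<phi> has the constant value \<open>\<phi> g\<close>.\<close>
    moreover have "\<phi> (\<lambda>x. g x - S n g x) = \<phi> g" for n
    proof -
      have "\<phi> (S n g) = (\<Sum>i\<in>\<sigma> ` {..<n}. coeff g i * \<phi> (e i))"
        unfolding S_def by (rule BFS_dual_sum[OF \<phi>_dual]) (auto intro: e_BFS)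
      then show ?thesis using BFS_dual_diff[OF \<phi>_dual gB test_functions_BFS[OF S_test]] by (simp add: \<phi>_e)
    qed
    ultimately show ?thesis by (simp add: LIMSEQ_const_iff)
  qed
  define t where "t = (\<lambda>k. truncation k f)"
  have t: "t k \<in> test_functions" for k unfolding t_def by (rule truncation_test_function[OF BFS_measurable[OF f]])
  have ft: "(\<lambda>x. f x - t k x) \<in> BFS rho" for k
    by (rule fun_subspace_diff[OF BFS_subspace f test_functions_BFS[OF t]])
  \<comment> \<open>The lattice property bounds these differences by the norm of f. Since \<phi>
    kills every truncation, its values along this weakly null sequence are all
    \<open>\<phi> f\<close>.\<close>
  have "(\<lambda>k. \<phi> (\<lambda>x. f x - t k x)) \<longlonglongrightarrow> 0"
  proof (rule reflexive_weakly_null[OF refl ft _ _ \<phi>_dual])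
    show "BFS_norm rho (\<lambda>x. f x - t k x) \<le> BFS_norm rho f" for k
      using BFS_measurable[OF ft[of k]] by (intro BFS_dominated(2)[OF f]) (auto simp: t_def truncation_def)
    show "(\<lambda>n. LINT x|lebesgue. (f x - t n x) * G x) \<longlonglongrightarrow> 0" if "G \<in> test_functions" for G
      unfolding t_def by (rule truncation_pairing[OF f that])
  qed
  then have "(\<lambda>k::nat. \<phi> f) \<longlonglongrightarrow> 0"
    using BFS_dual_diff[OF \<phi>_dual f test_functions_BFS[OF t]] \<phi>_test[OF t] by simp
  then show False using \<phi>(4) by (simp add: LIMSEQ_const_iff)
qed

lemma sum_bij_eq: "bij \<sigma> \<Longrightarrow> (\<Sum>m<n. c (\<sigma> m) * e (\<sigma> m) x) = (\<Sum>i\<in>\<sigma> ` {..<n::nat}. c i * e i x)"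
  using inj_on_subset[OF bij_is_inj subset_UNIV, of \<sigma> "{..<n}"] by (simp add: sum.reindex)

text \<open>The coefficient functional is bounded on X, being a pairing with a test function.
  Applied to the remainders it tends to 0, yet it equals \<open>coeff f i - c i\<close> as soon as i
  has been enumerated.\<close>

lemma uncond_conv_imp_coeff:
  assumes bfn: "banach_function_norm rho" and f: "f \<in> BFS rho" and conv: "uncond_conv rho e c f"
  shows "c i = coeff f i"
proof -
  interpret banach_fun_norm rho by standard (rule bfn)
  \<comment> \<open>Any one enumeration will do, since the hypothesis grants convergence along all
    of them.\<close>
  define \<sigma> :: "nat \<Rightarrow> int \<times> int" where "\<sigma> = from_nat_into UNIV"
  have \<sigma>: "bij \<sigma>"
    unfolding \<sigma>_def by (rule bij_betw_from_nat_into) (auto simp: finite_prod)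
  obtain m where m: "\<sigma> m = i" using \<sigma> by (metis bij_pointE)
  define h where "h = (\<lambda>n x. f x - (\<Sum>i\<in>\<sigma> ` {..<n}. c i * e i x))"
  have h: "h n \<in> BFS rho" for n
    unfolding h_def by (intro fun_subspace_diff[OF BFS_subspace f] test_functions_BFS span_test) simp
  obtain C where C: "C \<ge> 0" "\<And>u. u \<in> BFS rho \<Longrightarrow> integrable lebesgue (\<lambda>x. u x * cnj (e i x))"
    "\<And>u. u \<in> BFS rho \<Longrightarrow> cmod (coeff u i) \<le> C * BFS_norm rho u"
    using BFS_pairing[OF test_functions_cnj[OF test[of i]]] unfolding coeff_def by metis
  have int: "integrable lebesgue (\<lambda>x. f x * cnj (e j x))" for j
    using BFS_pairing[OF test_functions_cnj[OF test]] f by metis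
  have "(\<lambda>n. rho (\<lambda>x. ennreal (cmod (h n x)))) \<longlonglongrightarrow> 0"
    using conv \<sigma> unfolding uncond_conv_def h_def sum_bij_eq[OF \<sigma>, symmetric] by blast
  then have "(\<lambda>n. BFS_norm rho (h n)) \<longlonglongrightarrow> 0"
    unfolding BFS_norm_def by (intro tendsto_enn2real) auto
  then have "(\<lambda>n. C * BFS_norm rho (h n)) \<longlonglongrightarrow> 0" by (rule tendsto_mult_right_zero)
  then have "(\<lambda>n. coeff (h n) i) \<longlonglongrightarrow> 0"
    by (rule Lim_null_comparison[rotated]) (simp add: C(3)[OF h])
  moreover have "\<forall>\<^sub>F n in sequentially. coeff (h n) i = coeff f i - c i"
    using eventually_gt_at_top[of m]
  proof eventually_elim
    case (elim n)
    then have "i \<in> \<sigma> ` {..<n}" using m by blast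
    then show ?case unfolding h_def using coeff_diff_span[OF int, of "\<sigma> ` {..<n}" c i] by simp
  qed
  ultimately have "(\<lambda>n::nat. coeff f i - c i) \<longlonglongrightarrow> 0" by (rule Lim_transform_eventually)
  then show ?thesis by (simp add: LIMSEQ_const_iff)
qed

end

theorem theorem2p10:
  fixes rho :: "(real \<Rightarrow> ennreal) \<Rightarrow> ennreal" and \<psi> :: "real \<Rightarrow> complex"
  assumes "banach_function_norm rho"
    and "reflexive_BFS rho"
    and "maximal_bounded rho"
    and "maximal_bounded (assoc_norm rho)"
    and "orthonormal_wavelet \<psi>"
    and "\<psi> C1_differentiable_on UNIV"
    and "compact (closure {x. \<psi> x \<noteq> 0})"
  shows "unconditional_basis rho (wavelet_fam \<psi>) \<and>
         (\<forall>f \<in> BFS rho. uncond_conv rho (wavelet_fam \<psi>) (\<lambda>i. L2_inner f (wavelet_fam \<psi> i)) f)"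
proof -
  interpret banach_fun_norm rho by standard (rule assms(1))
  obtain N L where "bump_system (wavelet_fam \<psi>) N L" using wavelet_bump_system[OF assms(5-7)] .
  then interpret bump_system "wavelet_fam \<psi>" N L .
  let ?e = "wavelet_fam \<psi>"
  have complete: "\<exists>F c. finite F \<and> L2_norm (\<lambda>x. f x - (\<Sum>i\<in>F. c i * ?e i x)) < \<epsilon>" if "f \<in> L2_space" "\<epsilon> > 0" for f \<epsilon>
    using assms(5) that unfolding orthonormal_wavelet_def by blast
  have e_BFS: "?e i \<in> BFS rho" for i by (rule test_functions_BFS[OF test])
  have conv: "uncond_conv rho ?e (coeff f) f" if f: "f \<in> BFS rho" for f
    unfolding uncond_conv_def
  proof (intro allI impI)
    fix \<sigma> :: "nat \<Rightarrow> int \<times> int" assume \<sigma>: "bij \<sigma>"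
    have "(\<lambda>x. f x - (\<Sum>i\<in>\<sigma> ` {..<n}. coeff f i * ?e i x)) \<in> BFS rho" for n
      by (intro fun_subspace_diff[OF BFS_subspace f] test_functions_BFS span_test) simp
    then have "rho (\<lambda>x. ennreal (cmod (f x - (\<Sum>i\<in>\<sigma> ` {..<n}. coeff f i * ?e i x))))
        = ennreal (BFS_norm rho (\<lambda>x. f x - (\<Sum>i\<in>\<sigma> ` {..<n}. coeff f i * ?e i x)))" for n
      by (simp add: ennreal_BFS_norm)
    then show "(\<lambda>n. rho (\<lambda>x. ennreal (cmod (f x - (\<Sum>m<n. coeff f (\<sigma> m) * ?e (\<sigma> m) x))))) \<longlonglongrightarrow> 0"
      unfolding sum_bij_eq[OF \<sigma>]
      using tendsto_ennrealI[OF partial_sums_tendsto[OF assms(1-4) complete f \<sigma>]] by simp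
  qed
  have "\<exists>!c. uncond_conv rho ?e c f" if f: "f \<in> BFS rho" for f
  proof (rule ex1I[where a = "coeff f"])
    show "uncond_conv rho ?e (coeff f) f" by (rule conv[OF f])
  next
    fix c assume "uncond_conv rho ?e c f"
    then show "c = coeff f" using uncond_conv_imp_coeff[OF assms(1) f] by blast
  qed
  moreover have "(\<lambda>i. L2_inner f (?e i)) = coeff f" for f
    by (simp add: fun_eq_iff L2_inner_def coeff_def)
  ultimately show ?thesis using conv e_BFS by (simp add: unconditional_basis_def)
qed

end
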